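(* Let $P$ be a simple (not necessarily convex) hexagon with corners labeled $0,1,\dots,5$ cyclically, $[i]$ the angle at corner $i$, and $|\bar{i}|$ the length of the side $\bar i$ joining corners $i$ and $i+1$ (indices mod $6$). Suppose $[0]+[1]+[2]=[3]+[4]+[5]=2\pi$ and $|\bar{2}|=|\bar{5}|$, and suppose moreover that each of $|\bar{0}|$, $|\bar{1}|$ differs from the lengths of all the other five sides, and $|\bar{3}|\neq|\bar{4}|$. Then there is, up to isometry of the plane, exactly one side-to-side tiling of the Euclidean plane by congruent copies of $P$ in which every vertex has degree $3$. This tiling is isohedral and periodic, and it covers a minimal torus tiling consisting of two tiles.
   Context: Tiles are congruent copies of $P$ under isometries of the plane. A tiling is side-to-side if its vertices and edges coincide with corners and sides of tiles; the degree of a vertex is the number of tiles meeting there. Isohedral: the symmetry group of the tiling acts transitively on tiles. Periodic: invariant under two linearly independent translations. A plane tiling invariant under a lattice $\Lambda$ of translations induces a tiling of the flat torus $\mathbb{C}/\Lambda$, and for a sublattice $\Lambda'\subset\Lambda$ the induced tiling of $\mathbb{C}/\Lambda'$ covers that of $\mathbb{C}/\Lambda$; the plane tiling itself covers each such torus tiling. A torus tiling $\mathcal{T}$ is minimal if whenever $\mathcal{T}$ covers a torus tiling $\mathcal{T}'$, then $\mathcal{T}=\mathcal{T}'$. *)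

theory Defs
  imports "HOL-Complex_Analysis.Complex_Analysis"
begin

text \<open>The Euclidean plane is the type \<^typ>\<open>complex\<close>. A hexagon is given by its corners
  \<open>p 0, \<dots>, p 5\<close> in cyclic order; indices are read modulo 6 and other values of \<open>p\<close> are irrelevant.\<close>

definition hexagon_path :: "(nat \<Rightarrow> complex) \<Rightarrow> real \<Rightarrow> complex" where
  "hexagon_path p =
     linepath (p 0) (p 1) +++ linepath (p 1) (p 2) +++ linepath (p 2) (p 3) +++
     linepath (p 3) (p 4) +++ linepath (p 4) (p 5) +++ linepath (p 5) (p 0)"

definition simple_hexagon :: "(nat \<Rightarrow> complex) \<Rightarrow> bool" where
  "simple_hexagon p \<longleftrightarrow> simple_path (hexagon_path p)"

definition hexagon_side :: "(nat \<Rightarrow> complex) \<Rightarrow> nat \<Rightarrow> complex set" where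
  "hexagon_side p i = closed_segment (p (i mod 6)) (p ((i + 1) mod 6))"

definition side_length :: "(nat \<Rightarrow> complex) \<Rightarrow> nat \<Rightarrow> real" where
  "side_length p i = dist (p (i mod 6)) (p ((i + 1) mod 6))"

definition counterclockwise :: "(nat \<Rightarrow> complex) \<Rightarrow> bool" where
  "counterclockwise p \<longleftrightarrow>
     (\<forall>z \<in> inside (path_image (hexagon_path p)). winding_number (hexagon_path p) z = 1)"

text \<open>The interior angle, in the interval from \<open>0\<close> to \<open>2\<pi>\<close>. For a counterclockwise boundary the
  interior lies to the left, so the angle is swept counterclockwise from the side leaving
  corner \<open>i\<close> to the side arriving there; for a clockwise boundary it is the other way round.\<close>

definition interior_angle :: "(nat \<Rightarrow> complex) \<Rightarrow> nat \<Rightarrow> real" where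
  "interior_angle p i =
     (let next = p ((i + 1) mod 6) - p (i mod 6);
          prev = p ((i + 5) mod 6) - p (i mod 6)
      in if counterclockwise p then Arg2pi (prev / next) else Arg2pi (next / prev))"

text \<open>A tile carries its corners and sides besides its point set, because the point set does not
  determine them when an angle of the polygon equals \<open>\<pi>\<close>.\<close>

datatype tile = Tile (region: "complex set") (corners: "complex set") (sides: "complex set set")

definition hexagon :: "(nat \<Rightarrow> complex) \<Rightarrow> tile" where
  "hexagon p = Tile (path_image (hexagon_path p) \<union> inside (path_image (hexagon_path p)))
                    (p ` {..<6}) (hexagon_side p ` {..<6})"

definition plane_isometry :: "(complex \<Rightarrow> complex) \<Rightarrow> bool" where
  "plane_isometry g \<longleftrightarrow> bij g \<and> (\<forall>x y. dist (g x) (g y) = dist x y)"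

definition move :: "(complex \<Rightarrow> complex) \<Rightarrow> tile \<Rightarrow> tile" where
  "move g T = Tile (g ` region T) (g ` corners T) ((`) g ` sides T)"

definition tiling :: "tile \<Rightarrow> tile set \<Rightarrow> bool" where
  "tiling P \<T> \<longleftrightarrow>
     (\<forall>T\<in>\<T>. \<exists>g. plane_isometry g \<and> T = move g P) \<and>
     (\<Union>T\<in>\<T>. region T) = UNIV \<and>
     (\<forall>T\<in>\<T>. \<forall>T'\<in>\<T>. T \<noteq> T' \<longrightarrow> interior (region T) \<inter> interior (region T') = {})"

text \<open>Two tiles meet exactly along common corners and common entire sides. Tiles need not be
  convex, so two tiles may share several sides and corners.\<close>

definition side_to_side :: "tile set \<Rightarrow> bool" where
  "side_to_side \<T> \<longleftrightarrow>
     (\<forall>T\<in>\<T>. \<forall>T'\<in>\<T>. T \<noteq> T' \<longrightarrow>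
        region T \<inter> region T' = (corners T \<inter> corners T') \<union> \<Union>(sides T \<inter> sides T'))"

definition vertices :: "tile set \<Rightarrow> complex set" where
  "vertices \<T> = (\<Union>T\<in>\<T>. corners T)"

definition vertex_degree :: "tile set \<Rightarrow> complex \<Rightarrow> nat" where
  "vertex_degree \<T> v = card {T \<in> \<T>. v \<in> region T}"

definition symmetry :: "tile set \<Rightarrow> (complex \<Rightarrow> complex) \<Rightarrow> bool" where
  "symmetry \<T> g \<longleftrightarrow> plane_isometry g \<and> move g ` \<T> = \<T>"

definition isohedral :: "tile set \<Rightarrow> bool" where
  "isohedral \<T> \<longleftrightarrow> (\<forall>T\<in>\<T>. \<forall>T'\<in>\<T>. \<exists>g. symmetry \<T> g \<and> move g T = T')"

definition periodic :: "tile set \<Rightarrow> bool" where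
  "periodic \<T> \<longleftrightarrow>
     (\<exists>u v. u \<noteq> v \<and> independent {u, v} \<and> symmetry \<T> ((+) u) \<and> symmetry \<T> ((+) v))"

definition plane_lattice :: "complex set \<Rightarrow> bool" where
  "plane_lattice \<Lambda> \<longleftrightarrow>
     (\<exists>u v. u \<noteq> v \<and> independent {u, v} \<and>
            \<Lambda> = {of_int m * u + of_int n * v | m n. True})"

definition invariant_under :: "complex set \<Rightarrow> tile set \<Rightarrow> bool" where
  "invariant_under \<Lambda> \<T> \<longleftrightarrow> (\<forall>l\<in>\<Lambda>. symmetry \<T> ((+) l))"

text \<open>The tiling of the flat torus \<open>\<complex>/\<Lambda>\<close> induced by a \<open>\<Lambda>\<close>-invariant plane tiling. The torus is
  recorded by \<open>\<Lambda>\<close>, and a tile of the torus by the \<open>\<Lambda>\<close>-orbit of plane tiles lying over it (a torus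
  tile may touch itself along its boundary, so its image in \<open>\<complex>/\<Lambda>\<close> need not be a hexagon).\<close>

type_synonym torus_tiling = "complex set \<times> tile set set"

definition induced_torus_tiling :: "complex set \<Rightarrow> tile set \<Rightarrow> torus_tiling" where
  "induced_torus_tiling \<Lambda> \<T> = (\<Lambda>, (\<lambda>T. {move ((+) l) T | l. l \<in> \<Lambda>}) ` \<T>)"

definition torus_tiles :: "torus_tiling \<Rightarrow> tile set set" where
  "torus_tiles S = snd S"

definition plane_covers :: "tile set \<Rightarrow> torus_tiling \<Rightarrow> bool" where
  "plane_covers \<T> S \<longleftrightarrow>
     (\<exists>P \<Lambda>. tiling P \<T> \<and> plane_lattice \<Lambda> \<and> invariant_under \<Lambda> \<T> \<and> S = induced_torus_tiling \<Lambda> \<T>)"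

definition torus_covers :: "torus_tiling \<Rightarrow> torus_tiling \<Rightarrow> bool" where
  "torus_covers S' S \<longleftrightarrow>
     (\<exists>P \<T> \<Lambda>' \<Lambda>. tiling P \<T> \<and> plane_lattice \<Lambda>' \<and> plane_lattice \<Lambda> \<and> \<Lambda>' \<subseteq> \<Lambda> \<and>
        invariant_under \<Lambda> \<T> \<and>
        S' = induced_torus_tiling \<Lambda>' \<T> \<and> S = induced_torus_tiling \<Lambda> \<T>)"

definition minimal_torus_tiling :: "torus_tiling \<Rightarrow> bool" where
  "minimal_torus_tiling S \<longleftrightarrow> (\<forall>S'. torus_covers S S' \<longrightarrow> S = S')"

definition degree3_tiling :: "(nat \<Rightarrow> complex) \<Rightarrow> tile set \<Rightarrow> bool" where
  "degree3_tiling p \<T> \<longleftrightarrow>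
     tiling (hexagon p) \<T> \<and> side_to_side \<T> \<and> (\<forall>v \<in> vertices \<T>. vertex_degree \<T> v = 3)"

end

theory Submission
  imports Defs "HOL-Library.Groups_Big_Fun"
begin

text \<open>The angle condition makes the sides \<open>p\<^sub>2 p\<^sub>3\<close> and \<open>p\<^sub>0 p\<^sub>5\<close> translates of each
  other by \<open>u = p\<^sub>2 - p\<^sub>0\<close>. Hence the images of the hexagon under the group generated by the half-turns
  about the midpoints of the sides \<open>0, 1, 3, 4\<close> fit together along whole sides: the translates by
  multiples of \<open>u\<close> form strips bounded by two zigzags, each invariant under half-turns.

  To see that these images tile the plane although the hexagon need not be convex, count with
  signs how often a ray from a point \<open>z\<close>, transversal to \<open>u\<close>, crosses the boundaries of all tiles.
  For a single tile this is the winding number. Sides shared by two tiles cancel, so the sum over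
  a block of rows telescopes to the crossings of two far away zigzags, which is \<open>\<plusminus>1\<close>. So every
  point off the sides lies in exactly one tile.

  Conversely, in a tiling of degree 3 the unique lengths of the sides \<open>0\<close> and \<open>1\<close> force the
  neighbours across these sides, at corner \<open>1\<close>, to be the half-turn images; hence the whole strip is
  present, and then the lengths of the sides \<open>3\<close> and \<open>4\<close> force the half-turn about side \<open>3\<close>.
  Therefore the tiling contains, and so equals, an isometric copy of the orbit. The unequal side
  lengths also rule out symmetries of the hexagon, so the lattice of translations is not larger
  than the obvious one, modulo which there are two tiles.\<close>

section \<open>Plane isometries\<close>

text \<open>The second period \<open>w\<close> is the half-turn about the midpoint of side 0
  followed by that about side 3, just as \<open>u\<close> comes from sides 0 and 1. Whether a
  half-turn is applied at all distinguishes the two tiles of the torus. Crossings are read off as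
  jumps of \<open>Arg\<close> at its branch cut. The count is then an exact integer identity with no
  exception for corners on the ray, and it only requires that the point lie off all sides; such
  points are dense, and local finiteness carries covering over to all points. The orientation of the
  hexagon is never determined: it enters as one sign common to all tiles, and a number of tiles with
  absolute value 1 is 1. Degree 3 is shown without adding angles: three tiles sharing sides
  cyclically at a point fill a neighbourhood because a punctured disc is connected. In the converse,
  sides 2 and 5 may be as long as side 3 or 4, so lengths alone do not determine the tile across
  side 3. The strip has to come first, since it accounts for both tiles at each side 2 and
  5.\<close>

lemma complex_eq_or_cnj:
  assumes "norm (w::complex) = norm z" "norm (w - 1) = norm (z - 1)"
  shows "w = z \<or> w = cnj z"
proof -
  have 1: "(Re w)\<^sup>2 + (Im w)\<^sup>2 = (Re z)\<^sup>2 + (Im z)\<^sup>2"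
    using assms(1) by (simp add: cmod_def)
  have 2: "(Re w - 1)\<^sup>2 + (Im w)\<^sup>2 = (Re z - 1)\<^sup>2 + (Im z)\<^sup>2"
    using assms(2) by (simp add: cmod_def)
  have "Re w = Re z" using 1 2 by (simp add: power2_eq_square algebra_simps)
  moreover from this 1 have "(Im w)\<^sup>2 = (Im z)\<^sup>2" by simp
  then have "Im w = Im z \<or> Im w = - Im z" by (simp add: power2_eq_iff)
  ultimately show ?thesis by (auto simp: complex_eq_iff)
qed

text \<open>Normalising \<open>g\<close> by its values at 0 and 1 leaves a map \<open>w\<close> that
  sends each point to itself or to its conjugate. The image of \<open>\<i>\<close> decides for all
  points at once: a point treated the other way would be equidistant from \<open>\<i>\<close> and
  \<open>- \<i>\<close>, hence real.\<close>

lemma plane_isometry_cases: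
  assumes "plane_isometry g"
  obtains (direct) a b where "norm b = 1" "g = (\<lambda>z. a + b * z)"
  | (opposite) a b where "norm b = 1" "g = (\<lambda>z. a + b * cnj z)"
proof -
  define a b where "a = g 0" and "b = g 1 - g 0"
  define w where "w z = (g z - a) / b" for z
  have iso: "norm (g x - g y) = norm (x - y)" for x y
    using assms by (simp add: plane_isometry_def dist_norm)
  have b: "norm b = 1" using iso[of 1 0] by (simp add: b_def)
  then have b0: "b \<noteq> 0" by auto
  have wd: "norm (w x - w y) = norm (x - y)" for x y
  proof -
    have "w x - w y = (g x - g y) / b" by (simp add: w_def diff_divide_distrib)
    then show ?thesis using b iso by (simp add: norm_divide)
  qed
  have w01: "w 0 = 0" "w 1 = 1" using b0 by (simp_all add: w_def a_def b_def)
  have wz: "w z = z \<or> w z = cnj z" for z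
    using wd[of z 0] wd[of z 1] by (intro complex_eq_or_cnj) (simp_all add: w01)
  have g: "g z = a + b * w z" for z using b0 by (simp add: w_def)
  consider "w \<i> = \<i>" | "w \<i> = - \<i>" using wz[of \<i>] by auto
  then show ?thesis
  proof cases
    case 1
    have "w z = z" for z
    proof (rule ccontr)
      assume n: "w z \<noteq> z"
      then have c: "w z = cnj z" using wz by auto
      have "norm (cnj z - \<i>) = norm (z - \<i>)" using wd[of z \<i>] by (simp add: c 1)
      then have "Im z = 0" by (simp add: cmod_def power2_eq_square algebra_simps)
      then show False using n c by (simp add: complex_eq_iff)
    qed
    then show ?thesis using that(1)[OF b] g by (auto simp: fun_eq_iff)
  next
    case 2
    have "w z = cnj z" for z
    proof (rule ccontr)
      assume n: "w z \<noteq> cnj z"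
      then have c: "w z = z" using wz by auto
      have "norm (z + \<i>) = norm (z - \<i>)" using wd[of z \<i>] by (simp add: c 2)
      then have "Im z = 0" by (simp add: cmod_def power2_eq_square algebra_simps)
      then show False using n c by (simp add: complex_eq_iff)
    qed
    then show ?thesis using that(2)[OF b] g by (auto simp: fun_eq_iff)
  qed
qed

text \<open>Two image points leave one direct and one opposite candidate; later the ends of a shared
  side play the roles of \<open>a\<close> and \<open>b\<close>.\<close>

lemma plane_isometry_determined:
  assumes "plane_isometry g" "a \<noteq> b"
  shows "g = (\<lambda>z. g a + (z - a) / (b - a) * (g b - g a)) \<or>
         g = (\<lambda>z. g a + cnj ((z - a) / (b - a)) * (g b - g a))"
  using assms(1)
proof (cases rule: plane_isometry_cases)
  case (direct c d)
  then show ?thesis using assms(2) by (intro disjI1 ext) (simp add: field_simps)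
next
  case (opposite c d)
  have "cnj (b - a) \<noteq> 0" using assms(2) by simp
  with opposite show ?thesis using assms(2)
    by (intro disjI2 ext) (simp add: field_simps)
qed

lemma plane_isometry_compose:
  "plane_isometry f \<Longrightarrow> plane_isometry g \<Longrightarrow> plane_isometry (f \<circ> g)"
  by (auto simp: plane_isometry_def bij_comp)

lemma plane_isometry_inv:
  assumes "plane_isometry g" shows "plane_isometry (inv g)"
  using assms unfolding plane_isometry_def
  by (metis bij_imp_bij_inv bij_inv_eq_iff)

lemma plane_isometry_translation: "plane_isometry (\<lambda>z. z + t)"
  by (auto simp: plane_isometry_def bij_def inj_def surj_def dist_norm intro: exI[of _ "_ - t"])

lemma plane_isometry_halfturn: "plane_isometry (\<lambda>z. c - z)"
  by (auto simp: plane_isometry_def bij_def inj_def surj_def dist_norm norm_minus_commute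
      intro: exI[of _ "c - _"])

lemma plane_isometry_continuous:
  assumes "plane_isometry g" shows "continuous_on S g"
  using assms by (cases rule: plane_isometry_cases) (auto intro!: continuous_intros)

lemma plane_isometry_bij: "plane_isometry g \<Longrightarrow> bij g"
  by (simp add: plane_isometry_def)

lemma plane_isometry_inj: "plane_isometry g \<Longrightarrow> inj g"
  by (simp add: plane_isometry_def bij_is_inj)

lemma plane_isometry_bounded:
  assumes "plane_isometry g" "bounded S" shows "bounded (g ` S)"
proof -
  obtain e where "\<forall>y\<in>S. dist undefined y \<le> e" using assms(2) bounded_any_center by metis
  then have "\<forall>y\<in>g ` S. dist (g undefined) y \<le> e" using assms(1) by (auto simp: plane_isometry_def)
  then show ?thesis unfolding bounded_def by blast
qed

text \<open>Pulling back the component of \<open>g x\<close> in the complement of the image gives a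
  connected set around \<open>x\<close> that avoids \<open>S\<close>, hence part of a bounded
  component. The converse inclusion is the same fact for \<open>inv g\<close>.\<close>

lemma plane_isometry_inside_subset:
  assumes "plane_isometry g" shows "g ` inside S \<subseteq> inside (g ` S)"
proof clarify
  fix x assume x: "x \<in> inside S"
  note b = plane_isometry_bij[OF assms]
  let ?C = "connected_component_set (- (g ` S)) (g x)"
  have xS: "x \<notin> S" "bounded (connected_component_set (- S) x)" using x by (auto simp: inside_def)
  have "inv g ` ?C \<subseteq> connected_component_set (- S) x"
  proof (rule connected_component_maximal)
    show "x \<in> inv g ` ?C"
      using xS b by (intro image_eqI[of _ _ "g x"])
        (auto simp: bij_is_inj inv_f_f inj_image_mem_iff connected_component_refl_eq)
    show "connected (inv g ` ?C)"
      by (intro connected_continuous_image plane_isometry_continuous plane_isometry_inv assms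
          connected_connected_component)
    show "inv g ` ?C \<subseteq> - S"
      using connected_component_subset[of "- (g ` S)" "g x"] b
      by (auto simp: image_iff) (metis ComplD bij_inv_eq_iff image_eqI subsetD mem_Collect_eq)
  qed
  then have "bounded (g ` inv g ` ?C)"
    using xS(2) assms bounded_subset plane_isometry_bounded by metis
  moreover have "g ` inv g ` ?C = ?C" using b by (simp add: image_f_inv_f bij_is_surj)
  ultimately show "g x \<in> inside (g ` S)"
    using xS b by (auto simp: inside_def bij_is_inj inj_image_mem_iff)
qed

lemma plane_isometry_inside:
  assumes "plane_isometry g" shows "inside (g ` S) = g ` inside S"
proof
  have b: "bij g" by (rule plane_isometry_bij[OF assms])
  have "inv g ` inside (g ` S) \<subseteq> inside (inv g ` g ` S)"
    by (rule plane_isometry_inside_subset[OF plane_isometry_inv[OF assms]])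
  then have "g ` inv g ` inside (g ` S) \<subseteq> g ` inside S"
    using b by (simp add: bij_is_inj image_mono)
  then show "inside (g ` S) \<subseteq> g ` inside S" using b by (simp add: image_f_inv_f bij_is_surj)
qed (rule plane_isometry_inside_subset[OF assms])

lemma plane_isometry_linepath:
  assumes "plane_isometry g" shows "g \<circ> linepath a b = linepath (g a) (g b)"
  using assms
  by (cases rule: plane_isometry_cases)
     (auto simp: linepath_def fun_eq_iff scaleR_conv_of_real algebra_simps)

lemma plane_isometry_closed_segment:
  assumes "plane_isometry g" shows "g ` closed_segment a b = closed_segment (g a) (g b)"
  using plane_isometry_linepath[OF assms, of a b]
  by (metis path_image_compose path_image_linepath)

lemma hexagon_path_compose:
  assumes "plane_isometry g" shows "hexagon_path (g \<circ> p) = g \<circ> hexagon_path p"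
  by (simp add: hexagon_path_def path_compose_join plane_isometry_linepath[OF assms])

lemma hexagon_side_compose:
  assumes "plane_isometry g" shows "hexagon_side (g \<circ> p) i = g ` hexagon_side p i"
  by (simp add: hexagon_side_def plane_isometry_closed_segment[OF assms])

text \<open>From here on every congruent copy of the tile can be written
  \<open>hexagon (g \<circ> p)\<close>, so that its corners and sides keep the labels of
  \<open>p\<close>.\<close>

lemma move_hexagon:
  assumes "plane_isometry g" shows "move g (hexagon p) = hexagon (g \<circ> p)"
proof -
  have "hexagon_side (g \<circ> p) = (`) g \<circ> hexagon_side p"
    by (simp add: fun_eq_iff hexagon_side_compose[OF assms])
  then show ?thesis
    by (simp add: move_def hexagon_def hexagon_path_compose[OF assms] path_image_compose
        plane_isometry_inside[OF assms] image_Un image_comp)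
qed

lemma simple_hexagon_compose:
  assumes "plane_isometry g" "simple_hexagon p" shows "simple_hexagon (g \<circ> p)"
  unfolding simple_hexagon_def hexagon_path_compose[OF assms(1)]
  using assms
  by (intro simple_path_continuous_image)
     (auto simp: simple_hexagon_def plane_isometry_continuous intro: inj_on_subset[OF plane_isometry_inj])

lemma side_length_compose:
  assumes "plane_isometry g" shows "side_length (g \<circ> p) i = side_length p i"
  using assms by (simp add: side_length_def plane_isometry_def)

lemma move_compose: "move f (move g T) = move (f \<circ> g) T"
  by (simp add: move_def image_comp o_def)

lemma move_id: "move id T = T"
  by (cases T) (simp add: move_def)

section \<open>Simple hexagons\<close>

lemma hexagon_sides_simps:
  "hexagon_side q 0 = closed_segment (q 0) (q 1)"
  "hexagon_side q 1 = closed_segment (q 1) (q 2)"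
  "hexagon_side q 2 = closed_segment (q 2) (q 3)"
  "hexagon_side q 3 = closed_segment (q 3) (q 4)"
  "hexagon_side q 4 = closed_segment (q 4) (q 5)"
  "hexagon_side q 5 = closed_segment (q 5) (q 0)"
  by (simp_all add: hexagon_side_def flip: numeral_2_eq_2)

lemma less_6_cases:
  assumes "i < (6::nat)"
  obtains "i = 0" | "i = 1" | "i = 2" | "i = 3" | "i = 4" | "i = 5"
  using assms by linarith

lemma path_image_hexagon_path:
  "path_image (hexagon_path q) = \<Union> (sides (hexagon q))"
proof -
  have "{..<6} = {0, 1, 2, 3, 4, 5::nat}" by auto
  then show ?thesis
    by (simp only: hexagon_def tile.sel image_insert image_empty hexagon_sides_simps hexagon_path_def)
       (simp add: path_image_join)
qed

lemma hexagon_path_loop: "pathfinish (hexagon_path q) = pathstart (hexagon_path q)"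
  by (simp add: hexagon_path_def)

lemma path_hexagon_path: "path (hexagon_path q)"
  by (simp add: hexagon_path_def)

text \<open>The closed path is split one segment at a time. The first cut of a loop allows two
  common points, each later cut of an arc only the joint, which is why just the first of the
  intersection facts is a disjunction.\<close>

lemma simple_hexagon_arcs:
  assumes "simple_hexagon q"
  shows "q 0 \<noteq> q 1" "q 1 \<noteq> q 2" "q 2 \<noteq> q 3" "q 3 \<noteq> q 4" "q 4 \<noteq> q 5" "q 5 \<noteq> q 0"
    and "\<And>x j. x \<in> hexagon_side q 0 \<Longrightarrow> j \<in> {1,2,3,4,5} \<Longrightarrow> x \<in> hexagon_side q j \<Longrightarrow> x = q 0 \<or> x = q 1"
    and "\<And>x j. x \<in> hexagon_side q 1 \<Longrightarrow> j \<in> {2,3,4,5} \<Longrightarrow> x \<in> hexagon_side q j \<Longrightarrow> x = q 2"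
    and "\<And>x j. x \<in> hexagon_side q 2 \<Longrightarrow> j \<in> {3,4,5} \<Longrightarrow> x \<in> hexagon_side q j \<Longrightarrow> x = q 3"
    and "\<And>x j. x \<in> hexagon_side q 3 \<Longrightarrow> j \<in> {4,5} \<Longrightarrow> x \<in> hexagon_side q j \<Longrightarrow> x = q 4"
    and "\<And>x. x \<in> hexagon_side q 4 \<Longrightarrow> x \<in> hexagon_side q 5 \<Longrightarrow> x = q 5"
proof -
  let ?l = "\<lambda>i j. linepath (q i) (q j)"
  let ?g5 = "?l 4 5 +++ ?l 5 0"
  let ?g4 = "?l 3 4 +++ ?g5"
  let ?g3 = "?l 2 3 +++ ?g4"
  let ?g2 = "?l 1 2 +++ ?g3"
  have 0: "arc (?l 0 1)" "arc ?g2" "path_image (?l 0 1) \<inter> path_image ?g2 \<subseteq> {q 0, q 1}"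
    using assms simple_path_join_loop_eq[of ?g2 "?l 0 1"]
    by (simp_all add: simple_hexagon_def hexagon_path_def)
  have 1: "arc (?l 1 2)" "arc ?g3" "path_image (?l 1 2) \<inter> path_image ?g3 \<subseteq> {q 2}"
    using 0(2) arc_join_eq[of "?l 1 2" ?g3] by simp_all
  have 2: "arc (?l 2 3)" "arc ?g4" "path_image (?l 2 3) \<inter> path_image ?g4 \<subseteq> {q 3}"
    using 1(2) arc_join_eq[of "?l 2 3" ?g4] by simp_all
  have 3: "arc (?l 3 4)" "arc ?g5" "path_image (?l 3 4) \<inter> path_image ?g5 \<subseteq> {q 4}"
    using 2(2) arc_join_eq[of "?l 3 4" ?g5] by simp_all
  have 4: "arc (?l 4 5)" "arc (?l 5 0)" "path_image (?l 4 5) \<inter> path_image (?l 5 0) \<subseteq> {q 5}"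
    using 3(2) arc_join_eq[of "?l 4 5" "?l 5 0"] by simp_all
  have i5: "path_image ?g5 = hexagon_side q 4 \<union> hexagon_side q 5"
    unfolding hexagon_sides_simps by (simp add: path_image_join)
  have i4: "path_image ?g4 = hexagon_side q 3 \<union> path_image ?g5"
    unfolding hexagon_sides_simps by (simp add: path_image_join)
  have i3: "path_image ?g3 = hexagon_side q 2 \<union> path_image ?g4"
    unfolding hexagon_sides_simps by (simp add: path_image_join)
  have i2: "path_image ?g2 = hexagon_side q 1 \<union> path_image ?g3"
    unfolding hexagon_sides_simps by (simp add: path_image_join)
  have d: "a \<noteq> b" if "arc (linepath a b)" for a b :: complex
    using arc_distinct_ends[OF that] by simp
  show "q 0 \<noteq> q 1" "q 1 \<noteq> q 2" "q 2 \<noteq> q 3" "q 3 \<noteq> q 4" "q 4 \<noteq> q 5" "q 5 \<noteq> q 0"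
    by (rule d, rule 0 1 2 3 4)+
  show "x = q 0 \<or> x = q 1" if "x \<in> hexagon_side q 0" "j \<in> {1,2,3,4,5}" "x \<in> hexagon_side q j" for x j
  proof -
    have "hexagon_side q j \<subseteq> path_image ?g2" using that(2) i2 i3 i4 i5 by auto
    moreover have "x \<in> path_image (?l 0 1)" using that(1) by (simp only: hexagon_sides_simps path_image_linepath)
    ultimately show ?thesis using 0(3) that(3) by blast
  qed
  show "x = q 2" if "x \<in> hexagon_side q 1" "j \<in> {2,3,4,5}" "x \<in> hexagon_side q j" for x j
  proof -
    have "hexagon_side q j \<subseteq> path_image ?g3" using that(2) i3 i4 i5 by auto
    moreover have "x \<in> path_image (?l 1 2)" using that(1) by (simp only: hexagon_sides_simps path_image_linepath)
    ultimately show ?thesis using 1(3) that(3) by blast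
  qed
  show "x = q 3" if "x \<in> hexagon_side q 2" "j \<in> {3,4,5}" "x \<in> hexagon_side q j" for x j
  proof -
    have "hexagon_side q j \<subseteq> path_image ?g4" using that(2) i4 i5 by auto
    moreover have "x \<in> path_image (?l 2 3)" using that(1) by (simp only: hexagon_sides_simps path_image_linepath)
    ultimately show ?thesis using 2(3) that(3) by blast
  qed
  show "x = q 4" if "x \<in> hexagon_side q 3" "j \<in> {4,5}" "x \<in> hexagon_side q j" for x j
  proof -
    have "hexagon_side q j \<subseteq> path_image ?g5" using that(2) i5 by auto
    moreover have "x \<in> path_image (?l 3 4)" using that(1) by (simp only: hexagon_sides_simps path_image_linepath)
    ultimately show ?thesis using 3(3) that(3) by blast
  qed
  show "x = q 5" if "x \<in> hexagon_side q 4" "x \<in> hexagon_side q 5" for x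
    using 4(3) that unfolding hexagon_sides_simps by auto
qed

lemma corner_in_hexagon_side:
  assumes "i < 6"
  shows "q i \<in> hexagon_side q i" "q ((i + 1) mod 6) \<in> hexagon_side q i"
  using assms by (auto simp: hexagon_side_def)

lemma hexagon_sides_meet_at_corner:
  assumes "simple_hexagon q" "i < 6" "j < 6" "i \<noteq> j" "x \<in> hexagon_side q i" "x \<in> hexagon_side q j"
  shows "x \<in> q ` {..<6}"
proof -
  note arcs = simple_hexagon_arcs(7-)[OF assms(1), of x]
  have *: "x \<in> {q 0, q 1, q 2, q 3, q 4, q 5}"
    if "i < j" "j < 6" "x \<in> hexagon_side q i" "x \<in> hexagon_side q j" for i j
  proof -
    have "i < 6" using that by simp
    then show ?thesis
    proof (cases rule: less_6_cases)
      case 1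
      have "j \<in> {1,2,3,4,5}" using that(1,2) 1 by auto
      from arcs(1)[OF that(3)[unfolded 1] this that(4)] show ?thesis by blast
    next
      case 2
      have "j \<in> {2,3,4,5}" using that(1,2) 2 by auto
      from arcs(2)[OF that(3)[unfolded 2] this that(4)] show ?thesis by blast
    next
      case 3
      have "j \<in> {3,4,5}" using that(1,2) 3 by auto
      from arcs(3)[OF that(3)[unfolded 3] this that(4)] show ?thesis by blast
    next
      case 4
      have "j \<in> {4,5}" using that(1,2) 4 by auto
      from arcs(4)[OF that(3)[unfolded 4] this that(4)] show ?thesis by blast
    next
      case 5
      have "j = 5" using that(1,2) 5 by auto
      from arcs(5)[OF that(3)[unfolded 5] that(4)[unfolded this]] show ?thesis by blast
    next
      case 6
      then show ?thesis using that(1,2) by simp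
    qed
  qed
  have "x \<in> {q 0, q 1, q 2, q 3, q 4, q 5}"
    using * [of i j] * [of j i] assms(2-) by (metis nat_neq_iff)
  moreover have "{..<6} = {0, 1, 2, 3, 4, 5::nat}" by auto
  ultimately show ?thesis by auto
qed

text \<open>A corner on a foreign side would be a common point of that side and of the corner's own
  sides; the facts on common points then equate it with another corner.\<close>

lemma hexagon_corner_in_side:
  assumes "simple_hexagon q" "i < 6" "j < 6" "q j \<in> hexagon_side q i"
  shows "j = i \<or> j = (i + 1) mod 6"
proof -
  note arcs = simple_hexagon_arcs[OF assms(1)]
  have a0: "x = q 0 \<or> x = q 1" if "x \<in> hexagon_side q 0"
    "x \<in> hexagon_side q 1 \<or> x \<in> hexagon_side q 2 \<or> x \<in> hexagon_side q 3 \<or> x \<in> hexagon_side q 4 \<or> x \<in> hexagon_side q 5"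
    for x using arcs(7)[OF that(1)] that(2) by blast
  have a1: "x = q 2" if "x \<in> hexagon_side q 1"
    "x \<in> hexagon_side q 2 \<or> x \<in> hexagon_side q 3 \<or> x \<in> hexagon_side q 4 \<or> x \<in> hexagon_side q 5"
    for x using arcs(8)[OF that(1)] that(2) by blast
  have a2: "x = q 3" if "x \<in> hexagon_side q 2"
    "x \<in> hexagon_side q 3 \<or> x \<in> hexagon_side q 4 \<or> x \<in> hexagon_side q 5"
    for x using arcs(9)[OF that(1)] that(2) by blast
  have a3: "x = q 4" if "x \<in> hexagon_side q 3"
    "x \<in> hexagon_side q 4 \<or> x \<in> hexagon_side q 5"
    for x using arcs(10)[OF that(1)] that(2) by blast
  note a4 = arcs(11)
  have m: "q 0 \<in> hexagon_side q 0" "q 1 \<in> hexagon_side q 0" "q 1 \<in> hexagon_side q 1" "q 2 \<in> hexagon_side q 1"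
    "q 2 \<in> hexagon_side q 2" "q 3 \<in> hexagon_side q 2" "q 3 \<in> hexagon_side q 3" "q 4 \<in> hexagon_side q 3"
    "q 4 \<in> hexagon_side q 4" "q 5 \<in> hexagon_side q 4" "q 5 \<in> hexagon_side q 5" "q 0 \<in> hexagon_side q 5"
    unfolding hexagon_sides_simps by simp_all
  note ne = arcs(1-6)
  \<comment> \<open>Only consecutive corners are known to be distinct at this stage, so the
    exclusions are ordered such that equalities of distant corners are refuted by earlier
    exclusions.\<close>
  have n4: "q 4 \<notin> hexagon_side q 5" "q 4 \<notin> hexagon_side q 2" using a4 a2 m ne by metis+
  have n3: "q 3 \<notin> hexagon_side q 4" "q 3 \<notin> hexagon_side q 5" using a3 m ne by metis+
  have n0: "q 0 \<notin> hexagon_side q 3" "q 0 \<notin> hexagon_side q 2" "q 0 \<notin> hexagon_side q 4"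
    using a2 a3 a4 m ne n3 n4 by metis+
  have n0': "q 0 \<notin> hexagon_side q 1" using a1 m ne n0 by metis
  have n1: "q 1 \<notin> hexagon_side q 2" "q 1 \<notin> hexagon_side q 3" "q 1 \<notin> hexagon_side q 4" "q 1 \<notin> hexagon_side q 5"
    using a1 m ne by metis+
  have n2: "q 2 \<notin> hexagon_side q 3" "q 2 \<notin> hexagon_side q 4" "q 2 \<notin> hexagon_side q 5"
    using a2 m ne by metis+
  have n2': "q 2 \<notin> hexagon_side q 0" using a0 m ne n2 by metis
  have n3': "q 3 \<notin> hexagon_side q 1" using a1 m ne by metis
  have n3'': "q 3 \<notin> hexagon_side q 0" using a0 m n0 n1 n3 by metis
  have n4': "q 4 \<notin> hexagon_side q 1" using a1 m n4 n2 by metis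
  have n4'': "q 4 \<notin> hexagon_side q 0" using a0 m n0 n1 n4 by metis
  have n5: "q 5 \<notin> hexagon_side q 3" using a3 m n4 ne by metis
  have n5': "q 5 \<notin> hexagon_side q 2" using a2 m n5 n3 by metis
  have n5'': "q 5 \<notin> hexagon_side q 1" using a1 m n5' n2 by metis
  have n50: "q 5 \<notin> hexagon_side q 0" using a0 m n1 ne by metis
  note n = n0 n0' n1 n2 n2' n3 n3' n3'' n4 n4' n4'' n5 n5' n5'' n50
  from assms(2) show ?thesis
  proof (cases rule: less_6_cases)
    case 1 show ?thesis using assms(4) n unfolding 1 by (cases rule: less_6_cases[OF assms(3)]) simp_all
  next
    case 2 show ?thesis using assms(4) n unfolding 2 by (cases rule: less_6_cases[OF assms(3)]) simp_all
  next
    case 3 show ?thesis using assms(4) n unfolding 3 by (cases rule: less_6_cases[OF assms(3)]) simp_all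
  next
    case 4 show ?thesis using assms(4) n unfolding 4 by (cases rule: less_6_cases[OF assms(3)]) simp_all
  next
    case 5 show ?thesis using assms(4) n unfolding 5 by (cases rule: less_6_cases[OF assms(3)]) simp_all
  next
    case 6 show ?thesis using assms(4) n unfolding 6 by (cases rule: less_6_cases[OF assms(3)]) simp_all
  qed
qed

lemma hexagon_corners_distinct:
  assumes "simple_hexagon q" shows "inj_on q {..<6}"
proof (rule inj_onI)
  fix i j assume ij: "i \<in> {..<6}" "j \<in> {..<6::nat}" and e: "q i = q j"
  have "q j \<in> hexagon_side q i" "q i \<in> hexagon_side q j"
    using corner_in_hexagon_side(1)[of _ q] ij e by (metis lessThan_iff)+
  with hexagon_corner_in_side[OF assms] ij
  have "i = j \<or> j = (i + 1) mod 6" "i = j \<or> i = (j + 1) mod 6" by auto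
  then show "i = j" using ij by (auto simp: mod_Suc split: if_splits)
qed

lemma hexagon_side_inj:
  assumes "simple_hexagon q" "i < 6" "j < 6" "hexagon_side q i = hexagon_side q j"
  shows "i = j"
proof -
  have "q i \<in> hexagon_side q j" "q ((i + 1) mod 6) \<in> hexagon_side q j"
    using corner_in_hexagon_side[OF assms(2), of q] assms(4) by auto
  then have "i = j \<or> i = (j + 1) mod 6" "(i + 1) mod 6 = j \<or> (i + 1) mod 6 = (j + 1) mod 6"
    using hexagon_corner_in_side[OF assms(1,3)] assms(2) by auto
  then show ?thesis using assms(2,3) by (auto simp: mod_Suc split: if_splits)
qed

lemma hexagon_side_eq_endpoints:
  assumes "hexagon_side q i = hexagon_side q' j"
  shows "{q (i mod 6), q ((i + 1) mod 6)} = {q' (j mod 6), q' ((j + 1) mod 6)}"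
  using assms by (simp add: hexagon_side_def)

lemma hexagon_side_eq_length:
  assumes "hexagon_side q i = hexagon_side q' j" shows "side_length q i = side_length q' j"
  using hexagon_side_eq_endpoints[OF assms]
  by (auto simp: side_length_def doubleton_eq_iff dist_commute)


section \<open>Interior, boundary and the two sides of a boundary segment\<close>

lemma hexagon_jordan:
  assumes "simple_hexagon q"
  defines "S \<equiv> path_image (hexagon_path q)"
  shows "inside S \<noteq> {}" "open (inside S)" "open (outside S)" "bounded (inside S)"
    "inside S \<inter> outside S = {}" "inside S \<union> outside S = - S"
    "frontier (inside S) = S" "frontier (outside S) = S"
  using Jordan_inside_outside[OF assms(1)[unfolded simple_hexagon_def] hexagon_path_loop]
  unfolding S_def by blast+

lemma region_hexagon:
  "region (hexagon q) = path_image (hexagon_path q) \<union> inside (path_image (hexagon_path q))"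
  by (simp add: hexagon_def)

text \<open>By the Jordan curve theorem each boundary point is also a limit of outside points, so it
  cannot be interior to the closed region.\<close>

lemma interior_region_hexagon:
  assumes "simple_hexagon q"
  shows "interior (region (hexagon q)) = inside (path_image (hexagon_path q))"
proof
  note J = hexagon_jordan[OF assms]
  show "inside (path_image (hexagon_path q)) \<subseteq> interior (region (hexagon q))"
    using J(2) by (intro interior_maximal) (auto simp: region_hexagon)
  show "interior (region (hexagon q)) \<subseteq> inside (path_image (hexagon_path q))"
  proof (rule ccontr)
    assume "\<not> ?thesis"
    then obtain x where x: "x \<in> interior (region (hexagon q))" "x \<in> path_image (hexagon_path q)"
      using interior_subset[of "region (hexagon q)"] by (auto simp: region_hexagon)
    then have "x \<in> closure (outside (path_image (hexagon_path q)))"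
      using J(8) by (auto simp: frontier_def)
    then have "interior (region (hexagon q)) \<inter> outside (path_image (hexagon_path q)) \<noteq> {}"
      using x(1) open_Int_closure_eq_empty[OF open_interior] by blast
    then obtain y where "y \<in> region (hexagon q)" "y \<in> outside (path_image (hexagon_path q))"
      using interior_subset by blast
    then show False using J(5,6) unfolding region_hexagon by blast
  qed
qed

lemma closure_interior_region_hexagon:
  assumes "simple_hexagon q"
  shows "closure (interior (region (hexagon q))) = region (hexagon q)"
  using hexagon_jordan(7)[OF assms] closure_Un_frontier[of "inside (path_image (hexagon_path q))"]
  unfolding interior_region_hexagon[OF assms] unfolding region_hexagon by auto

lemma compact_region_hexagon:
  assumes "simple_hexagon q" shows "compact (region (hexagon q))"
proof -
  have "bounded (region (hexagon q))"
    using hexagon_jordan(4)[OF assms] bounded_path_image[OF path_hexagon_path]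
    by (simp add: region_hexagon)
  moreover have "closed (region (hexagon q))"
    by (metis closure_interior_region_hexagon[OF assms] closed_closure)
  ultimately show ?thesis by (simp add: compact_eq_bounded_closed)
qed

lemma interior_region_hexagon_nonempty:
  "simple_hexagon q \<Longrightarrow> interior (region (hexagon q)) \<noteq> {}"
  using hexagon_jordan(1) by (simp add: interior_region_hexagon)

lemma hexagon_boundary:
  assumes "simple_hexagon q"
  shows "region (hexagon q) = interior (region (hexagon q)) \<union> \<Union> (sides (hexagon q))"
    and "interior (region (hexagon q)) \<inter> \<Union> (sides (hexagon q)) = {}"
  unfolding interior_region_hexagon[OF assms] unfolding region_hexagon path_image_hexagon_path[symmetric]
  by (simp_all add: Un_commute inside_no_overlap)

lemma sides_hexagon: "sides (hexagon q) = hexagon_side q ` {..<6}"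
  and corners_hexagon: "corners (hexagon q) = q ` {..<6}"
  by (simp_all add: hexagon_def)

text \<open>\<open>Im ((z - x) / d)\<close> is the signed distance from the line through
  \<open>x\<close> in direction \<open>d\<close>, in units of \<open>norm d\<close>. Its sign will
  say on which side of a boundary segment a point lies.\<close>

lemma open_not_subset_line:
  fixes d x :: complex
  assumes "open U" "z \<in> U" "d \<noteq> 0"
  obtains z' where "z' \<in> U" "Im ((z' - x) / d) \<noteq> 0"
proof (cases "Im ((z - x) / d) = 0")
  case True
  obtain e where e: "e > 0" "ball z e \<subseteq> U" using assms(1,2) openE by blast
  define z' where "z' = z + of_real (e / (2 * norm d)) * \<i> * d"
  have "dist z z' < e" using e(1) assms(3) by (simp add: z'_def dist_norm norm_mult norm_divide)
  then have "z' \<in> U" using e(2) by auto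
  moreover have "(z' - x) / d = (z - x) / d + of_real (e / (2 * norm d)) * \<i>"
    using assms(3) by (simp add: z'_def field_simps)
  then have "Im ((z' - x) / d) = e / (2 * norm d)" using True by simp
  ultimately show ?thesis using that e(1) assms(3) by auto
qed (use that assms in blast)

lemma convex_halfplane: "convex {z::complex. 0 < s * Im ((z - x) / d)}"
proof -
  have "{z. 0 < s * Im ((z - x) / d)} = (\<lambda>z. s * Im (z / d)) -` {s * Im (x / d)<..}"
    by (auto simp: diff_divide_distrib algebra_simps)
  moreover have "linear (\<lambda>z. s * Im (z / d))"
  proof (rule linearI)
    show "s * Im (r *\<^sub>R b / d) = r *\<^sub>R (s * Im (b / d))" for r b
    proof -
      have "r *\<^sub>R b / d = r *\<^sub>R (b / d)" by (simp add: scaleR_conv_of_real)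
      then show ?thesis by simp
    qed
  qed (simp add: add_divide_distrib algebra_simps)
  ultimately show ?thesis by (simp add: convex_linear_vimage)
qed

lemma closed_segment_on_line:
  assumes "x \<in> closed_segment a b" "z \<in> closed_segment a (b::complex)" "d = b - a"
  shows "Im ((z - x) / d) = 0"
proof -
  obtain s t where "x = (1 - s) *\<^sub>R a + s *\<^sub>R b" "z = (1 - t) *\<^sub>R a + t *\<^sub>R b"
    using assms by (auto simp: in_segment)
  then have "x = a + of_real s * d" "z = a + of_real t * d"
    using assms(3) by (auto simp: scaleR_conv_of_real algebra_simps)
  then have "z - x = of_real (t - s) * d" by (simp add: algebra_simps)
  then show ?thesis by (cases "d = 0") auto
qed

text \<open>Near \<open>x\<close> the boundary is a straight segment. Each open half disc is
  connected and misses the boundary, so it is entirely inside or entirely outside; \<open>x\<close>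
  is in the frontier of both the inside and the outside, so the two halves differ. The sign
  \<open>\<sigma>\<close> records which one is inside.\<close>

lemma hexagon_half_disc:
  assumes q: "simple_hexagon q" and i: "i < 6"
    and x: "x \<in> hexagon_side q i" "x \<notin> corners (hexagon q)"
    and d: "d = q ((i + 1) mod 6) - q i"
  obtains e \<sigma> :: real where "e > 0" "\<sigma> = 1 \<or> \<sigma> = -1"
    "\<And>z. z \<in> ball x e \<Longrightarrow> \<sigma> * Im ((z - x) / d) > 0 \<Longrightarrow> z \<in> interior (region (hexagon q))"
    "\<And>z. z \<in> ball x e \<Longrightarrow> \<sigma> * Im ((z - x) / d) < 0 \<Longrightarrow> z \<notin> region (hexagon q)"
proof -
  let ?S = "path_image (hexagon_path q)"
  note J = hexagon_jordan[OF q]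
  have d0: "d \<noteq> 0"
  proof -
    have "i \<noteq> (i + 1) mod 6" using i by (auto simp: mod_Suc)
    then show ?thesis using hexagon_corners_distinct[OF q] i unfolding d inj_on_def
      by (metis lessThan_iff mod_less_divisor right_minus_eq zero_less_numeral)
  qed
  define K where "K = (\<Union>j\<in>{..<6} - {i}. hexagon_side q j)"
  have "closed K" by (auto simp: K_def hexagon_side_def intro!: closed_UN)
  moreover have "x \<notin> K"
    using hexagon_sides_meet_at_corner[OF q] x i by (auto simp: K_def corners_hexagon)
  ultimately obtain e where e: "e > 0" "ball x e \<subseteq> - K"
    by (metis open_Compl ComplI openE)
  have SK: "?S = hexagon_side q i \<union> K"
    using i by (auto simp: path_image_hexagon_path sides_hexagon K_def)
  define H where "H s = ball x e \<inter> {z. 0 < s * Im ((z - x) / d)}" for s :: real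
  have line: "Im ((z - x) / d) = 0" if "z \<in> hexagon_side q i" for z
    using closed_segment_on_line[of x "q i" "q ((i + 1) mod 6)" z d] x(1) that d i
    by (simp add: hexagon_side_def)
  have side: "H s \<subseteq> inside ?S \<or> H s \<subseteq> outside ?S" for s
  proof -
    have "connected (H s)" unfolding H_def by (intro convex_connected convex_Int convex_halfplane convex_ball)
    moreover have "H s \<subseteq> - ?S"
    proof
      fix z assume z: "z \<in> H s"
      have "z \<notin> K" using z e(2) by (auto simp: H_def)
      moreover have "z \<notin> hexagon_side q i" using z line[of z] by (auto simp: H_def)
      ultimately show "z \<in> - ?S" by (simp add: SK)
    qed
    then have "H s \<subseteq> inside ?S \<union> outside ?S" by (simp only: J(6))
    ultimately show ?thesis
      using J(2,3,5) unfolding connected_def by blast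
  qed
  \<comment> \<open>The line contains no nonempty open set, so an open set that accumulates at
    \<open>x\<close> meets one of the open halves.\<close>
  have meet: "\<exists>s. (s = 1 \<or> s = -1) \<and> H s \<inter> U \<noteq> {}" if "open U" "x \<in> closure U" for U
  proof -
    have "ball x e \<inter> U \<noteq> {}"
      using that e(1) open_Int_closure_eq_empty[OF open_ball, of x e U]
      by (metis IntI centre_in_ball empty_iff)
    then obtain z where z: "z \<in> ball x e \<inter> U" by blast
    obtain z' where z': "z' \<in> ball x e \<inter> U" "Im ((z' - x) / d) \<noteq> 0"
      by (rule open_not_subset_line[OF open_Int[OF open_ball \<open>open U\<close>] z d0, of x])
    show ?thesis
    proof (cases "Im ((z' - x) / d) > 0")
      case True
      then show ?thesis using z' by (intro exI[of _ 1]) (auto simp: H_def)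
    next
      case False
      then show ?thesis using z' by (intro exI[of _ "-1"]) (auto simp: H_def)
    qed
  qed
  have xS: "x \<in> ?S" using x(1) SK by auto
  obtain s where s: "s = 1 \<or> s = -1" "H s \<inter> inside ?S \<noteq> {}"
    using meet[OF J(2)] xS J(7) by (auto simp: frontier_def)
  obtain t where t: "t = 1 \<or> t = -1" "H t \<inter> outside ?S \<noteq> {}"
    using meet[OF J(3)] xS J(8) by (auto simp: frontier_def)
  have s': "H s \<subseteq> inside ?S" using side[of s] s(2) J(5) by blast
  have t': "H t \<subseteq> outside ?S" using side[of t] t(2) J(5) by blast
  have "s \<noteq> t" using s(2) s' t' J(5) by blast
  then have "t = - s" using s(1) t(1) by auto
  show ?thesis
  proof (rule that[OF e(1) s(1)])
    fix z assume "z \<in> ball x e" "s * Im ((z - x) / d) > 0"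
    then show "z \<in> interior (region (hexagon q))"
      using s' by (auto simp: interior_region_hexagon[OF q] H_def)
  next
    fix z assume "z \<in> ball x e" "s * Im ((z - x) / d) < 0"
    then have "z \<in> outside ?S" using t' \<open>t = - s\<close> by (auto simp: H_def)
    then show "z \<notin> region (hexagon q)" using J(5,6) unfolding region_hexagon by blast
  qed
qed

section \<open>Hexagons sharing sides\<close>

text \<open>A hexagon is the closure of its interior.\<close>

lemma open_meets_interior_hexagon:
  assumes "simple_hexagon q" "open U" "U \<inter> region (hexagon q) \<noteq> {}"
  shows "U \<inter> interior (region (hexagon q)) \<noteq> {}"
  using assms open_Int_closure_eq_empty[OF assms(2), of "interior (region (hexagon q))"]
  by (simp add: closure_interior_region_hexagon[OF assms(1)])

lemma side_subset_region:
  assumes "s \<in> sides (hexagon q)" shows "s \<subseteq> region (hexagon q)"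
  using assms unfolding region_hexagon path_image_hexagon_path by blast

lemma hexagon_endpoints_neq:
  assumes "simple_hexagon q" "i < 6" shows "q i \<noteq> q ((i + 1) mod 6)"
proof -
  have "i \<noteq> (i + 1) mod 6" using assms(2) by (auto simp: mod_Suc)
  then show ?thesis using hexagon_corners_distinct[OF assms(1)] assms(2) unfolding inj_on_def
    by (metis lessThan_iff mod_less_divisor zero_less_numeral)
qed

lemma side_midpoint_not_corner:
  assumes "simple_hexagon q" "i < 6"
  shows "midpoint (q i) (q ((i + 1) mod 6)) \<in> hexagon_side q i"
    "midpoint (q i) (q ((i + 1) mod 6)) \<notin> corners (hexagon q)"
proof -
  let ?m = "midpoint (q i) (q ((i + 1) mod 6))"
  show m: "?m \<in> hexagon_side q i" using assms(2) by (simp add: hexagon_side_def)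
  show "?m \<notin> corners (hexagon q)"
  proof
    assume "?m \<in> corners (hexagon q)"
    then obtain k where k: "k < 6" "?m = q k" by (auto simp: corners_hexagon)
    with m hexagon_corner_in_side[OF assms, of k] have "?m = q i \<or> ?m = q ((i + 1) mod 6)" by auto
    then show False using hexagon_endpoints_neq[OF assms] by simp
  qed
qed

lemma corner_on_side_of_other:
  assumes "simple_hexagon q" "s \<in> sides (hexagon q)" "s \<in> sides (hexagon q')"
    "v \<in> s" "v \<in> corners (hexagon q)"
  shows "v \<in> corners (hexagon q')"
proof -
  obtain i j k where *: "i < 6" "j < 6" "k < 6" "s = hexagon_side q i" "s = hexagon_side q' j" "v = q k"
    using assms by (auto simp: sides_hexagon corners_hexagon)
  have "v = q i \<or> v = q ((i + 1) mod 6)"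
    using hexagon_corner_in_side[OF assms(1) *(1,3)] assms(4) * by auto
  then have "v \<in> {q' j, q' ((j + 1) mod 6)}"
    using hexagon_side_eq_endpoints[of q i q' j] * by (metis insertCI mod_less)
  then show ?thesis using *(2) by (auto simp: corners_hexagon)
qed

text \<open>Each tile fills one of the two half discs at \<open>x\<close>, and disjoint interiors
  force opposite ones.\<close>

lemma shared_side_neighbourhood:
  assumes q: "simple_hexagon q" "simple_hexagon q'"
    and disj: "interior (region (hexagon q)) \<inter> interior (region (hexagon q')) = {}"
    and s: "s \<in> sides (hexagon q)" "s \<in> sides (hexagon q')"
    and x: "x \<in> s" "x \<notin> corners (hexagon q)"
  obtains e where "e > 0" "ball x e \<subseteq> region (hexagon q) \<union> region (hexagon q')"
proof -
  obtain i j where ij: "i < 6" "j < 6" "s = hexagon_side q i" "s = hexagon_side q' j"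
    using s by (auto simp: sides_hexagon)
  have x': "x \<notin> corners (hexagon q')"
    using corner_on_side_of_other[OF q(2) s(2,1) x(1)] x(2) by blast
  define d d' where "d = q ((i + 1) mod 6) - q i" and "d' = q' ((j + 1) mod 6) - q' j"
  have d0: "d \<noteq> 0" using hexagon_endpoints_neq[OF q(1) ij(1)] by (simp add: d_def)
  have dd: "d' = d \<or> d' = - d"
    using hexagon_side_eq_endpoints[of q i q' j] ij by (auto simp: d_def d'_def doubleton_eq_iff)
  obtain e \<sigma> where e: "e > 0" "\<sigma> = 1 \<or> \<sigma> = -1"
    "\<And>z. z \<in> ball x e \<Longrightarrow> \<sigma> * Im ((z - x) / d) > 0 \<Longrightarrow> z \<in> interior (region (hexagon q))"
    using hexagon_half_disc[OF q(1) ij(1) _ x(2) d_def] x(1) ij(3) by metis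
  obtain e' \<sigma>' where e': "e' > 0" "\<sigma>' = 1 \<or> \<sigma>' = -1"
    "\<And>z. z \<in> ball x e' \<Longrightarrow> \<sigma>' * Im ((z - x) / d') > 0 \<Longrightarrow> z \<in> interior (region (hexagon q'))"
    using hexagon_half_disc[OF q(2) ij(2) _ x' d'_def] x(1) ij(4) by metis
  \<comment> \<open>The two hexagons may run through the common side in opposite directions;
    \<open>\<tau>\<close> is the sign of the second half disc measured with the direction of the
    first.\<close>
  define \<tau> where "\<tau> = (if d' = d then \<sigma>' else - \<sigma>')"
  have \<tau>: "\<tau> = 1 \<or> \<tau> = -1" "\<sigma>' * Im ((z - x) / d') = \<tau> * Im ((z - x) / d)" for z
    using e'(2) dd by (auto simp: \<tau>_def)
  define r where "r = min e e'"
  have r: "r > 0" "ball x r \<subseteq> ball x e" "ball x r \<subseteq> ball x e'" using e(1) e'(1) by (auto simp: r_def)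
  have "\<tau> \<noteq> \<sigma>"
  proof
    assume eq: "\<tau> = \<sigma>"
    define z where "z = x + of_real (\<sigma> * (r / (2 * norm d))) * \<i> * d"
    have "norm (z - x) = r / 2" using d0 r(1) e(2) by (auto simp: z_def norm_mult norm_divide)
    then have z: "z \<in> ball x r" using r(1) by (simp add: dist_norm norm_minus_commute)
    have "(z - x) / d = of_real (\<sigma> * (r / (2 * norm d))) * \<i>" using d0 by (simp add: z_def)
    then have "Im ((z - x) / d) = \<sigma> * (r / (2 * norm d))" by simp
    then have "\<sigma> * Im ((z - x) / d) > 0" using e(2) r(1) d0 by auto
    then have "z \<in> interior (region (hexagon q)) \<inter> interior (region (hexagon q'))"
      using e(3)[of z] e'(3)[of z] \<tau>(2)[of z] z r eq by auto
    then show False using disj by blast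
  qed
  then have \<tau>': "\<tau> = - \<sigma>" using \<tau>(1) e(2) by auto
  let ?X = "region (hexagon q) \<union> region (hexagon q')"
  have in_X: "z \<in> ?X" if "z \<in> ball x r" "Im ((z - x) / d) \<noteq> 0" for z
  proof (cases "\<sigma> * Im ((z - x) / d) > 0")
    case True
    then show ?thesis using e(3)[of z] that r interior_subset by blast
  next
    case False
    then have "\<sigma>' * Im ((z - x) / d') > 0" using that(2) e(2) by (auto simp: \<tau>(2) \<tau>')
    then show ?thesis using e'(3)[of z] that r interior_subset by blast
  qed
  \<comment> \<open>Points on the line are caught because the union is closed: its complement in the
    disc would be open, hence contain points off the line.\<close>
  have "ball x r \<subseteq> ?X"
  proof
    fix z assume z: "z \<in> ball x r"
    show "z \<in> ?X"
    proof (rule ccontr)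
      assume n: "z \<notin> ?X"
      have "closed ?X" using compact_region_hexagon q by (simp add: compact_imp_closed closed_Un)
      then have "open (ball x r \<inter> - ?X)" by blast
      then obtain z' where "z' \<in> ball x r \<inter> - ?X" "Im ((z' - x) / d) \<noteq> 0"
        using open_not_subset_line[of "ball x r \<inter> - ?X" z d x] z n d0 by blast
      then show False using in_X by blast
    qed
  qed
  then show ?thesis using that r(1) by blast
qed

text \<open>At the midpoint the first two tiles already fill a disc, leaving no room for the
  interior of a third.\<close>

lemma side_shared_by_at_most_two:
  assumes "simple_hexagon q" "simple_hexagon q'" "simple_hexagon q''"
    and "interior (region (hexagon q)) \<inter> interior (region (hexagon q')) = {}"
    and "interior (region (hexagon q)) \<inter> interior (region (hexagon q'')) = {}"
    and "interior (region (hexagon q')) \<inter> interior (region (hexagon q'')) = {}"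
    and s: "s \<in> sides (hexagon q)" "s \<in> sides (hexagon q')" "s \<in> sides (hexagon q'')"
  shows False
proof -
  obtain i where i: "i < 6" "s = hexagon_side q i" using s by (auto simp: sides_hexagon)
  define x where "x = midpoint (q i) (q ((i + 1) mod 6))"
  have x: "x \<in> s" "x \<notin> corners (hexagon q)"
    using side_midpoint_not_corner[OF assms(1) i(1)] i(2) by (simp_all add: x_def)
  obtain e where e: "e > 0" "ball x e \<subseteq> region (hexagon q) \<union> region (hexagon q')"
    using shared_side_neighbourhood[OF assms(1,2,4) s(1,2) x] by blast
  have "x \<in> region (hexagon q'')" using x(1) side_subset_region[OF s(3)] by blast
  then have "ball x e \<inter> region (hexagon q'') \<noteq> {}" using e(1) centre_in_ball by blast
  then have "ball x e \<inter> interior (region (hexagon q'')) \<noteq> {}"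
    by (intro open_meets_interior_hexagon assms(3)) auto
  then have "interior (region (hexagon q'')) \<inter> region (hexagon q) \<noteq> {} \<or>
    interior (region (hexagon q'')) \<inter> region (hexagon q') \<noteq> {}" using e(2) by blast
  then show False
    using open_meets_interior_hexagon[OF assms(1) open_interior]
      open_meets_interior_hexagon[OF assms(2) open_interior] assms(5,6) by blast
qed

lemma sides_at_corner:
  assumes "simple_hexagon q" "j < 6"
  shows "{s \<in> sides (hexagon q). q j \<in> s} = {hexagon_side q j, hexagon_side q ((j + 5) mod 6)}"
proof
  show "{s \<in> sides (hexagon q). q j \<in> s} \<subseteq> {hexagon_side q j, hexagon_side q ((j + 5) mod 6)}"
  proof
    fix s assume "s \<in> {s \<in> sides (hexagon q). q j \<in> s}"
    then have s: "s \<in> sides (hexagon q)" "q j \<in> s" by auto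
    then obtain i where i: "i < 6" "s = hexagon_side q i" by (auto simp: sides_hexagon)
    have "j = i \<or> j = (i + 1) mod 6" using hexagon_corner_in_side[OF assms(1) i(1) assms(2)] s i by auto
    moreover have "(j + 5) mod 6 = i" if "j = (i + 1) mod 6" using that i(1) assms(2)
      by (auto simp: mod_Suc split: if_splits)
    ultimately show "s \<in> {hexagon_side q j, hexagon_side q ((j + 5) mod 6)}" using i(2) by auto
  qed
  have "q j \<in> hexagon_side q ((j + 5) mod 6)"
    using corner_in_hexagon_side(2)[of "(j + 5) mod 6" q] assms(2) by (simp add: mod_Suc_eq mod_simps)
  then show "{hexagon_side q j, hexagon_side q ((j + 5) mod 6)} \<subseteq> {s \<in> sides (hexagon q). q j \<in> s}"
    using corner_in_hexagon_side(1)[OF assms(2)] assms(2) by (auto simp: sides_hexagon)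
qed

text \<open>Meant for \<open>X\<close> the union of the three tiles at a vertex, whose sides there
  are shared pairwise.\<close>

lemma interior_of_union_at_noncorner:
  assumes "simple_hexagon q" "x \<in> region (hexagon q)" "x \<notin> corners (hexagon q)"
    and "region (hexagon q) \<subseteq> X"
    and nb: "\<And>s. s \<in> sides (hexagon q) \<Longrightarrow> x \<in> s \<Longrightarrow> \<exists>q'. simple_hexagon q' \<and> s \<in> sides (hexagon q') \<and>
      interior (region (hexagon q)) \<inter> interior (region (hexagon q')) = {} \<and> region (hexagon q') \<subseteq> X"
  shows "x \<in> interior X"
proof (cases "x \<in> interior (region (hexagon q))")
  case True
  then show ?thesis using interior_mono[OF assms(4)] by blast
next
  case False
  then obtain s where s: "s \<in> sides (hexagon q)" "x \<in> s"
    using hexagon_boundary(1)[OF assms(1)] assms(2) by blast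
  then obtain q' where q': "simple_hexagon q'" "s \<in> sides (hexagon q')" "region (hexagon q') \<subseteq> X"
    "interior (region (hexagon q)) \<inter> interior (region (hexagon q')) = {}"
    using nb by blast
  obtain e where "e > 0" "ball x e \<subseteq> region (hexagon q) \<union> region (hexagon q')"
    using shared_side_neighbourhood[OF assms(1) q'(1,4) s(1) q'(2) s(2) assms(3)] by blast
  then show ?thesis using assms(4) q'(3) by (meson Un_least mem_interior order_trans)
qed

text \<open>In a small punctured disc around \<open>v\<close> the union of the three tiles is
  closed, and it is open because each of the sides \<open>x\<close>, \<open>y\<close>,
  \<open>z\<close> has a tile on both sides. The punctured disc is connected and meets the union, so
  it is covered.\<close>

lemma three_hexagons_surround_vertex:
  assumes q: "simple_hexagon a" "simple_hexagon b" "simple_hexagon c"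
    and disj: "interior (region (hexagon a)) \<inter> interior (region (hexagon b)) = {}"
      "interior (region (hexagon a)) \<inter> interior (region (hexagon c)) = {}"
      "interior (region (hexagon b)) \<inter> interior (region (hexagon c)) = {}"
    and at_v: "{s \<in> sides (hexagon a). v \<in> s} = {x, y}" "{s \<in> sides (hexagon b). v \<in> s} = {x, z}"
      "{s \<in> sides (hexagon c). v \<in> s} = {y, z}"
  obtains e where "e > 0" "ball v e \<subseteq> region (hexagon a) \<union> region (hexagon b) \<union> region (hexagon c)"
proof -
  let ?X = "region (hexagon a) \<union> region (hexagon b) \<union> region (hexagon c)"
  \<comment> \<open>All that the small disc must avoid: the other corners and the sides not through
    \<open>v\<close>.\<close>
  define K where "K = (corners (hexagon a) \<union> corners (hexagon b) \<union> corners (hexagon c) - {v}) \<union>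
    \<Union> {s \<in> sides (hexagon a) \<union> sides (hexagon b) \<union> sides (hexagon c). v \<notin> s}"
  have "closed K" unfolding K_def
    by (intro closed_Un finite_imp_closed closed_Union) (auto simp: sides_hexagon corners_hexagon hexagon_side_def)
  moreover have "v \<notin> K" by (auto simp: K_def)
  ultimately obtain e where e: "e > 0" "ball v e \<subseteq> - K" by (metis open_Compl ComplI openE)
  let ?D = "ball v e - {v}"
  have "x \<in> sides (hexagon a)" "y \<in> sides (hexagon a)" "x \<in> sides (hexagon b)" "z \<in> sides (hexagon b)"
    "y \<in> sides (hexagon c)" "z \<in> sides (hexagon c)" using at_v by blast+
  note xyz = this
  have loc: "w \<in> interior ?X" if w: "w \<in> ?D" "w \<in> ?X" for w
  proof -
    have wK: "w \<notin> K" "w \<noteq> v" using w e(2) by auto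
    then have nc: "w \<notin> corners (hexagon a)" "w \<notin> corners (hexagon b)" "w \<notin> corners (hexagon c)"
      by (auto simp: K_def)
    have sv: "s \<in> {x, y}" if "s \<in> sides (hexagon a)" "w \<in> s" for s using that wK at_v(1) by (auto simp: K_def)
    have sv': "s \<in> {x, z}" if "s \<in> sides (hexagon b)" "w \<in> s" for s using that wK at_v(2) by (auto simp: K_def)
    have sv'': "s \<in> {y, z}" if "s \<in> sides (hexagon c)" "w \<in> s" for s using that wK at_v(3) by (auto simp: K_def)
    from w(2) consider "w \<in> region (hexagon a)" | "w \<in> region (hexagon b)" | "w \<in> region (hexagon c)" by blast
    then show ?thesis
    proof cases
      case 1
      show ?thesis
        by (rule interior_of_union_at_noncorner[OF q(1) 1 nc(1)]) (use sv q disj xyz in blast)+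
    next
      case 2
      show ?thesis
        by (rule interior_of_union_at_noncorner[OF q(2) 2 nc(2)]) (use sv' q disj xyz in blast)+
    next
      case 3
      show ?thesis
        by (rule interior_of_union_at_noncorner[OF q(3) 3 nc(3)]) (use sv'' q disj xyz in blast)+
    qed
  qed
  have "closed ?X" using compact_region_hexagon q by (simp add: compact_imp_closed closed_Un)
  then have oX: "open (- ?X)" by blast
  have "connected ?D" by (rule connected_punctured_ball) simp
  moreover have "?D \<subseteq> interior ?X \<union> - ?X" using loc by blast
  moreover have "interior ?X \<inter> - ?X \<inter> ?D = {}" using interior_subset[of ?X] by blast
  ultimately have alt: "interior ?X \<inter> ?D = {} \<or> - ?X \<inter> ?D = {}"
    using oX open_interior connectedD by metis
  have v: "v \<in> x" using at_v(1) by blast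
  have va: "v \<in> region (hexagon a)"
    using side_subset_region[OF xyz(1)] v by blast
  have "?D \<inter> interior ?X \<noteq> {}"
  proof -
    have "ball v e \<inter> region (hexagon a) \<noteq> {}" using va e(1) centre_in_ball by blast
    then obtain w where w: "w \<in> ball v e" "w \<in> interior (region (hexagon a))"
      using open_meets_interior_hexagon[OF q(1) open_ball, of v e] by blast
    moreover have "w \<noteq> v" using w(2) v xyz(1) hexagon_boundary(2)[OF q(1)] by blast
    moreover have "w \<in> interior ?X" using w(2) interior_mono[of "region (hexagon a)" ?X] by blast
    ultimately show ?thesis by blast
  qed
  then have "- ?X \<inter> ?D = {}" using alt by blast
  then have "ball v e \<subseteq> ?X" using va by blast
  then show ?thesis using that e(1) by blast
qed

text \<open>The two points are mirror images in the line of the side. They expose the reflections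
  that the ends of the side alone cannot rule out.\<close>

lemma hexagon_points_beside_side:
  assumes "simple_hexagon q" "i < 6" "a = q i" "b = q ((i + 1) mod 6)"
  obtains t :: real where "midpoint a b + of_real t * \<i> * (b - a) \<in> interior (region (hexagon q))"
    "midpoint a b - of_real t * \<i> * (b - a) \<notin> region (hexagon q)"
proof -
  define x where "x = midpoint a b"
  have x: "x \<in> hexagon_side q i" "x \<notin> corners (hexagon q)"
    using side_midpoint_not_corner[OF assms(1,2)] assms by (simp_all add: x_def)
  define d where "d = b - a"
  have d0: "d \<noteq> 0" using hexagon_endpoints_neq[OF assms(1,2)] assms by (simp add: d_def)
  obtain e \<sigma> where e: "e > 0" "\<sigma> = 1 \<or> \<sigma> = -1"
    "\<And>z. z \<in> ball x e \<Longrightarrow> \<sigma> * Im ((z - x) / d) > 0 \<Longrightarrow> z \<in> interior (region (hexagon q))"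
    "\<And>z. z \<in> ball x e \<Longrightarrow> \<sigma> * Im ((z - x) / d) < 0 \<Longrightarrow> z \<notin> region (hexagon q)"
    using hexagon_half_disc[OF assms(1,2) x, of d] by (metis assms(3,4) d_def)
  define t where "t = \<sigma> * (e / (2 * norm d))"
  have n: "norm (of_real t * \<i> * d) < e" using d0 e(1,2) by (auto simp: t_def norm_mult norm_divide)
  have "of_real t * \<i> * d / d = of_real t * \<i>" using d0 by simp
  then have I: "Im (of_real t * \<i> * d / d) = t" by simp
  have t: "\<sigma> * t > 0" using e(1,2) d0 by (auto simp: t_def)
  show ?thesis
  proof (rule that[of t])
    show "midpoint a b + of_real t * \<i> * (b - a) \<in> interior (region (hexagon q))"
      unfolding x_def[symmetric] d_def[symmetric]
      by (rule e(3)) (use n I t in \<open>auto simp: dist_norm\<close>)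
    show "midpoint a b - of_real t * \<i> * (b - a) \<notin> region (hexagon q)"
      unfolding x_def[symmetric] d_def[symmetric]
      by (rule e(4)) (use n I t in \<open>auto simp: dist_norm\<close>)
  qed
qed

lemma region_hexagon_compose:
  assumes "plane_isometry g"
  shows "region (hexagon (g \<circ> q)) = g ` region (hexagon q)"
  by (simp add: move_hexagon[OF assms, symmetric] move_def)

lemma interior_region_hexagon_compose:
  assumes "plane_isometry g" "simple_hexagon q"
  shows "interior (region (hexagon (g \<circ> q))) = g ` interior (region (hexagon q))"
  unfolding interior_region_hexagon[OF assms(2)]
    interior_region_hexagon[OF simple_hexagon_compose[OF assms]]
  by (simp add: hexagon_path_compose[OF assms(1)] path_image_compose plane_isometry_inside[OF assms(1)])

text \<open>The only other isometry exchanging the ends of a side is the reflection in its perpendicular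
  bisector, which keeps the tile on the same side.\<close>

lemma halfturn_of_swapped_side:
  assumes q: "simple_hexagon q" and i: "i < 6" and h: "plane_isometry h"
    and sw: "h (q i) = q ((i + 1) mod 6)" "h (q ((i + 1) mod 6)) = q i"
    and disj: "interior (region (hexagon q)) \<inter> interior (region (hexagon (h \<circ> q))) = {}"
  shows "h = (\<lambda>z. q i + q ((i + 1) mod 6) - z)"
proof -
  define a b where "a = q i" and "b = q ((i + 1) mod 6)"
  have ab: "a \<noteq> b" using hexagon_endpoints_neq[OF q i] by (simp add: a_def b_def)
  have hab: "h a = b" "h b = a" using sw by (simp_all add: a_def b_def)
  consider "h = (\<lambda>z. b + (z - a) / (b - a) * (a - b))" | "h = (\<lambda>z. b + cnj ((z - a) / (b - a)) * (a - b))"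
    using plane_isometry_determined[OF h ab] hab by auto
  then show ?thesis
  proof cases
    case 1
    have "(z - a) / (b - a) * (a - b) = a - z" for z
    proof -
      have "(z - a) / (b - a) * (a - b) = - ((z - a) / (b - a) * (b - a))"
        by (metis minus_diff_eq mult_minus_right)
      then show ?thesis using ab by simp
    qed
    then show ?thesis using 1 by (simp add: fun_eq_iff a_def b_def)
  next
    case 2
    obtain t :: real where t: "midpoint a b + of_real t * \<i> * (b - a) \<in> interior (region (hexagon q))"
      using hexagon_points_beside_side[OF q i a_def b_def] by blast
    define z where "z = midpoint a b + of_real t * \<i> * (b - a)"
    have "z - a = (b - a) * (1/2 + of_real t * \<i>)"
      by (simp add: z_def midpoint_def scaleR_conv_of_real field_simps)
    then have "(z - a) / (b - a) = 1/2 + of_real t * \<i>" using ab by simp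
    then have "cnj ((z - a) / (b - a)) = cnj (1/2 + of_real t * \<i>)" by (rule arg_cong)
    then have "cnj ((z - a) / (b - a)) = 1/2 - of_real t * \<i>" by simp
    then have "h z = b + (1/2 - of_real t * \<i>) * (a - b)" by (simp only: 2)
    also have "\<dots> = z" by (simp add: z_def midpoint_def scaleR_conv_of_real field_simps)
    finally have "h z = z" .
    then have "z \<in> h ` interior (region (hexagon q))" using t by (metis image_eqI z_def)
    then have "z \<in> interior (region (hexagon q)) \<inter> interior (region (hexagon (h \<circ> q)))"
      using t by (simp add: interior_region_hexagon_compose[OF h q] z_def)
    then show ?thesis using disj by blast
  qed
qed

text \<open>The only rival to the identity is the reflection in the line of the side, which moves an
  inner point beside the midpoint to an outer one.\<close>

lemma identity_of_fixed_side:
  assumes q: "simple_hexagon q" and i: "i < 6" and h: "plane_isometry h"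
    and fx: "h (q i) = q i" "h (q ((i + 1) mod 6)) = q ((i + 1) mod 6)"
    and eq: "region (hexagon (h \<circ> q)) = region (hexagon q)"
  shows "h = id"
proof -
  define a b where "a = q i" and "b = q ((i + 1) mod 6)"
  have ab: "a \<noteq> b" using hexagon_endpoints_neq[OF q i] by (simp add: a_def b_def)
  have hab: "h a = a" "h b = b" using fx by (simp_all add: a_def b_def)
  consider "h = (\<lambda>z. a + (z - a) / (b - a) * (b - a))" | "h = (\<lambda>z. a + cnj ((z - a) / (b - a)) * (b - a))"
    using plane_isometry_determined[OF h ab] hab by auto
  then show ?thesis
  proof cases
    case 1
    then show ?thesis using ab by (auto simp: fun_eq_iff)
  next
    case 2
    obtain t :: real where t: "midpoint a b + of_real t * \<i> * (b - a) \<in> interior (region (hexagon q))"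
      "midpoint a b - of_real t * \<i> * (b - a) \<notin> region (hexagon q)"
      using hexagon_points_beside_side[OF q i a_def b_def] by blast
    define z where "z = midpoint a b + of_real t * \<i> * (b - a)"
    have "z - a = (b - a) * (1/2 + of_real t * \<i>)"
      by (simp add: z_def midpoint_def scaleR_conv_of_real field_simps)
    then have "(z - a) / (b - a) = 1/2 + of_real t * \<i>" using ab by simp
    then have "cnj ((z - a) / (b - a)) = cnj (1/2 + of_real t * \<i>)" by (rule arg_cong)
    then have "cnj ((z - a) / (b - a)) = 1/2 - of_real t * \<i>" by simp
    then have "h z = a + (1/2 - of_real t * \<i>) * (b - a)" by (simp only: 2)
    also have "\<dots> = midpoint a b - of_real t * \<i> * (b - a)"
      by (simp add: z_def midpoint_def scaleR_conv_of_real field_simps)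
    finally have "h z \<notin> region (hexagon q)" using t(2) by simp
    moreover have "h z \<in> region (hexagon (h \<circ> q))"
      using t(1) interior_subset by (auto simp: region_hexagon_compose[OF h] z_def)
    ultimately show ?thesis using eq by simp
  qed
qed

section \<open>Signed crossings\<close>

text \<open>For a segment from \<open>a\<close> to \<open>b\<close> that misses 0 this is its signed
  crossing with the negative real axis, positive from above to below. Reading it off the jump of
  \<open>Arg\<close> also covers ends on the axis: there \<open>Arg\<close> is pi, so the axis
  belongs to the half plane \<open>0 \<le> Im\<close>.\<close>

definition crossing :: "complex \<Rightarrow> complex \<Rightarrow> int" where
  "crossing a b = (if Arg b - Arg a < - pi then 1 else if Arg b - Arg a > pi then - 1 else 0)"

lemma crossing_swap: "crossing b a = - crossing a b"
  using pi_gt_zero unfolding crossing_def by (smt (verit))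

lemma abs_crossing_le_1: "\<bar>crossing a b\<bar> \<le> 1"
  by (simp add: crossing_def)

lemma crossing_same_half:
  assumes "0 \<le> Im a \<longleftrightarrow> 0 \<le> Im b" shows "crossing a b = 0"
  using assms Arg_less_0[of a] Arg_less_0[of b] mpi_less_Arg[of a] mpi_less_Arg[of b]
    Arg_le_pi[of a] Arg_le_pi[of b]
  by (auto simp: crossing_def)

lemma crossing_right:
  assumes "0 < Re a" "0 < Re b" shows "crossing a b = 0"
  using assms Arg_Re_pos[of a] Arg_Re_pos[of b] by (auto simp: crossing_def abs_if split: if_splits)

text \<open>Between points of the left half plane the crossing is a difference of values at the
  ends; along a path such terms telescope.\<close>

lemma crossing_left:
  assumes "Re a < 0" "Re b < 0"
  shows "crossing a b = of_bool (0 \<le> Im a) - of_bool (0 \<le> Im b)"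
proof -
  have "\<bar>Arg a\<bar> > pi / 2" "\<bar>Arg b\<bar> > pi / 2"
    using assms Arg_Re_nonneg[of a] Arg_Re_nonneg[of b] by auto
  then show ?thesis
    using Arg_less_0[of a] Arg_less_0[of b] mpi_less_Arg[of a] mpi_less_Arg[of b]
      Arg_le_pi[of a] Arg_le_pi[of b]
    by (auto simp: crossing_def abs_if split: if_splits)
qed

text \<open>The real part of the winding number of a segment is below 1/2 in absolute value, so
  \<open>2 * pi\<close> times it is the principal argument of the quotient of the ends. That differs
  from the difference of arguments exactly by the jump. The factor \<open>c\<close> turns the ray
  along which crossings are counted.\<close>

lemma winding_number_linepath_crossing:
  assumes "z \<notin> closed_segment a b" "c \<noteq> 0"
  shows "2 * pi * Re (winding_number (linepath a b) z) =
    Arg (c * (b - z)) - Arg (c * (a - z)) + 2 * pi * crossing (c * (a - z)) (c * (b - z))"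
proof -
  let ?w = "winding_number (linepath a b) z"
  have n: "a - z \<noteq> 0" "b - z \<noteq> 0" using assms(1) by auto
  have "b - z = exp (2 * pi * \<i> * ?w) * (a - z)"
    using winding_number_exp_2pi[of "linepath a b" z] assms(1) by simp
  then have e: "(c * (b - z)) / (c * (a - z)) = exp (2 * pi * \<i> * ?w)" using n assms(2) by simp
  have l: "\<bar>2 * pi * Re ?w\<bar> < pi"
  proof -
    have "\<bar>2 * pi * Re ?w\<bar> = 2 * pi * \<bar>Re ?w\<bar>" by (simp add: abs_mult)
    also have "\<dots> < 2 * pi * (1 / 2)"
      using winding_number_lt_half_linepath[OF assms(1)] by (intro mult_strict_left_mono) auto
    finally show ?thesis by simp
  qed
  have I: "Im (2 * pi * \<i> * ?w) = 2 * pi * Re ?w" by simp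
  have "Arg (exp (2 * pi * \<i> * ?w)) = Im (2 * pi * \<i> * ?w)"
    by (rule Arg_exp; unfold I; use l in linarith)
  then have A: "Arg ((c * (b - z)) / (c * (a - z))) = 2 * pi * Re ?w"
    unfolding e I .
  have n': "c * (b - z) \<noteq> 0" "c * (a - z) \<noteq> 0" using n assms(2) by auto
  show ?thesis
    using A l unfolding Arg_divide'[OF n'] crossing_def by (auto split: if_splits)
qed

text \<open>Intersection number of the closed polygon with the ray of those \<open>x\<close> for
  which \<open>c * (x - z)\<close> is negative real.\<close>

definition hexagon_crossing :: "(nat \<Rightarrow> complex) \<Rightarrow> complex \<Rightarrow> complex \<Rightarrow> int" where
  "hexagon_crossing q c z =
     (let C = \<lambda>i j. crossing (c * (q i - z)) (c * (q j - z)) in C 0 1 + C 1 2 + C 2 3 + C 3 4 + C 4 5 + C 5 0)"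

text \<open>Around the closed polygon the differences of \<open>Arg\<close> cancel and only the
  jumps remain.\<close>

lemma winding_number_hexagon_path:
  assumes "z \<notin> path_image (hexagon_path q)" "c \<noteq> 0"
  shows "Re (winding_number (hexagon_path q) z) = of_int (hexagon_crossing q c z)"
proof -
  have z: "z \<notin> closed_segment (q 0) (q 1)" "z \<notin> closed_segment (q 1) (q 2)" "z \<notin> closed_segment (q 2) (q 3)"
    "z \<notin> closed_segment (q 3) (q 4)" "z \<notin> closed_segment (q 4) (q 5)" "z \<notin> closed_segment (q 5) (q 0)"
    using assms(1) by (auto simp: hexagon_path_def path_image_join)
  let ?W = "\<lambda>i j. winding_number (linepath (q i) (q j)) z"
  have "winding_number (hexagon_path q) z = ?W 0 1 + (?W 1 2 + (?W 2 3 + (?W 3 4 + (?W 4 5 + ?W 5 0))))"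
    unfolding hexagon_path_def using z by (simp add: winding_number_join path_image_join)
  then have "2 * pi * Re (winding_number (hexagon_path q) z) = 2 * pi * Re (?W 0 1) + 2 * pi * Re (?W 1 2) +
    2 * pi * Re (?W 2 3) + 2 * pi * Re (?W 3 4) + 2 * pi * Re (?W 4 5) + 2 * pi * Re (?W 5 0)"
    by (simp add: algebra_simps)
  also have "\<dots> = 2 * pi * of_int (hexagon_crossing q c z)"
    unfolding z[THEN winding_number_linepath_crossing, OF assms(2)] hexagon_crossing_def Let_def
    by (simp add: algebra_simps)
  finally show ?thesis by simp
qed

text \<open>The sign is the orientation of the hexagon. It is chosen before \<open>c\<close> and
  \<open>z\<close>, so turned and unturned tiles will count alike.\<close>

lemma hexagon_crossing_cases:
  assumes "simple_hexagon q"
  obtains \<sigma> :: int where "\<sigma> = 1 \<or> \<sigma> = -1"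
    "\<And>c z. c \<noteq> 0 \<Longrightarrow> z \<notin> path_image (hexagon_path q) \<Longrightarrow>
       hexagon_crossing q c z = \<sigma> * of_bool (z \<in> inside (path_image (hexagon_path q)))"
proof -
  let ?S = "path_image (hexagon_path q)"
  have out: "winding_number (hexagon_path q) z = 0" if "z \<notin> inside ?S" "z \<notin> ?S" for z
  proof -
    have "z \<in> outside ?S" using that hexagon_jordan(6)[OF assms] by blast
    then show ?thesis by (rule winding_number_zero_in_outside[OF path_hexagon_path hexagon_path_loop])
  qed
  have *: "hexagon_crossing q c z = \<sigma> * of_bool (z \<in> inside ?S)"
    if "\<And>z. z \<in> inside ?S \<Longrightarrow> winding_number (hexagon_path q) z = of_int \<sigma>" "c \<noteq> 0" "z \<notin> ?S" for \<sigma> c z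
  proof -
    have "real_of_int (hexagon_crossing q c z) = of_int (\<sigma> * of_bool (z \<in> inside ?S))"
      using winding_number_hexagon_path[OF that(3,2)] that(1)[of z] out[of z] that(3) by auto
    then show ?thesis by (simp only: of_int_eq_iff)
  qed
  from assms[unfolded simple_hexagon_def] show ?thesis
  proof (cases rule: simple_closed_path_winding_number_inside)
    case 1
    show ?thesis by (rule that[of 1]) (use * [of 1] 1 in auto)
  next
    case 2
    show ?thesis by (rule that[of "-1"]) (use * [of "-1"] 2 in auto)
  qed
qed

lemma Sum_any_of_bool:
  assumes "finite {k. P k}" shows "Sum_any (\<lambda>k. of_bool (P k) :: int) = int (card {k. P k})"
proof -
  have "Sum_any (\<lambda>k. of_bool (P k) :: int) = sum (\<lambda>k. of_bool (P k)) {k. P k}"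
    using assms by (intro Sum_any.expand_superset) (auto split: if_splits)
  also have "\<dots> = sum (\<lambda>k. 1) {k. P k}" by (intro sum.cong) auto
  finally show ?thesis by simp
qed

lemma Sum_any_minus:
  fixes f :: "'a \<Rightarrow> int" shows "Sum_any (\<lambda>k. - f k) = - Sum_any f"
  by (simp add: Sum_any.expand_set sum_negf)

lemma abs_Sum_any_le:
  fixes f :: "'a \<Rightarrow> int"
  assumes "finite A" "{k. f k \<noteq> 0} \<subseteq> A" "\<And>k. \<bar>f k\<bar> \<le> 1"
  shows "\<bar>Sum_any f\<bar> \<le> int (card A)"
proof -
  have "\<bar>Sum_any f\<bar> = \<bar>sum f A\<bar>" using assms by (simp add: Sum_any.expand_superset)
  also have "\<dots> \<le> sum (\<lambda>k. \<bar>f k\<bar>) A" by (rule sum_abs)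
  also have "\<dots> \<le> sum (\<lambda>k. 1) A" by (intro sum_mono assms(3))
  finally show ?thesis by simp
qed

lemma sum_int_telescope:
  fixes f :: "int \<Rightarrow> int"
  assumes "a \<le> b" shows "(\<Sum>m\<in>{a<..b}. f m - f (m - 1)) = f b - f a"
  using assms
proof (induction b rule: int_ge_induct)
  case (step b)
  then have "{a<..b + 1} = insert (b + 1) {a<..b}" by auto
  then show ?case using step by simp
qed simp

section \<open>Crossings of rows of translates by \<open>u\<close>\<close>

locale translation_hexagon =
  fixes p :: "nat \<Rightarrow> complex"
  assumes simple: "simple_hexagon p" and opposite: "p 5 - p 0 = p 3 - p 2"
begin

definition u :: complex where "u = p 2 - p 0"
definition w :: complex where "w = p 3 + p 4 - p 0 - p 1"

lemma u_nonzero: "u \<noteq> 0"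
  using inj_onD[OF hexagon_corners_distinct[OF simple], of 2 0] by (auto simp: u_def)

lemma corner_2: "p 2 = p 0 + u" and corner_3: "p 3 = p 5 + u"
  using opposite by (simp_all add: u_def algebra_simps)

text \<open>Multiplication by \<open>\<i> / u\<close> turns \<open>u\<close> into
  \<open>\<i>\<close>: a translation by \<open>u\<close> raises imaginary parts by 1, and the ray
  counted is perpendicular to \<open>u\<close>.\<close>

definition seg_crossing :: "complex \<Rightarrow> complex \<Rightarrow> complex \<Rightarrow> int" where
  "seg_crossing z a b = crossing (\<i> / u * (a - z)) (\<i> / u * (b - z))"

definition row_crossing :: "complex \<Rightarrow> complex \<Rightarrow> complex \<Rightarrow> int" where
  "row_crossing z a b = Sum_any (\<lambda>k::int. seg_crossing z (a + of_int k * u) (b + of_int k * u))"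

lemma coordinate_shift: "\<i> / u * (a + of_int k * u - z) = \<i> / u * (a - z) + of_int k * \<i>"
  using u_nonzero by (simp add: field_simps)

text \<open>A translate counts only if adding \<open>k\<close> gives the imaginary parts of its ends
  different signs, which confines \<open>k\<close> to a bounded range and makes row sums
  finite.\<close>

lemma seg_crossing_support:
  fixes z :: complex
  defines "\<alpha> \<equiv> \<lambda>a. Im (\<i> / u * (a - z))"
  shows "{k::int. seg_crossing z (a + of_int k * u) (b + of_int k * u) \<noteq> 0}
    \<subseteq> {\<lceil>- max (\<alpha> a) (\<alpha> b)\<rceil>..\<lceil>- min (\<alpha> a) (\<alpha> b)\<rceil>}"
proof
  fix k :: int assume "k \<in> {k::int. seg_crossing z (a + of_int k * u) (b + of_int k * u) \<noteq> 0}"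
  then have "\<not> (0 \<le> Im (\<i> / u * (a + of_int k * u - z)) \<longleftrightarrow> 0 \<le> Im (\<i> / u * (b + of_int k * u - z)))"
    using crossing_same_half by (auto simp: seg_crossing_def)
  then have "\<not> (0 \<le> \<alpha> a + k \<longleftrightarrow> 0 \<le> \<alpha> b + k)" unfolding coordinate_shift \<alpha>_def by simp
  then have "- max (\<alpha> a) (\<alpha> b) \<le> of_int k" "of_int k \<le> - min (\<alpha> a) (\<alpha> b)" by linarith+
  then show "k \<in> {\<lceil>- max (\<alpha> a) (\<alpha> b)\<rceil>..\<lceil>- min (\<alpha> a) (\<alpha> b)\<rceil>}"
    by (auto simp: ceiling_le_iff) linarith
qed

lemma seg_crossing_finite: "finite {k::int. seg_crossing z (a + of_int k * u) (b + of_int k * u) \<noteq> 0}"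
  using finite_subset[OF seg_crossing_support] by blast

text \<open>The bound depends neither on \<open>z\<close> nor on the position of the segment. So
  \<open>zigzag z m\<close> is bounded uniformly in \<open>m\<close>, and this is available before
  \<open>w\<close> is known to be transversal to \<open>u\<close>.\<close>

lemma row_crossing_bound: "\<bar>row_crossing z a b\<bar> \<le> \<lceil>\<bar>Im (\<i> / u * (a - b))\<bar>\<rceil> + 2"
proof -
  define \<alpha> where "\<alpha> a = Im (\<i> / u * (a - z))" for a
  let ?A = "{\<lceil>- max (\<alpha> a) (\<alpha> b)\<rceil>..\<lceil>- min (\<alpha> a) (\<alpha> b)\<rceil>}"
  have "\<bar>row_crossing z a b\<bar> \<le> int (card ?A)"
    unfolding row_crossing_def using seg_crossing_support[of z a b] abs_crossing_le_1
    by (intro abs_Sum_any_le) (auto simp: \<alpha>_def seg_crossing_def)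
  also have "\<dots> \<le> \<lceil>\<bar>\<alpha> a - \<alpha> b\<bar>\<rceil> + 2"
  proof -
    have "int (card ?A) \<le> max 0 (\<lceil>- min (\<alpha> a) (\<alpha> b)\<rceil> + 1 - \<lceil>- max (\<alpha> a) (\<alpha> b)\<rceil>)" by simp
    moreover have "of_int (\<lceil>- min (\<alpha> a) (\<alpha> b)\<rceil> - \<lceil>- max (\<alpha> a) (\<alpha> b)\<rceil>) \<le> \<bar>\<alpha> a - \<alpha> b\<bar> + 1"
      by linarith
    ultimately show ?thesis by linarith
  qed
  also have "\<alpha> a - \<alpha> b = Im (\<i> / u * (a - b))"
  proof -
    have "\<i> / u * (a - z) - \<i> / u * (b - z) = \<i> / u * (a - b)"
      by (simp only: right_diff_distrib[symmetric]) simp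
    then show ?thesis unfolding \<alpha>_def by (metis minus_complex.sel(2))
  qed
  finally show ?thesis .
qed

lemma row_crossing_swap: "row_crossing z b a = - row_crossing z a b"
  unfolding row_crossing_def seg_crossing_def by (subst crossing_swap) (simp add: Sum_any_minus)

lemma row_crossing_shift: "row_crossing z (a + u) (b + u) = row_crossing z a b"
  unfolding row_crossing_def
proof (rule Sum_any.reindex_cong[symmetric])
  show "bij (\<lambda>k::int. k + 1)" by (rule bij_plus_right)
  show "(\<lambda>k. seg_crossing z (a + of_int k * u) (b + of_int k * u)) \<circ> (\<lambda>k::int. k + 1) =
    (\<lambda>k. seg_crossing z (a + u + of_int k * u) (b + u + of_int k * u))"
    by (simp add: fun_eq_iff algebra_simps)
qed

lemma Sum_any_six_segments:
  "Sum_any (\<lambda>k::int. seg_crossing z (a0 + of_int k * u) (b0 + of_int k * u)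
     + seg_crossing z (a1 + of_int k * u) (b1 + of_int k * u) + seg_crossing z (a2 + of_int k * u) (b2 + of_int k * u)
     + seg_crossing z (a3 + of_int k * u) (b3 + of_int k * u) + seg_crossing z (a4 + of_int k * u) (b4 + of_int k * u)
     + seg_crossing z (a5 + of_int k * u) (b5 + of_int k * u)) =
   row_crossing z a0 b0 + row_crossing z a1 b1 + row_crossing z a2 b2 + row_crossing z a3 b3 +
   row_crossing z a4 b4 + row_crossing z a5 b5" (is "Sum_any ?f = _")
  and finite_six_segments: "finite {k::int. seg_crossing z (a0 + of_int k * u) (b0 + of_int k * u)
     + seg_crossing z (a1 + of_int k * u) (b1 + of_int k * u) + seg_crossing z (a2 + of_int k * u) (b2 + of_int k * u)
     + seg_crossing z (a3 + of_int k * u) (b3 + of_int k * u) + seg_crossing z (a4 + of_int k * u) (b4 + of_int k * u)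
     + seg_crossing z (a5 + of_int k * u) (b5 + of_int k * u) \<noteq> 0}"
proof -
  have fin: "finite {k::int. f k + g k \<noteq> 0}" if "finite {k. f k \<noteq> 0}" "finite {k. g k \<noteq> 0}" for f g :: "int \<Rightarrow> int"
    by (rule finite_subset[OF _ finite_UnI[OF that]]) auto
  show "Sum_any ?f = row_crossing z a0 b0 + row_crossing z a1 b1 + row_crossing z a2 b2 + row_crossing z a3 b3 +
   row_crossing z a4 b4 + row_crossing z a5 b5"
    unfolding row_crossing_def
    by (subst Sum_any.distrib; (intro fin seg_crossing_finite)?)+ simp
  show "finite {k. ?f k \<noteq> 0}" by (intro fin seg_crossing_finite)
qed

text \<open>The common boundary of rows \<open>m\<close> and \<open>m + 1\<close>. As
  \<open>p 5 + u = p 3\<close>, the translates of sides 3 and 4 join end to end into one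
  \<open>u\<close>-periodic polygonal line.\<close>

definition zigzag :: "complex \<Rightarrow> int \<Rightarrow> int" where
  "zigzag z m = row_crossing z (p 3 + of_int m * w) (p 4 + of_int m * w)
              + row_crossing z (p 4 + of_int m * w) (p 5 + of_int m * w)"

lemma hexagon_crossing_translated:
  fixes k m :: int and t :: complex
  defines "t \<equiv> of_int m * w"
  shows "hexagon_crossing p (\<i> / u) (z - (of_int k * u + of_int m * w)) =
    seg_crossing z (p 0 + t + of_int k * u) (p 1 + t + of_int k * u) + seg_crossing z (p 1 + t + of_int k * u) (p 2 + t + of_int k * u)
  + seg_crossing z (p 2 + t + of_int k * u) (p 3 + t + of_int k * u) + seg_crossing z (p 3 + t + of_int k * u) (p 4 + t + of_int k * u)
  + seg_crossing z (p 4 + t + of_int k * u) (p 5 + t + of_int k * u) + seg_crossing z (p 5 + t + of_int k * u) (p 0 + t + of_int k * u)"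
proof -
  have "p i - (z - (of_int k * u + of_int m * w)) = p i + t + of_int k * u - z" for i
    by (simp add: t_def)
  then show ?thesis unfolding hexagon_crossing_def seg_crossing_def Let_def by (simp only:)
qed

text \<open>A half-turn negates all difference vectors; negating \<open>c\<close> as well keeps the
  ray fixed in the plane, so that turned tiles are counted against the same ray.\<close>

lemma hexagon_crossing_rotated:
  fixes k m :: int and t :: complex
  defines "t \<equiv> p 0 + p 1 + of_int m * w"
  shows "hexagon_crossing p (- (\<i> / u)) (p 0 + p 1 + (of_int k * u + of_int m * w) - z) =
    seg_crossing z (t - p 0 + of_int k * u) (t - p 1 + of_int k * u) + seg_crossing z (t - p 1 + of_int k * u) (t - p 2 + of_int k * u)
  + seg_crossing z (t - p 2 + of_int k * u) (t - p 3 + of_int k * u) + seg_crossing z (t - p 3 + of_int k * u) (t - p 4 + of_int k * u)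
  + seg_crossing z (t - p 4 + of_int k * u) (t - p 5 + of_int k * u) + seg_crossing z (t - p 5 + of_int k * u) (t - p 0 + of_int k * u)"
proof -
  have "- (\<i> / u) * (p i - (p 0 + p 1 + (of_int k * u + of_int m * w) - z)) = \<i> / u * (t - p i + of_int k * u - z)" for i
  proof -
    have "p i - (p 0 + p 1 + (of_int k * u + of_int m * w) - z) = - (t - p i + of_int k * u - z)"
      by (simp add: t_def)
    then show ?thesis by (simp only: minus_mult_minus)
  qed
  then show ?thesis unfolding hexagon_crossing_def seg_crossing_def Let_def by (simp only:)
qed

text \<open>Within a row the sides 2 and 5 of adjacent translates cancel, and the sides 0 and 1
  cancel between turned and unturned tiles. The unturned sides 3 and 4 form
  \<open>zigzag z m\<close>; the turned ones are those of row \<open>m - 1\<close> run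
  backwards.\<close>

lemma row_telescopes:
  "Sum_any (\<lambda>k. hexagon_crossing p (\<i> / u) (z - (of_int k * u + of_int m * w))) +
   Sum_any (\<lambda>k. hexagon_crossing p (- (\<i> / u)) (p 0 + p 1 + (of_int k * u + of_int m * w) - z)) =
   zigzag z m - zigzag z (m - 1)"
proof -
  let ?R = "row_crossing z" and ?t = "of_int m * w" and ?c = "p 0 + p 1 + of_int m * w"
    and ?t' = "of_int (m - 1) * w"
  have t': "?t' = ?t - w" by (simp add: algebra_simps)
  have P: "?R (p 2 + ?t) (p 3 + ?t) = - ?R (p 5 + ?t) (p 0 + ?t)"
    using row_crossing_shift[of z "p 0 + ?t" "p 5 + ?t"] row_crossing_swap[of z "p 0 + ?t" "p 5 + ?t"]
    by (simp add: corner_2 corner_3 ac_simps)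
  have Q: "?R (?c - p 2) (?c - p 3) = - ?R (?c - p 5) (?c - p 0)"
    using row_crossing_shift[of z "?c - p 2" "?c - p 3"] row_crossing_swap[of z "?c - p 0" "?c - p 5"]
    by (simp add: corner_2 corner_3 algebra_simps)
  have Q0: "?R (?c - p 0) (?c - p 1) = - ?R (p 0 + ?t) (p 1 + ?t)"
    using row_crossing_swap[of z "p 1 + ?t" "p 0 + ?t"] by (simp add: algebra_simps)
  have Q1: "?R (?c - p 1) (?c - p 2) = - ?R (p 1 + ?t) (p 2 + ?t)"
    using row_crossing_shift[of z "?c - p 1" "?c - p 2"] row_crossing_swap[of z "p 2 + ?t" "p 1 + ?t"]
    by (simp add: corner_2 algebra_simps)
  have Q3: "?R (?c - p 3) (?c - p 4) = - ?R (p 3 + ?t') (p 4 + ?t')"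
  proof -
    have "?c - p 3 = p 4 + ?t'" "?c - p 4 = p 3 + ?t'" by (simp_all add: t' w_def algebra_simps)
    then show ?thesis using row_crossing_swap by metis
  qed
  have Q4: "?R (?c - p 4) (?c - p 5) = - ?R (p 4 + ?t') (p 5 + ?t')"
  proof -
    have "?c - p 4 = p 5 + ?t' + u" "?c - p 5 = p 4 + ?t' + u"
      using corner_3 by (simp_all add: t' w_def algebra_simps)
    then show ?thesis using row_crossing_swap row_crossing_shift by metis
  qed
  show ?thesis
    unfolding hexagon_crossing_translated hexagon_crossing_rotated Sum_any_six_segments zigzag_def
    using P Q Q0 Q1 Q3 Q4 by simp
qed

lemma zigzag_bound: obtains B where "\<And>m. \<bar>zigzag z m\<bar> \<le> B"
proof
  fix m
  show "\<bar>zigzag z m\<bar> \<le> (\<lceil>\<bar>Im (\<i> / u * (p 3 - p 4))\<bar>\<rceil> + 2) + (\<lceil>\<bar>Im (\<i> / u * (p 4 - p 5))\<bar>\<rceil> + 2)"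
    using row_crossing_bound[of z "p 3 + of_int m * w" "p 4 + of_int m * w"]
      row_crossing_bound[of z "p 4 + of_int m * w" "p 5 + of_int m * w"]
    unfolding zigzag_def add_diff_cancel_right by linarith
qed

lemma zigzag_right:
  assumes "\<And>j. j \<in> {3, 4, 5} \<Longrightarrow> 0 < Re (\<i> / u * (p j + of_int m * w - z))"
  shows "zigzag z m = 0"
proof -
  have "Re (\<i> / u * (a + of_int k * u - z)) = Re (\<i> / u * (a - z))" for a k
    unfolding coordinate_shift by simp
  then show ?thesis
    unfolding zigzag_def row_crossing_def seg_crossing_def
    using assms by (simp add: crossing_right)
qed

text \<open>By \<open>crossing_left\<close> only the ends of each period matter. They differ by
  \<open>u\<close>, so exactly one translate of the period contributes.\<close>

lemma zigzag_left:
  assumes "\<And>j. j \<in> {3, 4, 5} \<Longrightarrow> Re (\<i> / u * (p j + of_int m * w - z)) < 0"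
  shows "zigzag z m = 1"
proof -
  define g where "g a k = (of_bool (0 \<le> Im (\<i> / u * (a + of_int m * w - z)) + of_int k) :: int)" for a and k :: int
  have R: "Re (\<i> / u * (a + of_int k * u - z)) = Re (\<i> / u * (a - z))"
   and I: "Im (\<i> / u * (a + of_int k * u - z)) = Im (\<i> / u * (a - z)) + of_int k" for a and k :: int
    unfolding coordinate_shift by simp_all
  let ?p = "\<lambda>j. p j + of_int m * w"
  have s: "seg_crossing z (?p i + of_int k * u) (?p j + of_int k * u) = g (p i) k - g (p j) k"
    if "i \<in> {3,4,5}" "j \<in> {3,4,5}" for i j and k :: int
    unfolding seg_crossing_def g_def I[symmetric]
    by (rule crossing_left) (use assms[OF that(1)] assms[OF that(2)] R in auto)
  have "zigzag z m = Sum_any (\<lambda>k. seg_crossing z (?p 3 + of_int k * u) (?p 4 + of_int k * u) +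
     seg_crossing z (?p 4 + of_int k * u) (?p 5 + of_int k * u))"
    unfolding zigzag_def row_crossing_def by (rule Sum_any.distrib[symmetric]; rule seg_crossing_finite)
  also have "\<dots> = Sum_any (\<lambda>k. g (p 3) k - g (p 5) k)" by (simp add: s)
  \<comment> \<open>The unique \<open>k\<close> for which the end at \<open>p 5\<close> has negative
    imaginary part and the end at \<open>p 3\<close>, one unit higher, has not.\<close>
  also have "(\<lambda>k. g (p 3) k - g (p 5) k) =
      (\<lambda>k. if k = \<lceil>- Im (\<i> / u * (?p 5 - z))\<rceil> - 1 then 1 else 0)"
  proof
    fix k :: int
    have "?p 3 - z = ?p 5 + of_int 1 * u - z" by (simp add: corner_3)
    then have "Im (\<i> / u * (?p 3 - z)) = Im (\<i> / u * (?p 5 - z)) + 1" by (simp only: I)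
    then show "g (p 3) k - g (p 5) k = (if k = \<lceil>- Im (\<i> / u * (?p 5 - z))\<rceil> - 1 then 1 else 0)"
      unfolding g_def by (auto simp: of_bool_def) linarith+
  qed
  finally show ?thesis by simp
qed

end

section \<open>Every generic point is covered once\<close>

lemma negligible_hexagon_path: "negligible (path_image (hexagon_path q))"
proof -
  have "negligible (closed_segment a b)" for a b :: complex
    using negligible_convex_frontier[OF convex_closed_segment[of a b]]
    by (simp add: frontier_def interior_closed_segment_ge2)
  then show ?thesis by (simp add: hexagon_path_def path_image_join negligible_Un)
qed

section \<open>Counting the tiles over a generic point\<close>

context translation_hexagon
begin

text \<open>With the translation applied after the half-turn, turned tiles of index \<open>m\<close>
  share sides 0 and 1 with unturned tiles of the same row, and sides 3 and 4 with those of row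
  \<open>m - 1\<close>.\<close>

definition motion :: "bool \<Rightarrow> int \<Rightarrow> int \<Rightarrow> complex \<Rightarrow> complex" where
  "motion e k m x = (if e then p 0 + p 1 - x else x) + (of_int k * u + of_int m * w)"

definition pullback :: "bool \<Rightarrow> int \<Rightarrow> int \<Rightarrow> complex \<Rightarrow> complex" where
  "pullback e k m z = (if e then p 0 + p 1 + (of_int k * u + of_int m * w) - z else z - (of_int k * u + of_int m * w))"

lemma motion_pullback: "motion e k m (pullback e k m z) = z" and pullback_motion: "pullback e k m (motion e k m x) = x"
  by (simp_all add: motion_def pullback_def)

lemma motion_isometry: "plane_isometry (motion e k m)"
proof (cases e)
  case True
  then have "motion e k m = (\<lambda>z. (p 0 + p 1 + (of_int k * u + of_int m * w)) - z)"
    by (simp add: fun_eq_iff motion_def)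
  then show ?thesis by (simp only: plane_isometry_halfturn)
next
  case False
  then have "motion e k m = (\<lambda>z. z + (of_int k * u + of_int m * w))" by (simp add: fun_eq_iff motion_def)
  then show ?thesis by (simp only: plane_isometry_translation)
qed

lemma mem_motion_image: "z \<in> motion e k m ` S \<longleftrightarrow> pullback e k m z \<in> S"
  by (auto simp: pullback_motion) (metis motion_pullback imageI)

definition generic :: "complex \<Rightarrow> bool" where
  "generic z \<longleftrightarrow> (\<forall>e k m. pullback e k m z \<notin> path_image (hexagon_path p))"

text \<open>The sides of all tiles form a countable union of null sets, and a nonempty open set is
  not null.\<close>

lemma generic_dense:
  assumes "open U" "U \<noteq> {}" obtains z where "z \<in> U" "generic z"
proof -
  let ?N = "\<Union>(e, k, m)\<in>UNIV. motion e k m ` path_image (hexagon_path p)"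
  have "negligible ?N"
  proof (rule negligible_countable_Union)
    show "countable (range (\<lambda>(e, k, m). motion e k m ` path_image (hexagon_path p)))" by simp
    fix S assume "S \<in> range (\<lambda>(e, k, m). motion e k m ` path_image (hexagon_path p))"
    then obtain e k m where "S = motion e k m ` path_image (hexagon_path p)" by auto
    then have "S = path_image (hexagon_path (motion e k m \<circ> p))"
      by (simp add: hexagon_path_compose[OF motion_isometry] path_image_compose)
    then show "negligible S" using negligible_hexagon_path by simp
  qed
  then have "\<not> U \<subseteq> ?N" using assms open_not_negligible negligible_subset by blast
  then obtain z where "z \<in> U" "z \<notin> ?N" by blast
  then show ?thesis using that[of z] by (auto simp: generic_def mem_motion_image)
qed

definition covering :: "complex \<Rightarrow> int \<Rightarrow> (bool \<times> int) set" where
  "covering z m = {(e, k). pullback e k m z \<in> inside (path_image (hexagon_path p))}"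

text \<open>For a generic point all winding numbers are defined, so the crossings of a row amount to
  \<open>\<sigma>\<close> times the number of its tiles over \<open>z\<close>; as
  \<open>\<sigma>\<close> is its own inverse it moves to the other side.\<close>

lemma covering_count:
  obtains \<sigma> :: int where "\<sigma> = 1 \<or> \<sigma> = -1"
    "\<And>z m. generic z \<Longrightarrow> finite (covering z m)"
    "\<And>z m. generic z \<Longrightarrow> int (card (covering z m)) = \<sigma> * (zigzag z m - zigzag z (m - 1))"
proof -
  let ?I = "inside (path_image (hexagon_path p))"
  obtain \<sigma> :: int where \<sigma>: "\<sigma> = 1 \<or> \<sigma> = -1"
    "\<And>c z. c \<noteq> 0 \<Longrightarrow> z \<notin> path_image (hexagon_path p) \<Longrightarrow> hexagon_crossing p c z = \<sigma> * of_bool (z \<in> ?I)"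
    using hexagon_crossing_cases[OF simple] by blast
  have c0: "\<i> / u \<noteq> 0" "- (\<i> / u) \<noteq> 0" using u_nonzero by auto
  have *: "finite (covering z m) \<and> int (card (covering z m)) = \<sigma> * (zigzag z m - zigzag z (m - 1))"
    if g: "generic z" for z m
  proof -
    define K where "K e = {k. pullback e k m z \<in> ?I}" for e
    have F: "hexagon_crossing p (\<i> / u) (z - (of_int k * u + of_int m * w)) = \<sigma> * of_bool (k \<in> K False)" for k
    proof -
      have "pullback False k m z \<notin> path_image (hexagon_path p)" using g by (simp add: generic_def)
      from \<sigma>(2)[OF c0(1) this] show ?thesis by (simp add: K_def pullback_def)
    qed
    have T: "hexagon_crossing p (- (\<i> / u)) (p 0 + p 1 + (of_int k * u + of_int m * w) - z) = \<sigma> * of_bool (k \<in> K True)" for k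
    proof -
      have "pullback True k m z \<notin> path_image (hexagon_path p)" using g by (simp add: generic_def)
      from \<sigma>(2)[OF c0(2) this] show ?thesis by (simp add: K_def pullback_def)
    qed
    have s0: "\<sigma> \<noteq> 0" using \<sigma>(1) by auto
    have "finite {k. hexagon_crossing p (\<i> / u) (z - (of_int k * u + of_int m * w)) \<noteq> 0}"
      unfolding hexagon_crossing_translated by (rule finite_six_segments)
    then have fF: "finite (K False)" unfolding F using s0 by simp
    have "finite {k. hexagon_crossing p (- (\<i> / u)) (p 0 + p 1 + (of_int k * u + of_int m * w) - z) \<noteq> 0}"
      unfolding hexagon_crossing_rotated by (rule finite_six_segments)
    then have fT: "finite (K True)" unfolding T using s0 by simp
    have mult: "Sum_any (\<lambda>k. \<sigma> * of_bool (k \<in> K e)) = \<sigma> * int (card (K e))" if "finite (K e)" for e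
      using Sum_any_right_distrib[of "\<lambda>k. of_bool (k \<in> K e)" \<sigma>] Sum_any_of_bool[of "\<lambda>k. k \<in> K e"] that by simp
    have "zigzag z m - zigzag z (m - 1) = \<sigma> * int (card (K False)) + \<sigma> * int (card (K True))"
      using row_telescopes[of z m] unfolding F T by (simp add: mult fF fT)
    moreover have c: "covering z m = Pair False ` K False \<union> Pair True ` K True"
      by (auto simp: covering_def K_def image_iff) (metis (full_types))+
    then have "card (covering z m) = card (K False) + card (K True)"
      using fF fT by (simp add: card_Un_disjoint card_image inj_on_def disjoint_iff image_iff)
    moreover have "\<sigma> * \<sigma> = 1" using \<sigma>(1) by auto
    ultimately show ?thesis using fF fT c by (simp add: algebra_simps flip: mult.assoc)
  qed
  then show ?thesis using that[OF \<sigma>(1)] by blast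
qed

lemma sum_covering:
  obtains \<sigma> :: int where "\<sigma> = 1 \<or> \<sigma> = -1"
    "\<And>z a b. generic z \<Longrightarrow> a \<le> b \<Longrightarrow> finite (Sigma {a<..b} (covering z)) \<and>
       int (card (Sigma {a<..b} (covering z))) = \<sigma> * (zigzag z b - zigzag z a)"
proof -
  obtain \<sigma> :: int where \<sigma>: "\<sigma> = 1 \<or> \<sigma> = -1"
    "\<And>z m. generic z \<Longrightarrow> finite (covering z m)"
    "\<And>z m. generic z \<Longrightarrow> int (card (covering z m)) = \<sigma> * (zigzag z m - zigzag z (m - 1))"
    using covering_count by blast
  show ?thesis
  proof (rule that[OF \<sigma>(1)])
    fix z and a b :: int assume g: "generic z" and ab: "a \<le> b"
    have "int (card (Sigma {a<..b} (covering z))) = (\<Sum>m\<in>{a<..b}. int (card (covering z m)))"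
      using \<sigma>(2)[OF g] by (simp add: card_SigmaI)
    also have "\<dots> = \<sigma> * (zigzag z b - zigzag z a)"
      by (simp add: \<sigma>(3)[OF g] sum_int_telescope[OF ab] flip: sum_distrib_left)
    finally show "finite (Sigma {a<..b} (covering z)) \<and>
       int (card (Sigma {a<..b} (covering z))) = \<sigma> * (zigzag z b - zigzag z a)"
      using \<sigma>(2)[OF g] by (simp add: finite_SigmaI)
  qed
qed

text \<open>If \<open>w\<close> were parallel to \<open>u\<close>, the translates of the hexagon by \<open>m w\<close> modulo \<open>u\<close> would
  accumulate, so some generic point would lie in infinitely many of them, against the bound on
  the zigzag crossings.\<close>

lemma w_not_parallel: "Im (w / u) \<noteq> 0"
proof
  assume "Im (w / u) = 0"
  then obtain t where t: "w / u = of_real t" by (metis complex_is_Real_iff Reals_cases)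
  then have wt: "w = of_real t * u" using u_nonzero by (simp add: field_simps)
  obtain z0 r where r: "r > 0" "ball z0 r \<subseteq> inside (path_image (hexagon_path p))"
    using hexagon_jordan(1,2)[OF simple] by (metis all_not_in_conv openE)
  define f where "f n = frac (real n * t)" for n :: nat
  have "\<forall>n. f n \<in> {0..1}" by (auto simp: f_def frac_ge_0 less_imp_le[OF frac_lt_1])
  then obtain l s where l: "strict_mono (s :: nat \<Rightarrow> nat)" "(f \<circ> s) \<longlonglongrightarrow> l"
    using compact_Icc[of "0::real" 1] unfolding compact_def by metis
  \<comment> \<open>Half the radius is spent on the choice of \<open>z\<close>, the other half on
    the distance of \<open>f (s n)\<close> from its limit.\<close>
  obtain z where z: "z \<in> ball (z0 + of_real l * u) (r / 2)" "generic z"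
    using generic_dense[of "ball (z0 + of_real l * u) (r / 2)"] r(1) by auto
  have "r / (2 * norm u) > 0" using r(1) u_nonzero by simp
  then obtain N where N: "\<And>n. n \<ge> N \<Longrightarrow> \<bar>f (s n) - l\<bar> < r / (2 * norm u)"
    using l(2) unfolding LIMSEQ_def by (auto simp: dist_real_def)
  have cov: "covering z (int (s n)) \<noteq> {}" if "n \<ge> N" for n
  proof -
    \<comment> \<open>This \<open>k\<close> reduces the \<open>s n\<close>-fold multiple of
      \<open>w\<close> modulo \<open>u\<close> to its fractional part.\<close>
    define k where "k = - \<lfloor>real (s n) * t\<rfloor>"
    have "of_int k * u + of_int (int (s n)) * w = of_real (f (s n)) * u"
      by (simp add: k_def f_def frac_def wt algebra_simps)
    moreover have "dist z0 (z - of_real (f (s n)) * u) < r"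
    proof -
      have "z0 - (z - of_real (f (s n)) * u) = (z0 + of_real l * u - z) + of_real (f (s n) - l) * u"
        by (simp add: algebra_simps)
      then have "norm (z0 - (z - of_real (f (s n)) * u)) \<le>
        norm (z0 + of_real l * u - z) + \<bar>f (s n) - l\<bar> * norm u"
        by (metis norm_triangle_ineq norm_mult norm_of_real)
      also have "\<dots> < r / 2 + r / 2"
      proof (rule add_strict_mono)
        show "norm (z0 + of_real l * u - z) < r / 2" using z(1) by (simp add: dist_norm)
        show "\<bar>f (s n) - l\<bar> * norm u < r / 2" using N[OF that] u_nonzero by (simp add: field_simps)
      qed
      finally show ?thesis by (simp add: dist_norm)
    qed
    ultimately have "pullback False k (int (s n)) z \<in> inside (path_image (hexagon_path p))"
      using r(2) by (auto simp: pullback_def)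
    then show ?thesis by (auto simp: covering_def)
  qed
  obtain \<sigma> :: int where \<sigma>: "\<sigma> = 1 \<or> \<sigma> = -1"
    "\<And>z a b. generic z \<Longrightarrow> a \<le> b \<Longrightarrow> finite (Sigma {a<..b} (covering z)) \<and>
       int (card (Sigma {a<..b} (covering z))) = \<sigma> * (zigzag z b - zigzag z a)"
    using sum_covering by blast
  obtain B where B: "\<And>m. \<bar>zigzag z m\<bar> \<le> B" using zigzag_bound by blast
  \<comment> \<open>Two values of \<open>zigzag\<close> differ by at most \<open>2 * B\<close>, so
    \<open>2 * B + 1\<close> nonempty rows are too many.\<close>
  define M where "M = nat (2 * B + 1)"
  define A where "A = (\<lambda>n. int (s n)) ` {N..<N + M}"
  define b where "b = int (s (N + M))"
  have inj: "inj (\<lambda>n. int (s n))" using l(1) by (auto simp: inj_def strict_mono_eq)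
  have AA: "A \<subseteq> {-1<..b}" using l(1) by (auto simp: A_def b_def strict_mono_less_eq)
  have "A \<subseteq> fst ` Sigma {-1<..b} (covering z)"
  proof
    fix m assume m: "m \<in> A"
    then have "covering z m \<noteq> {}" using cov by (auto simp: A_def)
    then show "m \<in> fst ` Sigma {-1<..b} (covering z)" using m AA by force
  qed
  moreover have fin: "finite (Sigma {-1<..b} (covering z))"
    "int (card (Sigma {-1<..b} (covering z))) = \<sigma> * (zigzag z b - zigzag z (-1))"
    using \<sigma>(2)[OF z(2), of "-1" b] by (auto simp: b_def)
  ultimately have "card A \<le> card (Sigma {-1<..b} (covering z))"
    by (meson card_image_le card_mono finite_imageI le_trans)
  moreover have "card A = M" using inj by (simp add: A_def card_image inj_on_subset)
  moreover have "\<sigma> * (zigzag z b - zigzag z (-1)) \<le> 2 * B"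
    using B[of b] B[of "-1"] \<sigma>(1) by auto
  ultimately have "int M \<le> 2 * B" using fin(2) by linarith
  then show False by (simp add: M_def split: if_splits)
qed

text \<open>By \<open>w_not_parallel\<close> each row moves along the direction of the ray by
  \<open>\<eta>\<close>, so distant zigzags lie wholly before or wholly behind \<open>z\<close>. The
  sign of \<open>\<eta>\<close> is not known, whence the absolute value.\<close>

lemma zigzag_ends:
  obtains M where "\<And>a b. a \<le> - M \<Longrightarrow> M \<le> b \<Longrightarrow> \<bar>zigzag z b - zigzag z a\<bar> = 1"
proof -
  define \<eta> where "\<eta> = Re (\<i> / u * w)"
  have \<eta>0: "\<eta> \<noteq> 0" using w_not_parallel by (simp add: \<eta>_def Re_divide Im_divide algebra_simps)
  define c where "c j = Re (\<i> / u * (p j - z))" for j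
  define C where "C = \<bar>c 3\<bar> + \<bar>c 4\<bar> + \<bar>c 5\<bar> + 1"
  have Re: "Re (\<i> / u * (p j + of_int m * w - z)) = c j + of_int m * \<eta>" for j m
  proof -
    have "p j + of_int m * w - z = (p j - z) + of_int m * w" by simp
    then have "\<i> / u * (p j + of_int m * w - z) = \<i> / u * (p j - z) + of_int m * (\<i> / u * w)"
      by (simp only: distrib_left mult.left_commute)
    moreover have "Re (of_int m * x) = of_int m * Re x" for x by simp
    ultimately show ?thesis by (simp only: c_def \<eta>_def plus_complex.sel)
  qed
  have cC: "\<bar>c j\<bar> < C" if "j \<in> {3, 4, 5}" for j using that by (auto simp: C_def)
  have hi: "zigzag z m = 0" if "of_int m * \<eta> \<ge> C" for m
  proof (rule zigzag_right)
    fix j :: nat assume "j \<in> {3, 4, 5}"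
    then show "0 < Re (\<i> / u * (p j + of_int m * w - z))" unfolding Re using cC[of j] that by linarith
  qed
  have lo: "zigzag z m = 1" if "of_int m * \<eta> \<le> - C" for m
  proof (rule zigzag_left)
    fix j :: nat assume "j \<in> {3, 4, 5}"
    then show "Re (\<i> / u * (p j + of_int m * w - z)) < 0" unfolding Re using cC[of j] that by linarith
  qed
  define M where "M = \<lceil>C / \<bar>\<eta>\<bar>\<rceil>"
  have M: "C \<le> of_int M * \<bar>\<eta>\<bar>"
  proof -
    have "C / \<bar>\<eta>\<bar> \<le> of_int M" unfolding M_def by (rule le_of_int_ceiling)
    then show ?thesis using \<eta>0 pos_divide_le_eq[of "\<bar>\<eta>\<bar>" C "of_int M"] by simp
  qed
  show ?thesis
  proof (rule that[of M])
    fix a b assume ab: "a \<le> - M" "M \<le> b"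
    have b: "C \<le> of_int b * \<bar>\<eta>\<bar>"
      using M ab(2) by (meson abs_ge_zero mult_right_mono of_int_le_iff order_trans)
    have "of_int M * \<bar>\<eta>\<bar> \<le> of_int (- a) * \<bar>\<eta>\<bar>"
      using ab(1) by (intro mult_right_mono) auto
    then have a: "of_int a * \<bar>\<eta>\<bar> \<le> - C" using M by simp
    show "\<bar>zigzag z b - zigzag z a\<bar> = 1"
    proof (cases "\<eta> > 0")
      case True
      then show ?thesis using hi[of b] lo[of a] a b by simp
    next
      case False
      then show ?thesis using lo[of b] hi[of a] a b by simp
    qed
  qed
qed

text \<open>The number of tiles over \<open>z\<close> in a large block of rows has absolute value 1,
  so it is 1 whatever the signs. Any two solutions lie in a common block and therefore
  agree.\<close>

lemma generic_covered_once:
  assumes "generic z"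
  shows "\<exists>!(e, k, m). pullback e k m z \<in> inside (path_image (hexagon_path p))"
proof -
  obtain \<sigma> :: int where \<sigma>: "\<sigma> = 1 \<or> \<sigma> = -1"
    "\<And>z a b. generic z \<Longrightarrow> a \<le> b \<Longrightarrow> finite (Sigma {a<..b} (covering z)) \<and>
       int (card (Sigma {a<..b} (covering z))) = \<sigma> * (zigzag z b - zigzag z a)"
    using sum_covering by blast
  obtain M where M: "\<And>a b. a \<le> - M \<Longrightarrow> M \<le> b \<Longrightarrow> \<bar>zigzag z b - zigzag z a\<bar> = 1"
    using zigzag_ends by blast
  have one: "card (Sigma {a<..b} (covering z)) = 1" if "a \<le> - M" "M \<le> b" "a \<le> b" for a b
  proof -
    have "int (card (Sigma {a<..b} (covering z))) = \<sigma> * (zigzag z b - zigzag z a)"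
      using \<sigma>(2)[OF assms that(3)] by simp
    then have "\<bar>int (card (Sigma {a<..b} (covering z)))\<bar> = 1"
      using M[OF that(1,2)] \<sigma>(1) by (auto simp: abs_mult)
    then show ?thesis by simp
  qed
  have mem: "(m, e, k) \<in> Sigma {a<..b} (covering z) \<longleftrightarrow>
    a < m \<and> m \<le> b \<and> pullback e k m z \<in> inside (path_image (hexagon_path p))" for a b m e k
    by (auto simp: covering_def)
  have "card (Sigma {- \<bar>M\<bar><..\<bar>M\<bar>} (covering z)) = 1" by (rule one) auto
  then obtain m e k where ex: "(m, e, k) \<in> Sigma {- \<bar>M\<bar><..\<bar>M\<bar>} (covering z)"
    by (metis card_1_singletonE insertI1 prod_cases3)
  show ?thesis
  proof (rule ex1I[of _ "(e, k, m)"])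
    show "case (e, k, m) of (e, k, m) \<Rightarrow> pullback e k m z \<in> inside (path_image (hexagon_path p))"
      using ex mem by simp
    fix y assume y: "case y of (e, k, m) \<Rightarrow> pullback e k m z \<in> inside (path_image (hexagon_path p))"
    obtain e' k' m' where y': "y = (e', k', m')" by (metis prod_cases3)
    \<comment> \<open>The blocks are open at the lower end; the added 1 keeps \<open>m\<close> and
      \<open>m'\<close> strictly above it.\<close>
    define L where "L = \<bar>M\<bar> + \<bar>m\<bar> + \<bar>m'\<bar> + 1"
    have "card (Sigma {- L<..L} (covering z)) = 1" by (rule one) (auto simp: L_def)
    then obtain x where x: "Sigma {- L<..L} (covering z) = {x}" by (metis card_1_singletonE)
    have "(m, e, k) \<in> Sigma {- L<..L} (covering z)" "(m', e', k') \<in> Sigma {- L<..L} (covering z)"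
      unfolding mem using ex mem y y' by (auto simp: L_def)
    then show "y = (e, k, m)" using x y' by auto
  qed
qed

end

section \<open>The orbit is a tiling of degree 3\<close>

text \<open>Every tile contains a disc of fixed radius around a marked point \<open>g T c\<close>.
  Disjoint interiors keep the marked points apart by that radius, and tiles meeting the ball have
  them in a bounded set.\<close>

lemma finite_tiles_meeting_ball:
  assumes p: "simple_hexagon p"
    and iso: "\<And>T. T \<in> \<T> \<Longrightarrow> \<exists>g. plane_isometry g \<and> T = move g (hexagon p)"
    and dj: "\<And>T T'. T \<in> \<T> \<Longrightarrow> T' \<in> \<T> \<Longrightarrow> T \<noteq> T' \<Longrightarrow> interior (region T) \<inter> interior (region T') = {}"
  shows "finite {T \<in> \<T>. region T \<inter> ball x r \<noteq> {}}" (is "finite ?F")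
proof -
  obtain c e where e: "e > 0" "ball c e \<subseteq> interior (region (hexagon p))"
    using interior_region_hexagon_nonempty[OF p] by (metis all_not_in_conv open_interior openE)
  obtain D where D: "\<And>y. y \<in> region (hexagon p) \<Longrightarrow> dist c y \<le> D"
    using compact_imp_bounded[OF compact_region_hexagon[OF p]] bounded_any_center by metis
  obtain g where g: "\<And>T. T \<in> \<T> \<Longrightarrow> plane_isometry (g T) \<and> T = move (g T) (hexagon p)"
    using iso by metis
  have gd: "dist (g T a) (g T b) = dist a b" if "T \<in> \<T>" for T a b
    using g[OF that] by (simp add: plane_isometry_def)
  have int: "interior (region T) = g T ` interior (region (hexagon p))" if "T \<in> \<T>" for T
    using g[OF that] interior_region_hexagon_compose[of "g T" p] p by (metis move_hexagon)
  have ball: "ball (g T c) e \<subseteq> interior (region T)" if "T \<in> \<T>" for T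
  proof
    fix y assume y: "y \<in> ball (g T c) e"
    have "bij (g T)" using g[OF that] plane_isometry_bij by blast
    then obtain y' where y': "y = g T y'" by (metis bij_pointE)
    then have "y' \<in> ball c e" using y gd[OF that] by simp
    then show "y \<in> interior (region T)" using e(2) y' int[OF that] by blast
  qed
  have sep: "T' = T" if "T \<in> \<T>" "T' \<in> \<T>" "norm (g T' c - g T c) < e" for T T'
  proof (rule ccontr)
    assume "T' \<noteq> T"
    moreover have "g T' c \<in> interior (region T)" using ball[OF that(1)] that(3)
      by (auto simp: dist_norm norm_minus_commute)
    moreover have "g T' c \<in> interior (region T')" using ball[OF that(2)] e(1) centre_in_ball by blast
    ultimately show False using dj[OF that(2,1)] by blast
  qed
  have "bounded ((\<lambda>T. g T c) ` ?F)"
  proof (rule boundedI[of _ "norm x + r + D"])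
    fix y assume "y \<in> (\<lambda>T. g T c) ` ?F"
    then obtain T a where T: "T \<in> \<T>" "y = g T c" "a \<in> region T" "a \<in> ball x r" by blast
    obtain a' where a': "a = g T a'" "a' \<in> region (hexagon p)"
      using T(3) g[OF T(1)] by (metis imageE move_def tile.sel(1))
    have "dist y a \<le> D" using D[OF a'(2)] gd[OF T(1)] T(2) a'(1) by simp
    moreover have "norm y \<le> norm x + dist x a + dist y a"
    proof -
      have "norm y = norm (x + (a - x) + (y - a))" by simp
      also have "\<dots> \<le> norm (x + (a - x)) + norm (y - a)" by (rule norm_triangle_ineq)
      also have "norm (x + (a - x)) \<le> norm x + norm (a - x)" by (rule norm_triangle_ineq)
      finally show ?thesis by (simp add: dist_norm norm_minus_commute)
    qed
    ultimately show "norm y \<le> norm x + r + D" using T(4) by simp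
  qed
  moreover have "uniform_discrete ((\<lambda>T. g T c) ` ?F)"
    unfolding uniform_discrete_def using sep e(1) by (auto simp: dist_norm)
  ultimately have "finite ((\<lambda>T. g T c) ` ?F)" using uniform_discrete_finite_iff by blast
  moreover have "inj_on (\<lambda>T. g T c) ?F" using sep e(1) by (auto simp: inj_on_def)
  ultimately show ?thesis by (rule finite_imageD)
qed

text \<open>Serves both the orbit, before it is known to cover the plane, and an arbitrary tiling of
  degree 3; hence covering is not assumed.\<close>

locale hexagon_packing =
  fixes \<T> :: "tile set"
  assumes hexagonal: "T \<in> \<T> \<Longrightarrow> \<exists>q. simple_hexagon q \<and> T = hexagon q"
    and disjoint: "T \<in> \<T> \<Longrightarrow> T' \<in> \<T> \<Longrightarrow> T \<noteq> T' \<Longrightarrow> interior (region T) \<inter> interior (region T') = {}"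
begin

lemma open_meets_interior:
  assumes "T \<in> \<T>" "open U" "U \<inter> region T \<noteq> {}" shows "U \<inter> interior (region T) \<noteq> {}"
  using hexagonal[OF assms(1)] open_meets_interior_hexagon assms by blast

lemma meets_interior_eq:
  assumes "T \<in> \<T>" "T' \<in> \<T>" "interior (region T) \<inter> region T' \<noteq> {}" shows "T = T'"
  using open_meets_interior[OF assms(2) open_interior assms(3)] disjoint[OF assms(1,2)] by blast

lemma on_side:
  assumes "T \<in> \<T>" "T' \<in> \<T>" "T \<noteq> T'" "x \<in> region T" "x \<in> region T'"
  obtains s where "s \<in> sides T" "x \<in> s"
proof -
  obtain q where q: "simple_hexagon q" "T = hexagon q" using hexagonal assms by blast
  have "x \<notin> interior (region T)" using meets_interior_eq[OF assms(1,2)] assms(3,5) by blast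
  then have "x \<in> \<Union> (sides T)" using hexagon_boundary(1)[OF q(1)] assms(4) q(2) by (metis UnE)
  then show ?thesis using that by blast
qed

text \<open>A further tile at \<open>x\<close> would have interior points in the disc that the tiles
  of \<open>F\<close> already fill.\<close>

lemma covered_neighbourhood:
  assumes "F \<subseteq> \<T>" "e > 0" "ball x e \<subseteq> \<Union> (region ` F)" "T \<in> \<T>" "x \<in> region T"
  shows "T \<in> F"
proof -
  have "ball x e \<inter> region T \<noteq> {}" using assms(2,5) centre_in_ball by blast
  then have "ball x e \<inter> interior (region T) \<noteq> {}" by (intro open_meets_interior assms(4)) auto
  then obtain T' where "T' \<in> F" "interior (region T) \<inter> region T' \<noteq> {}" using assms(3) by blast
  then show ?thesis using meets_interior_eq[of T T'] assms(1,4) by blast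
qed

lemma two_tiles_fill:
  assumes "T \<in> \<T>" "T' \<in> \<T>" "T \<noteq> T'" "s \<in> sides T" "s \<in> sides T'" "x \<in> s" "x \<notin> corners T"
  obtains e where "e > 0" "ball x e \<subseteq> \<Union> (region ` {T, T'})"
proof -
  obtain q q' where q: "simple_hexagon q" "T = hexagon q" "simple_hexagon q'" "T' = hexagon q'"
    using hexagonal assms by metis
  show ?thesis
    using shared_side_neighbourhood[OF q(1,3), of s x] disjoint[OF assms(1-3)] assms(4-) q that by auto
qed

lemma side_of_two_tiles:
  assumes "A \<in> \<T>" "B \<in> \<T>" "C \<in> \<T>" "s \<in> sides A" "s \<in> sides B" "s \<in> sides C"
  shows "A = B \<or> A = C \<or> B = C"
proof (rule ccontr)
  assume n: "\<not> ?thesis"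
  obtain a b c where q: "simple_hexagon a" "A = hexagon a" "simple_hexagon b" "B = hexagon b"
    "simple_hexagon c" "C = hexagon c" using hexagonal assms by metis
  show False
    using side_shared_by_at_most_two[OF q(1,3,5), of s] disjoint[OF assms(1,2)] disjoint[OF assms(1,3)]
      disjoint[OF assms(2,3)] assms(4-) q n by auto
qed

text \<open>At a point of a side that is not a corner of \<open>T\<close>, the tile and its
  neighbour across the side fill a disc, so any other tile there is this neighbour. What remains are
  points that are corners of both tiles.\<close>

lemma side_to_side_if_sides_shared:
  assumes shared: "\<And>T s. T \<in> \<T> \<Longrightarrow> s \<in> sides T \<Longrightarrow> \<exists>T'\<in>\<T>. T' \<noteq> T \<and> s \<in> sides T'"
  shows "side_to_side \<T>"
proof -
  have *: "\<exists>s. s \<in> sides T \<and> s \<in> sides T' \<and> x \<in> s"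
    if T: "T \<in> \<T>" "T' \<in> \<T>" "T \<noteq> T'" "x \<in> region T" "x \<in> region T'" "x \<notin> corners T" for T T' x
  proof -
    obtain s where s: "s \<in> sides T" "x \<in> s" using on_side[OF T(1-5)] by blast
    obtain T'' where T'': "T'' \<in> \<T>" "T'' \<noteq> T" "s \<in> sides T''" using shared[OF T(1) s(1)] by blast
    obtain e where e: "e > 0" "ball x e \<subseteq> \<Union> (region ` {T, T''})"
      using two_tiles_fill[OF T(1) T''(1) _ s(1) T''(3) s(2) T(6)] T''(2) by metis
    have "T' \<in> {T, T''}" using covered_neighbourhood[OF _ e T(2) T(5)] T(1) T''(1) by blast
    then show ?thesis using T(3) s T'' by blast
  qed
  have sub: "s \<subseteq> region T" if "T \<in> \<T>" "s \<in> sides T" for T s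
    using hexagonal[OF that(1)] side_subset_region that by blast
  have csub: "c \<in> region T" if cT: "T \<in> \<T>" "c \<in> corners T" for T c
  proof -
    obtain q where q: "simple_hexagon q" "T = hexagon q" using hexagonal[OF cT(1)] by blast
    then obtain i where "i < 6" "c = q i" using cT(2) by (auto simp: corners_hexagon)
    then show ?thesis using corner_in_hexagon_side(1)[of i q] sub[OF cT(1), of "hexagon_side q i"] q
      by (auto simp: sides_hexagon)
  qed
  show ?thesis unfolding side_to_side_def
  proof (intro ballI impI equalityI subsetI)
    fix T T' x assume T: "T \<in> \<T>" "T' \<in> \<T>" "T \<noteq> T'" and "x \<in> region T \<inter> region T'"
    then have x: "x \<in> region T" "x \<in> region T'" by auto
    show "x \<in> corners T \<inter> corners T' \<union> \<Union> (sides T \<inter> sides T')"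
      using *[OF T x] *[OF T(2,1) T(3)[symmetric] x(2,1)] by blast
  next
    fix T T' x assume T: "T \<in> \<T>" "T' \<in> \<T>" "T \<noteq> T'"
      and "x \<in> corners T \<inter> corners T' \<union> \<Union> (sides T \<inter> sides T')"
    then show "x \<in> region T \<inter> region T'" using sub csub by blast
  qed
qed

lemma vertex_degree_3:
  assumes T: "hexagon a \<in> \<T>" "hexagon b \<in> \<T>" "hexagon c \<in> \<T>"
    and d: "hexagon a \<noteq> hexagon b" "hexagon a \<noteq> hexagon c" "hexagon b \<noteq> hexagon c"
    and q: "simple_hexagon a" "simple_hexagon b" "simple_hexagon c"
    and at_v: "{s \<in> sides (hexagon a). v \<in> s} = {x, y}" "{s \<in> sides (hexagon b). v \<in> s} = {x, z}"
      "{s \<in> sides (hexagon c). v \<in> s} = {y, z}"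
  shows "vertex_degree \<T> v = 3"
proof -
  obtain e where e: "e > 0" "ball v e \<subseteq> region (hexagon a) \<union> region (hexagon b) \<union> region (hexagon c)"
    using three_hexagons_surround_vertex[OF q disjoint[OF T(1,2) d(1)] disjoint[OF T(1,3) d(2)]
        disjoint[OF T(2,3) d(3)] at_v] by blast
  let ?F = "{hexagon a, hexagon b, hexagon c}"
  have "D \<in> ?F" if "D \<in> \<T>" "v \<in> region D" for D
    by (rule covered_neighbourhood[OF _ e(1) _ that]) (use T e(2) in auto)
  moreover have "v \<in> region (hexagon a)" "v \<in> region (hexagon b)" "v \<in> region (hexagon c)"
    using side_subset_region[of x a] side_subset_region[of x b]
      side_subset_region[of y c] at_v by blast+
  ultimately have "{D \<in> \<T>. v \<in> region D} = ?F" using T by blast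
  then show ?thesis using d by (simp add: vertex_degree_def)
qed

end

section \<open>The tiles of the orbit and their neighbours\<close>

context translation_hexagon
begin

definition tiles :: "tile set" where
  "tiles = {move (motion e k m) (hexagon p) | e k m. True}"

lemma motion_tile: "move (motion e k m) (hexagon p) = hexagon (motion e k m \<circ> p)"
  by (rule move_hexagon[OF motion_isometry])

lemma motion_simple: "simple_hexagon (motion e k m \<circ> p)"
  by (rule simple_hexagon_compose[OF motion_isometry simple])

lemma motion_in_tiles: "hexagon (motion e k m \<circ> p) \<in> tiles"
  by (auto simp: tiles_def simp flip: motion_tile)

lemma tiles_cases:
  assumes "T \<in> tiles" obtains e k m where "T = hexagon (motion e k m \<circ> p)"
  using assms by (auto simp: tiles_def motion_tile)

lemma motion_interior:
  "z \<in> interior (region (hexagon (motion e k m \<circ> p))) \<longleftrightarrow> pullback e k m z \<in> inside (path_image (hexagon_path p))"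
  by (simp add: interior_region_hexagon_compose[OF motion_isometry simple]
      interior_region_hexagon[OF simple] mem_motion_image)

text \<open>An overlap would be open, hence contain a generic point, which is covered only
  once.\<close>

lemma motion_interiors_disjoint:
  assumes "(e, k, m) \<noteq> (e', k', m')"
  shows "interior (region (hexagon (motion e k m \<circ> p))) \<inter> interior (region (hexagon (motion e' k' m' \<circ> p))) = {}"
    (is "?U = {}")
proof (rule ccontr)
  assume "?U \<noteq> {}"
  then obtain z where z: "z \<in> ?U" "generic z"
    by (rule generic_dense[OF open_Int[OF open_interior open_interior]])
  then have "pullback e k m z \<in> inside (path_image (hexagon_path p))"
    "pullback e' k' m' z \<in> inside (path_image (hexagon_path p))" by (auto simp only: motion_interior Int_iff)
  then show False using generic_covered_once[OF z(2)] assms by auto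
qed

text \<open>Follows from disjoint nonempty interiors, so possible symmetries of the hexagon do no
  harm.\<close>

lemma motion_tile_inj:
  assumes "hexagon (motion e k m \<circ> p) = hexagon (motion e' k' m' \<circ> p)"
  shows "(e, k, m) = (e', k', m')"
  using motion_interiors_disjoint[of e k m e' k' m'] assms
    interior_region_hexagon_nonempty[OF motion_simple, of e k m] by auto

sublocale hexagon_packing tiles
proof
  fix T assume "T \<in> tiles"
  then show "\<exists>q. simple_hexagon q \<and> T = hexagon q" using tiles_cases motion_simple by metis
next
  fix T T' assume T: "T \<in> tiles" "T' \<in> tiles" "T \<noteq> T'"
  from T(1) obtain e k m where 1: "T = hexagon (motion e k m \<circ> p)" by (rule tiles_cases)
  from T(2) obtain e' k' m' where 2: "T' = hexagon (motion e' k' m' \<circ> p)" by (rule tiles_cases)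
  have "(e, k, m) \<noteq> (e', k', m')" using T(3) unfolding 1 2 by (metis prod.inject)
  then show "interior (region T) \<inter> interior (region T') = {}"
    unfolding 1 2 by (rule motion_interiors_disjoint)
qed

lemma tiles_congruent: "T \<in> tiles \<Longrightarrow> \<exists>g. plane_isometry g \<and> T = move g (hexagon p)"
  using motion_isometry by (auto simp: tiles_def)

text \<open>Locally there are finitely many tiles, all closed: an uncovered point would have an
  uncovered neighbourhood, which contains a generic point.\<close>

lemma tiles_cover: "(\<Union>T\<in>tiles. region T) = UNIV"
proof (rule ccontr)
  assume "(\<Union>T\<in>tiles. region T) \<noteq> UNIV"
  then obtain x where x: "x \<notin> (\<Union>T\<in>tiles. region T)" by blast
  let ?F = "{T \<in> tiles. region T \<inter> ball x 1 \<noteq> {}}"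
  have "finite ?F" by (rule finite_tiles_meeting_ball[OF simple tiles_congruent disjoint])
  moreover have "closed (region T)" if "T \<in> tiles" for T
    using hexagonal[OF that] compact_region_hexagon compact_imp_closed by blast
  ultimately have "closed (\<Union> (region ` ?F))" by (intro closed_UN) auto
  then have "open (ball x 1 - \<Union> (region ` ?F))" by (intro open_Diff) auto
  moreover have "x \<in> ball x 1 - \<Union> (region ` ?F)" using x by auto
  ultimately obtain z where z: "z \<in> ball x 1 - \<Union> (region ` ?F)" "generic z" using generic_dense by blast
  obtain e k m where "pullback e k m z \<in> inside (path_image (hexagon_path p))"
    using generic_covered_once[OF z(2)] by auto
  then have "z \<in> region (hexagon (motion e k m \<circ> p))" using motion_interior interior_subset by blast
  then show False using z(1) motion_in_tiles by blast
qed

lemma tiles_tiling: "tiling (hexagon p) tiles"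
  unfolding tiling_def using tiles_congruent tiles_cover disjoint by blast

lemma motion_compose:
  "motion e k m (motion e' k' m' x) =
   motion (e \<noteq> e') (if e then k - k' else k + k') (if e then m - m' else m + m') x"
  by (auto simp: motion_def algebra_simps)

lemma motion_compose_hexagon:
  "motion e k m \<circ> (motion e' k' m' \<circ> q) =
   motion (e \<noteq> e') (if e then k - k' else k + k') (if e then m - m' else m + m') \<circ> q"
  by (simp add: fun_eq_iff motion_compose)

lemma motion_o: "motion e k m \<circ> motion e' k' m' =
    motion (e \<noteq> e') (if e then k - k' else k + k') (if e then m - m' else m + m')"
  by (simp add: fun_eq_iff motion_compose)

lemma motion_corners:
  "motion True 0 0 (p 0) = p 1" "motion True 0 0 (p 1) = p 0"
  "motion True 1 0 (p 1) = p 2" "motion True 1 0 (p 2) = p 1"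
  "motion True 0 1 (p 3) = p 4" "motion True 0 1 (p 4) = p 3"
  "motion True (-1) 1 (p 4) = p 5" "motion True (-1) 1 (p 5) = p 4"
  "motion False 1 0 (p 5) = p 3" "motion False 1 0 (p 0) = p 2"
  "motion False (-1) 0 (p 3) = p 5" "motion False (-1) 0 (p 2) = p 0"
  "motion True 0 0 (p 5) = motion True 1 0 (p 3)"
  "motion True 0 1 (p 2) = motion True (-1) 1 (p 0)"
  using corner_2 corner_3 by (simp_all add: motion_def w_def algebra_simps)

text \<open>The first six equations name the neighbour of the base tile across each side. The last
  two say that the two turned neighbours at \<open>p 1\<close>, and likewise those at
  \<open>p 4\<close>, share the third side at that vertex.\<close>

lemma motion_sides:
  "hexagon_side (motion True 0 0 \<circ> p) 0 = hexagon_side p 0"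
  "hexagon_side (motion True 1 0 \<circ> p) 1 = hexagon_side p 1"
  "hexagon_side (motion False 1 0 \<circ> p) 5 = hexagon_side p 2"
  "hexagon_side (motion True 0 1 \<circ> p) 3 = hexagon_side p 3"
  "hexagon_side (motion True (-1) 1 \<circ> p) 4 = hexagon_side p 4"
  "hexagon_side (motion False (-1) 0 \<circ> p) 2 = hexagon_side p 5"
  "hexagon_side (motion True 0 0 \<circ> p) 5 = hexagon_side (motion True 1 0 \<circ> p) 2"
  "hexagon_side (motion True 0 1 \<circ> p) 2 = hexagon_side (motion True (-1) 1 \<circ> p) 5"
  unfolding hexagon_sides_simps o_apply motion_corners by (rule refl closed_segment_commute)+

lemma tile_side_shared:
  assumes "T \<in> tiles" "s \<in> sides T"
  shows "\<exists>T'\<in>tiles. T' \<noteq> T \<and> s \<in> sides T'"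
proof -
  from assms(1) obtain e k m where T: "T = hexagon (motion e k m \<circ> p)" by (rule tiles_cases)
  from assms(2) obtain i where i: "i < 6" "s = motion e k m ` hexagon_side p i"
    unfolding T sides_hexagon by (auto simp: hexagon_side_compose[OF motion_isometry])
  have *: ?thesis if "hexagon_side (motion e' k' m' \<circ> p) j = hexagon_side p i" "j < 6"
    "(e', k', m') \<noteq> (False, 0, 0)" for e' k' m' j
  proof -
    define T' where "T' = hexagon (motion e k m \<circ> (motion e' k' m' \<circ> p))"
    have "T' \<in> tiles" unfolding T'_def motion_compose_hexagon by (rule motion_in_tiles)
    moreover have "s = hexagon_side (motion e k m \<circ> (motion e' k' m' \<circ> p)) j"
      unfolding i(2) that(1)[symmetric] by (rule hexagon_side_compose[OF motion_isometry, symmetric])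
    then have "s \<in> sides T'" using that(2) by (simp add: T'_def sides_hexagon)
    moreover have "T' \<noteq> T"
    proof
      assume "T' = T"
      then have "(e \<noteq> e', if e then k - k' else k + k', if e then m - m' else m + m') = (e, k, m)"
        unfolding T'_def T motion_compose_hexagon by (rule motion_tile_inj)
      then show False using that(3) by (auto split: if_splits)
    qed
    ultimately show ?thesis by blast
  qed
  from i(1) show ?thesis
  proof (cases rule: less_6_cases)
    case 1 show ?thesis by (rule *[of True 0 0 0]) (simp_all only: 1 motion_sides, simp_all)
  next
    case 2 show ?thesis by (rule *[of True 1 0 1]) (simp_all only: 2 motion_sides, simp_all)
  next
    case 3 show ?thesis by (rule *[of False 1 0 5]) (simp_all only: 3 motion_sides, simp_all)
  next
    case 4 show ?thesis by (rule *[of True 0 1 3]) (simp_all only: 4 motion_sides, simp_all)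
  next
    case 5 show ?thesis by (rule *[of True "-1" 1 4]) (simp_all only: 5 motion_sides, simp_all)
  next
    case 6 show ?thesis by (rule *[of False "-1" 0 2]) (simp_all only: 6 motion_sides, simp_all)
  qed
qed

text \<open>Half-turns about sides 0 and 1 link corners 0, 1, 2; those about sides 3 and 4 link
  corners 3, 4, 5.\<close>

lemma vertex_orbits:
  assumes "v \<in> vertices tiles"
  obtains e k m where "v = motion e k m (p 1) \<or> v = motion e k m (p 4)"
proof -
  obtain e k m i where v: "i < 6" "v = motion e k m (p i)"
    using assms by (auto simp: vertices_def corners_hexagon elim!: tiles_cases)
  have *: thesis if "p i = motion e' k' m' (p j)" "j = 1 \<or> j = 4" for e' k' m' j
    using that(2) v(2) \<open>\<And>e k m. v = motion e k m (p 1) \<or> v = motion e k m (p 4) \<Longrightarrow> thesis\<close>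
    unfolding that(1) motion_compose by blast
  from v(1) show thesis
  proof (cases rule: less_6_cases)
    case 1 show ?thesis by (rule *[of True 0 0 1]) (simp_all only: 1 motion_corners, simp)
  next
    case 2 then show ?thesis using v(2) that by blast
  next
    case 3 show ?thesis by (rule *[of True 1 0 1]) (simp_all only: 3 motion_corners, simp)
  next
    case 4 show ?thesis by (rule *[of True 0 1 4]) (simp_all only: 4 motion_corners, simp)
  next
    case 5 then show ?thesis using v(2) that by blast
  next
    case 6 show ?thesis by (rule *[of True "-1" 1 4]) (simp_all only: 6 motion_corners, simp)
  qed
qed

text \<open>\<open>j\<close> and \<open>l\<close> are the labels of the vertex in the two other
  tiles there; \<open>x\<close>, \<open>y\<close>, \<open>z\<close> are the three sides issuing from
  it. The motion in front transports the check from the base tile to the whole orbit.\<close>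

lemma degree_3_at:
  assumes j: "i < 6" "j < 6" "l < 6"
    and c: "motion e1 k1 m1 (p j) = p i" "motion e2 k2 m2 (p l) = p i"
    and n: "(e1, k1, m1) \<noteq> (False, 0, 0)" "(e2, k2, m2) \<noteq> (False, 0, 0)" "(e1, k1, m1) \<noteq> (e2, k2, m2)"
    and s: "{hexagon_side p i, hexagon_side p ((i + 5) mod 6)} = {x, y}"
      "{hexagon_side (motion e1 k1 m1 \<circ> p) j, hexagon_side (motion e1 k1 m1 \<circ> p) ((j + 5) mod 6)} = {x, z}"
      "{hexagon_side (motion e2 k2 m2 \<circ> p) l, hexagon_side (motion e2 k2 m2 \<circ> p) ((l + 5) mod 6)} = {y, z}"
  shows "vertex_degree tiles (motion e k m (p i)) = 3"
proof -
  let ?g = "motion e k m"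
  let ?b = "?g \<circ> (motion e1 k1 m1 \<circ> p)" and ?c = "?g \<circ> (motion e2 k2 m2 \<circ> p)"
  have img: "{s \<in> sides (hexagon (?g \<circ> q)). ?g v \<in> s} = (`) ?g ` {s \<in> sides (hexagon q). v \<in> s}" for q v
  proof -
    have S: "sides (hexagon (?g \<circ> q)) = (`) ?g ` sides (hexagon q)"
      by (simp add: sides_hexagon image_image hexagon_side_compose[OF motion_isometry])
    show ?thesis
      unfolding S Compr_image_eq inj_image_mem_iff[OF plane_isometry_inj[OF motion_isometry]] by simp
  qed
  show ?thesis
  proof (rule vertex_degree_3[of "?g \<circ> p" ?b ?c])
    show "hexagon (?g \<circ> p) \<in> tiles" "hexagon ?b \<in> tiles" "hexagon ?c \<in> tiles"
      unfolding motion_compose_hexagon by (rule motion_in_tiles)+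
    show "simple_hexagon (?g \<circ> p)" "simple_hexagon ?b" "simple_hexagon ?c"
      unfolding motion_compose_hexagon by (rule motion_simple)+
    show "hexagon (?g \<circ> p) \<noteq> hexagon ?b"
      unfolding motion_compose_hexagon using n(1) by (auto dest!: motion_tile_inj split: if_splits)
    show "hexagon (?g \<circ> p) \<noteq> hexagon ?c"
      unfolding motion_compose_hexagon using n(2) by (auto dest!: motion_tile_inj split: if_splits)
    show "hexagon ?b \<noteq> hexagon ?c"
      unfolding motion_compose_hexagon using n(3) by (auto dest!: motion_tile_inj split: if_splits)
    show "{s \<in> sides (hexagon (?g \<circ> p)). ?g (p i) \<in> s} = {?g ` x, ?g ` y}"
      unfolding img sides_at_corner[OF simple j(1)] s(1) by simp
    show "{s \<in> sides (hexagon ?b). ?g (p i) \<in> s} = {?g ` x, ?g ` z}"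
      using sides_at_corner[OF motion_simple j(2), of e1 k1 m1] c(1) s(2) unfolding img by simp
    show "{s \<in> sides (hexagon ?c). ?g (p i) \<in> s} = {?g ` y, ?g ` z}"
      using sides_at_corner[OF motion_simple j(3), of e2 k2 m2] c(2) s(3) unfolding img by simp
  qed
qed

text \<open>The tiles at \<open>p 1\<close> meet there with their corners 1, 0, 2, those at
  \<open>p 4\<close> with corners 4, 3, 5, in accordance with the two angle sums.\<close>

lemma tiles_degree_3:
  assumes "v \<in> vertices tiles" shows "vertex_degree tiles v = 3"
proof -
  obtain e k m where "v = motion e k m (p 1) \<or> v = motion e k m (p 4)"
    using vertex_orbits[OF assms] by blast
  moreover have "vertex_degree tiles (motion e k m (p 1)) = 3"
  proof (rule degree_3_at[of 1 0 2 True 0 0 True 1 0 "hexagon_side p 0" "hexagon_side p 1"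
        "hexagon_side (motion True 0 0 \<circ> p) 5"])
    have "(1 + 5) mod 6 = (0::nat)" "(0 + 5) mod 6 = (5::nat)" "(2 + 5) mod 6 = (1::nat)" by simp_all
    note m = this
    show "{hexagon_side p 1, hexagon_side p ((1 + 5) mod 6)} = {hexagon_side p 0, hexagon_side p 1}"
      unfolding m by blast
    show "{hexagon_side (motion True 0 0 \<circ> p) 0, hexagon_side (motion True 0 0 \<circ> p) ((0 + 5) mod 6)} =
      {hexagon_side p 0, hexagon_side (motion True 0 0 \<circ> p) 5}"
      unfolding m motion_sides by blast
    show "{hexagon_side (motion True 1 0 \<circ> p) 2, hexagon_side (motion True 1 0 \<circ> p) ((2 + 5) mod 6)} =
      {hexagon_side p 1, hexagon_side (motion True 0 0 \<circ> p) 5}"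
      unfolding m motion_sides by blast
  qed (simp_all only: motion_corners, simp_all)
  moreover have "vertex_degree tiles (motion e k m (p 4)) = 3"
  proof (rule degree_3_at[of 4 3 5 True 0 1 True "-1" 1 "hexagon_side p 3" "hexagon_side p 4"
        "hexagon_side (motion True 0 1 \<circ> p) 2"])
    have "(4 + 5) mod 6 = (3::nat)" "(3 + 5) mod 6 = (2::nat)" "(5 + 5) mod 6 = (4::nat)" by simp_all
    note m = this
    show "{hexagon_side p 4, hexagon_side p ((4 + 5) mod 6)} = {hexagon_side p 3, hexagon_side p 4}"
      unfolding m by blast
    show "{hexagon_side (motion True 0 1 \<circ> p) 3, hexagon_side (motion True 0 1 \<circ> p) ((3 + 5) mod 6)} =
      {hexagon_side p 3, hexagon_side (motion True 0 1 \<circ> p) 2}"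
      unfolding m motion_sides by blast
    show "{hexagon_side (motion True (-1) 1 \<circ> p) 5, hexagon_side (motion True (-1) 1 \<circ> p) ((5 + 5) mod 6)} =
      {hexagon_side p 4, hexagon_side (motion True 0 1 \<circ> p) 2}"
      unfolding m motion_sides by blast
  qed (simp_all only: motion_corners, simp_all)
  ultimately show ?thesis by blast
qed

lemma tiles_degree3_tiling: "degree3_tiling p tiles"
  unfolding degree3_tiling_def
  using tiles_tiling side_to_side_if_sides_shared[OF tile_side_shared] tiles_degree_3 by blast

end

section \<open>Uniqueness\<close>

lemma halfturn_of_swapped_side':
  assumes q: "simple_hexagon q" and i: "i < 6" and g: "plane_isometry g" "plane_isometry g'"
    and sw: "g' (q i) = g (q ((i + 1) mod 6))" "g' (q ((i + 1) mod 6)) = g (q i)"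
    and disj: "interior (region (hexagon (g \<circ> q))) \<inter> interior (region (hexagon (g' \<circ> q))) = {}"
  shows "g' = g \<circ> (\<lambda>z. q i + q ((i + 1) mod 6) - z)"
proof -
  define h where "h = inv g \<circ> g'"
  have b: "bij g" by (rule plane_isometry_bij[OF g(1)])
  have h: "plane_isometry h" unfolding h_def by (intro plane_isometry_compose plane_isometry_inv g)
  have gh: "g \<circ> h = g'" using b by (simp add: h_def fun_eq_iff bij_is_surj surj_f_inv_f)
  have inv: "inv g (g x) = x" for x using b by (simp add: bij_is_inj)
  have "interior (region (hexagon q)) \<inter> interior (region (hexagon (h \<circ> q))) = {}"
  proof -
    have "g ` interior (region (hexagon q)) \<inter> g ` interior (region (hexagon (h \<circ> q))) = {}"
      using disj unfolding gh[symmetric] comp_assoc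
      by (simp add: interior_region_hexagon_compose g h q simple_hexagon_compose)
    then show ?thesis by blast
  qed
  then have "h = (\<lambda>z. q i + q ((i + 1) mod 6) - z)"
    by (intro halfturn_of_swapped_side[OF q i h]) (simp_all only: h_def o_apply sw inv)
  then show ?thesis using gh by simp
qed

section \<open>Hexagons whose side lengths exclude symmetries\<close>

locale asymmetric_hexagon = translation_hexagon +
  assumes length_0: "\<And>j. j < 6 \<Longrightarrow> j \<noteq> 0 \<Longrightarrow> side_length p 0 \<noteq> side_length p j"
    and length_1: "\<And>j. j < 6 \<Longrightarrow> j \<noteq> 1 \<Longrightarrow> side_length p 1 \<noteq> side_length p j"
    and length_34: "side_length p 3 \<noteq> side_length p 4"
begin

lemma common_side_length:
  assumes "plane_isometry g" "plane_isometry g'" "hexagon_side (g \<circ> p) i = hexagon_side (g' \<circ> p) j"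
  shows "side_length p i = side_length p j"
  using hexagon_side_eq_length[OF assms(3)] assms(1,2) by (simp add: side_length_compose)

text \<open>A side whose length occurs once can only be matched with the side of the same
  label.\<close>

lemma common_side_0:
  assumes "plane_isometry g" "plane_isometry g'" "hexagon_side (g \<circ> p) 0 \<in> sides (hexagon (g' \<circ> p))"
  shows "hexagon_side (g \<circ> p) 0 = hexagon_side (g' \<circ> p) 0"
  using assms common_side_length[OF assms(1,2)] length_0 unfolding sides_hexagon by fastforce

lemma common_side_1:
  assumes "plane_isometry g" "plane_isometry g'" "hexagon_side (g \<circ> p) 1 \<in> sides (hexagon (g' \<circ> p))"
  shows "hexagon_side (g \<circ> p) 1 = hexagon_side (g' \<circ> p) 1"
  using assms common_side_length[OF assms(1,2)] length_1 unfolding sides_hexagon by fastforce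

lemma corners_neq: "i < 6 \<Longrightarrow> j < 6 \<Longrightarrow> i \<noteq> j \<Longrightarrow> p i \<noteq> p j"
  using hexagon_corners_distinct[OF simple] by (auto dest: inj_onD)

text \<open>An isometry keeping the tile keeps sides 0 and 1 by their lengths, hence their common
  corner and both ends of side 0, so it is the identity.\<close>

lemma tile_isometry_unique:
  assumes g: "plane_isometry g" "plane_isometry g'" and eq: "hexagon (g \<circ> p) = hexagon (g' \<circ> p)"
  shows "g = g'"
proof -
  define h where "h = inv g \<circ> g'"
  have b: "bij g" by (rule plane_isometry_bij[OF g(1)])
  have h: "plane_isometry h" unfolding h_def by (intro plane_isometry_compose plane_isometry_inv g)
  have gh: "g \<circ> h = g'" using b by (simp add: h_def fun_eq_iff bij_is_surj surj_f_inv_f)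
  have "move g (hexagon (h \<circ> p)) = move g (hexagon p)"
    using eq by (simp add: move_hexagon[OF g(1)] gh flip: comp_assoc)
  then have "move (inv g) (move g (hexagon (h \<circ> p))) = move (inv g) (move g (hexagon p))" by simp
  then have hp: "hexagon (h \<circ> p) = hexagon p"
    unfolding move_compose using b by (simp add: bij_is_inj move_id)
  have idp: "plane_isometry id" by (simp add: plane_isometry_def)
  have "hexagon_side (h \<circ> p) 0 \<in> sides (hexagon (id \<circ> p))" "hexagon_side (h \<circ> p) 1 \<in> sides (hexagon (id \<circ> p))"
    using hp by (auto simp: sides_hexagon[of "h \<circ> p"] simp flip: hp)
  then have "hexagon_side (h \<circ> p) 0 = hexagon_side (id \<circ> p) 0" "hexagon_side (h \<circ> p) 1 = hexagon_side (id \<circ> p) 1"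
    using common_side_0[OF h idp] common_side_1[OF h idp] by blast+
  then have "{h (p 0), h (p 1)} = {p 0, p 1}" "{h (p 1), h (p 2)} = {p 1, p 2}"
    unfolding hexagon_sides_simps by simp_all
  then have "h (p 0) = p 0" "h (p 1) = p 1"
    using corners_neq[of 0 1] corners_neq[of 1 2] corners_neq[of 0 2] by (auto simp: doubleton_eq_iff)
  then have "h = id" using hp by (intro identity_of_fixed_side[OF simple _ h, of 0]) simp_all
  then show ?thesis using gh by simp
qed

end

section \<open>Local structure of an arbitrary tiling of degree 3\<close>

locale degree3 = asymmetric_hexagon +
  fixes \<T> :: "tile set"
  assumes degree3: "degree3_tiling p \<T>"
begin

text \<open>Following isometries instead of tiles keeps track of the labels; by
  \<open>tile_isometry_unique\<close> each tile has just one.\<close>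

definition placed :: "(complex \<Rightarrow> complex) \<Rightarrow> bool" where
  "placed g \<longleftrightarrow> plane_isometry g \<and> hexagon (g \<circ> p) \<in> \<T>"

lemma tile_placed:
  assumes "T \<in> \<T>" obtains g where "placed g" "T = hexagon (g \<circ> p)"
  using assms degree3 unfolding degree3_tiling_def tiling_def placed_def by (metis move_hexagon)

lemma placed_simple: "placed g \<Longrightarrow> simple_hexagon (g \<circ> p)"
  using simple_hexagon_compose[OF _ simple] by (simp add: placed_def)

sublocale other: hexagon_packing \<T>
proof
  fix T assume "T \<in> \<T>"
  then show "\<exists>q. simple_hexagon q \<and> T = hexagon q" using tile_placed placed_simple by metis
next
  fix T T' assume "T \<in> \<T>" "T' \<in> \<T>" "T \<noteq> T'"
  then show "interior (region T) \<inter> interior (region T') = {}"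
    using degree3 by (auto simp: degree3_tiling_def tiling_def)
qed

lemma cover: "(\<Union>T\<in>\<T>. region T) = UNIV"
  using degree3 by (simp add: degree3_tiling_def tiling_def)

lemma meet_side_to_side:
  assumes "T \<in> \<T>" "T' \<in> \<T>" "T \<noteq> T'" "x \<in> region T" "x \<in> region T'"
  shows "x \<in> corners T \<inter> corners T' \<union> \<Union> (sides T \<inter> sides T')"
proof -
  have "region T \<inter> region T' = corners T \<inter> corners T' \<union> \<Union> (sides T \<inter> sides T')"
    using degree3 assms(1-3) by (simp add: degree3_tiling_def side_to_side_def)
  then show ?thesis using assms(4,5) by (metis IntI)
qed

text \<open>If all other tiles missed the midpoint, by local finiteness a neighbourhood of it would
  lie in \<open>T\<close>, although it is a boundary point. So another tile contains it, and as it
  is no corner, side-to-side leaves only a common side.\<close>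

lemma side_shared:
  assumes T: "T \<in> \<T>" "s \<in> sides T"
  obtains T' where "T' \<in> \<T>" "T' \<noteq> T" "s \<in> sides T'"
proof -
  obtain q where q: "simple_hexagon q" "T = hexagon q" using other.hexagonal[OF T(1)] by blast
  obtain i where i: "i < 6" "s = hexagon_side q i" using T(2) q by (auto simp: sides_hexagon)
  define x where "x = midpoint (q i) (q ((i + 1) mod 6))"
  have x: "x \<in> hexagon_side q i" "x \<notin> corners T"
    using side_midpoint_not_corner[OF q(1) i(1)] q(2) by (simp_all add: x_def)
  have iso: "\<exists>g. plane_isometry g \<and> T' = move g (hexagon p)" if "T' \<in> \<T>" for T'
    using that degree3 by (auto simp: degree3_tiling_def tiling_def)
  let ?F = "{T' \<in> \<T>. region T' \<inter> ball x 1 \<noteq> {}} - {T}"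
  have "finite ?F" using finite_tiles_meeting_ball[OF simple iso other.disjoint] by blast
  moreover have "closed (region T')" if "T' \<in> \<T>" for T'
    using other.hexagonal[OF that] compact_region_hexagon compact_imp_closed by blast
  ultimately have cl: "closed (\<Union> (region ` ?F))" by (intro closed_UN) auto
  have "x \<in> \<Union> (region ` ?F)"
  proof (rule ccontr)
    assume n: "x \<notin> \<Union> (region ` ?F)"
    have "open (ball x 1 - \<Union> (region ` ?F))" using cl by (intro open_Diff) auto
    moreover have "ball x 1 - \<Union> (region ` ?F) \<subseteq> region T"
    proof
      fix y assume y: "y \<in> ball x 1 - \<Union> (region ` ?F)"
      have "y \<in> (\<Union>T\<in>\<T>. region T)" by (simp add: cover)
      then obtain T' where "T' \<in> \<T>" "y \<in> region T'" by blast
      then show "y \<in> region T" using y by blast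
    qed
    ultimately have "ball x 1 - \<Union> (region ` ?F) \<subseteq> interior (region T)" by (simp add: interior_maximal)
    moreover have "x \<in> ball x 1 - \<Union> (region ` ?F)" using n by simp
    ultimately have "x \<in> interior (region (hexagon q))" using q(2) by blast
    moreover have "x \<in> \<Union> (sides (hexagon q))" using x(1) i(1) by (auto simp: sides_hexagon)
    ultimately show False using hexagon_boundary(2)[OF q(1)] by blast
  qed
  then obtain T' where T': "T' \<in> \<T>" "T' \<noteq> T" "x \<in> region T'" by blast
  have "x \<in> region T" using side_subset_region x(1) T(2) i(2) q(2) by blast
  then have "x \<in> corners T \<inter> corners T' \<union> \<Union> (sides T \<inter> sides T')"
    using T(1) T' by (intro meet_side_to_side) auto
  then obtain s' where s': "s' \<in> sides T" "s' \<in> sides T'" "x \<in> s'" using x(2) by blast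
  then obtain j where j: "j < 6" "s' = hexagon_side q j" using q(2) by (auto simp: sides_hexagon)
  have "j = i" using hexagon_sides_meet_at_corner[OF q(1) j(1) i(1), of x] x s' j q(2)
    by (auto simp: corners_hexagon)
  then show ?thesis using that[OF T'(1,2)] s'(2) j(2) i(2) by simp
qed

text \<open>The degree counts tiles whose region contains \<open>v\<close>; this shows that all of
  them have a corner there.\<close>

lemma corner_shared:
  assumes "T \<in> \<T>" "T' \<in> \<T>" "v \<in> corners T" "v \<in> region T'"
  shows "v \<in> corners T'"
proof (cases "T = T'")
  case False
  obtain q q' where q: "simple_hexagon q" "T = hexagon q" "T' = hexagon q'"
    using other.hexagonal assms by metis
  obtain i where i: "i < 6" "v = q i" using assms(3) q by (auto simp: corners_hexagon)
  have "v \<in> region T"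
    using side_subset_region[of "hexagon_side q i" q] corner_in_hexagon_side(1)[OF i(1), of q] i q
    by (auto simp: sides_hexagon)
  then have "v \<in> corners T \<inter> corners T' \<union> \<Union> (sides T \<inter> sides T')"
    using assms False by (intro meet_side_to_side) auto
  then show ?thesis using corner_on_side_of_other[OF q(1), of _ q' v] assms(3) q by blast
qed (use assms in simp)

lemma two_sides_at_corner:
  assumes "T \<in> \<T>" "v \<in> corners T"
  obtains a b where "a \<noteq> b" "{s \<in> sides T. v \<in> s} = {a, b}"
proof -
  obtain q where q: "simple_hexagon q" "T = hexagon q" using other.hexagonal assms by blast
  obtain i where i: "i < 6" "v = q i" using assms(2) q by (auto simp: corners_hexagon)
  have "i \<noteq> (i + 5) mod 6" using i(1) by (cases rule: less_6_cases) simp_all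
  then have "hexagon_side q i \<noteq> hexagon_side q ((i + 5) mod 6)"
    using hexagon_side_inj[OF q(1) i(1), of "(i + 5) mod 6"] by auto
  then show ?thesis using that sides_at_corner[OF q(1) i(1)] q(2) i(2) by blast
qed

text \<open>\<open>A\<close>, \<open>B\<close>, \<open>C\<close> exhaust the three tiles at
  \<open>v\<close>. The second side of \<open>B\<close> at \<open>v\<close> needs another tile,
  which cannot be \<open>A\<close>, so it is shared with \<open>C\<close>.\<close>

lemma around_vertex:
  assumes A: "A \<in> \<T>" "v \<in> corners A" "{s \<in> sides A. v \<in> s} = {s1, s2}" "s1 \<noteq> s2"
    and B: "B \<in> \<T>" "B \<noteq> A" "s1 \<in> sides B" and C: "C \<in> \<T>" "C \<noteq> A" "s2 \<in> sides C"
  obtains t where "B \<noteq> C" "t \<noteq> s1" "t \<noteq> s2" "{s \<in> sides B. v \<in> s} = {s1, t}" "{s \<in> sides C. v \<in> s} = {s2, t}"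
proof -
  define V where "V = {T \<in> \<T>. v \<in> region T}"
  have "v \<in> vertices \<T>" using A by (auto simp: vertices_def)
  then have "card V = 3" using degree3 by (simp add: degree3_tiling_def vertex_degree_def V_def)
  have V_eq: "V = {X, Y, Z}" if "{X, Y, Z} \<subseteq> V" "X \<noteq> Y" "X \<noteq> Z" "Y \<noteq> Z" for X Y Z
  proof (rule card_subset_eq[symmetric])
    show "finite V" using \<open>card V = 3\<close> by (metis card.infinite zero_neq_numeral)
    show "card {X, Y, Z} = card V" using that \<open>card V = 3\<close> by simp
  qed (use that in simp)
  have inV: "T \<in> V" if "T \<in> \<T>" "s \<in> sides T" "v \<in> s" for T s
    using other.hexagonal[OF that(1)] side_subset_region that by (auto simp: V_def)
  have s: "s1 \<in> sides A" "s2 \<in> sides A" "v \<in> s1" "v \<in> s2" using A(3) by blast+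
  have ABC: "A \<in> V" "B \<in> V" "C \<in> V" using inV A(1) B C s by blast+
  have two: "{s \<in> sides T. v \<in> s} = {a, b}"
    if "T \<in> V" "a \<in> sides T" "v \<in> a" "b \<in> sides T" "v \<in> b" "a \<noteq> b" for T a b
  proof -
    have "T \<in> \<T>" "v \<in> corners T" using that(1) corner_shared[OF A(1) _ A(2)] by (auto simp: V_def)
    then obtain x y where xy: "x \<noteq> y" "{s \<in> sides T. v \<in> s} = {x, y}" by (rule two_sides_at_corner)
    have "a \<in> {s \<in> sides T. v \<in> s}" "b \<in> {s \<in> sides T. v \<in> s}" using that by auto
    then show ?thesis unfolding xy(2) using that(6) by auto
  qed
  \<comment> \<open>Otherwise \<open>A\<close> and \<open>B\<close> have the same two sides at
    \<open>v\<close>; a side of the third tile \<open>D\<close> would have to be one of these and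
    belong to three tiles.\<close>
  have BC: "B \<noteq> C"
  proof
    assume "B = C"
    then have B2: "{s \<in> sides B. v \<in> s} = {s1, s2}" using two[OF ABC(2) B(3) s(3) _ s(4) A(4)] C(3) by blast
    have "V \<noteq> {A, B}" using \<open>card V = 3\<close> B(2) by auto
    then obtain D where D: "D \<in> V" "D \<noteq> A" "D \<noteq> B" using ABC by blast
    then have Dc: "D \<in> \<T>" "v \<in> corners D" using corner_shared[OF A(1) _ A(2)] by (auto simp: V_def)
    obtain d d' where "{s \<in> sides D. v \<in> s} = {d, d'}" by (rule two_sides_at_corner[OF Dc])
    then have d: "d \<in> sides D" "v \<in> d" by blast+
    obtain E where E: "E \<in> \<T>" "E \<noteq> D" "d \<in> sides E" using side_shared[OF Dc(1) d(1)] by blast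
    have "E \<in> V" using inV[OF E(1,3) d(2)] .
    moreover have "V = {A, B, D}" using V_eq[of A B D] ABC D B(2) by blast
    ultimately have "d \<in> {s \<in> sides A. v \<in> s} \<or> d \<in> {s \<in> sides B. v \<in> s}" using E(2,3) d(2) by auto
    then have "d \<in> {s1, s2}" unfolding A(3) B2 by simp
    then have "d \<in> {s \<in> sides A. v \<in> s}" "d \<in> {s \<in> sides B. v \<in> s}" unfolding A(3) B2 by simp_all
    then have "d \<in> sides A" "d \<in> sides B" by simp_all
    then show False using other.side_of_two_tiles[OF A(1) B(1) Dc(1)] d(1) B(2) D by blast
  qed
  have V3: "V = {A, B, C}" using V_eq[of A B C] ABC BC B(2) C(2) by blast
  have "v \<in> corners B" using corner_shared[OF A(1) B(1) A(2)] ABC(2) by (simp add: V_def)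
  then obtain x y where xy: "x \<noteq> y" "{s \<in> sides B. v \<in> s} = {x, y}" by (rule two_sides_at_corner[OF B(1)])
  have "s1 \<in> {s \<in> sides B. v \<in> s}" using B(3) s(3) by simp
  then have "s1 = x \<or> s1 = y" unfolding xy(2) by simp
  then obtain t where t: "t \<noteq> s1" "{s \<in> sides B. v \<in> s} = {s1, t}" using xy by (metis insert_commute)
  then have tB: "t \<in> sides B" "v \<in> t" by blast+
  have n2: "s2 \<notin> sides B"
    using other.side_of_two_tiles[OF A(1) B(1) C(1), of s2] s C(3) B(2) C(2) BC by blast
  then have t2: "t \<noteq> s2" using tB by blast
  obtain E where E: "E \<in> \<T>" "E \<noteq> B" "t \<in> sides E" using side_shared[OF B(1) tB(1)] by blast
  have "E \<in> V" using inV[OF E(1,3) tB(2)] .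
  moreover have "E \<noteq> A"
  proof
    assume "E = A"
    then have "t \<in> {s \<in> sides A. v \<in> s}" using E(3) tB(2) by simp
    then show False unfolding A(3) using t(1) t2 by simp
  qed
  ultimately have "t \<in> sides C" using V3 E by blast
  then have "{s \<in> sides C. v \<in> s} = {s2, t}" using two[OF ABC(3) C(3) s(4) _ tB(2)] t2 by blast
  then show ?thesis using that BC t t2 by blast
qed

lemma placed_isometry: "placed g \<Longrightarrow> plane_isometry g"
  and placed_tile: "placed g \<Longrightarrow> hexagon (g \<circ> p) \<in> \<T>"
  by (simp_all add: placed_def)

lemma placed_neighbour:
  assumes "placed g" "i < 6"
  obtains g' where "placed g'" "hexagon (g' \<circ> p) \<noteq> hexagon (g \<circ> p)"
    "hexagon_side (g \<circ> p) i \<in> sides (hexagon (g' \<circ> p))"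
proof -
  have "hexagon_side (g \<circ> p) i \<in> sides (hexagon (g \<circ> p))" using assms(2) by (simp add: sides_hexagon)
  then obtain T' where "T' \<in> \<T>" "T' \<noteq> hexagon (g \<circ> p)" "hexagon_side (g \<circ> p) i \<in> sides T'"
    by (rule side_shared[OF placed_tile[OF assms(1)]])
  then show ?thesis using that tile_placed by metis
qed

lemma placed_corner: "i < 6 \<Longrightarrow> g (p i) \<in> corners (hexagon (g \<circ> p))"
  by (auto simp: corners_hexagon)

lemma placed_sides_at_corner:
  assumes "placed g" "i < 6"
  shows "{s \<in> sides (hexagon (g \<circ> p)). g (p i) \<in> s} = {hexagon_side (g \<circ> p) i, hexagon_side (g \<circ> p) ((i + 5) mod 6)}"
  using sides_at_corner[OF placed_simple[OF assms(1)] assms(2)] by simp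

lemma placed_side_inj:
  "placed g \<Longrightarrow> i < 6 \<Longrightarrow> j < 6 \<Longrightarrow> hexagon_side (g \<circ> p) i = hexagon_side (g \<circ> p) j \<Longrightarrow> i = j"
  using hexagon_side_inj[OF placed_simple] by blast

lemma placed_swapped:
  assumes "placed g" "placed g'" "hexagon (g \<circ> p) \<noteq> hexagon (g' \<circ> p)" "i < 6"
    "g' (p i) = g (p ((i + 1) mod 6))" "g' (p ((i + 1) mod 6)) = g (p i)"
  shows "g' = g \<circ> (\<lambda>z. p i + p ((i + 1) mod 6) - z)"
  using halfturn_of_swapped_side'[OF simple assms(4) placed_isometry placed_isometry assms(5,6)]
    other.disjoint[OF placed_tile placed_tile assms(3)] assms(1,2) by blast

text \<open>The neighbours across sides 0 and 1 attach by the sides of the same labels. If one of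
  them kept corner 1 in place, its second side there would be labelled 1 or 0 and hence, by the
  lengths, be that side of the other neighbour, which is already a side of the tile of
  \<open>g\<close>. So both exchange the ends of the shared side.\<close>

lemma placed_rotate_01:
  assumes g: "placed g"
  shows "placed (g \<circ> motion True 0 0)" "placed (g \<circ> motion True 1 0)"
proof -
  note gi = placed_isometry[OF g]
  obtain b where b: "placed b" "hexagon (b \<circ> p) \<noteq> hexagon (g \<circ> p)"
    "hexagon_side (g \<circ> p) 0 \<in> sides (hexagon (b \<circ> p))" using placed_neighbour[OF g, of 0] by auto
  obtain c where c: "placed c" "hexagon (c \<circ> p) \<noteq> hexagon (g \<circ> p)"
    "hexagon_side (g \<circ> p) 1 \<in> sides (hexagon (c \<circ> p))" using placed_neighbour[OF g, of 1] by auto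
  note bi = placed_isometry[OF b(1)] and ci = placed_isometry[OF c(1)]
  have b0: "hexagon_side (g \<circ> p) 0 = hexagon_side (b \<circ> p) 0" by (rule common_side_0[OF gi bi b(3)])
  have c1: "hexagon_side (g \<circ> p) 1 = hexagon_side (c \<circ> p) 1" by (rule common_side_1[OF gi ci c(3)])
  have m: "(1 + 5) mod 6 = (0::nat)" by simp
  have at: "{s \<in> sides (hexagon (g \<circ> p)). g (p 1) \<in> s} = {hexagon_side (g \<circ> p) 0, hexagon_side (g \<circ> p) 1}"
    using placed_sides_at_corner[OF g, of 1] unfolding m by auto
  have ne: "hexagon_side (g \<circ> p) 0 \<noteq> hexagon_side (g \<circ> p) 1" using placed_side_inj[OF g, of 0 1] by auto
  have corner: "g (p 1) \<in> corners (hexagon (g \<circ> p))" by (rule placed_corner) simp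
  obtain t where t: "t \<noteq> hexagon_side (g \<circ> p) 0" "t \<noteq> hexagon_side (g \<circ> p) 1"
    "{s \<in> sides (hexagon (b \<circ> p)). g (p 1) \<in> s} = {hexagon_side (g \<circ> p) 0, t}"
    "{s \<in> sides (hexagon (c \<circ> p)). g (p 1) \<in> s} = {hexagon_side (g \<circ> p) 1, t}"
    by (rule around_vertex[OF placed_tile[OF g] corner at ne placed_tile[OF b(1)] b(2,3) placed_tile[OF c(1)] c(2,3)])
  have tb: "t \<in> sides (hexagon (b \<circ> p))" and tc: "t \<in> sides (hexagon (c \<circ> p))" using t(3,4) by blast+
  have eb: "{g (p 0), g (p 1)} = {b (p 0), b (p 1)}" using b0 unfolding hexagon_sides_simps by simp
  have ec: "{g (p 1), g (p 2)} = {c (p 1), c (p 2)}" using c1 unfolding hexagon_sides_simps by simp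
  have "b (p 1) \<noteq> g (p 1)"
  proof
    assume eq: "b (p 1) = g (p 1)"
    have "{hexagon_side (g \<circ> p) 0, t} = {hexagon_side (b \<circ> p) 1, hexagon_side (b \<circ> p) 0}"
      using placed_sides_at_corner[OF b(1), of 1] unfolding m eq t(3) by simp
    then have "t = hexagon_side (b \<circ> p) 1" using t(1) b0 by (metis doubleton_eq_iff)
    then have "t = hexagon_side (c \<circ> p) 1" using common_side_1[OF bi ci] tc by blast
    then show False using t(2) c1 by simp
  qed
  then have sb: "b (p 0) = g (p 1)" "b (p 1) = g (p 0)" using eb by (auto simp: doubleton_eq_iff)
  have "c (p 1) \<noteq> g (p 1)"
  proof
    assume eq: "c (p 1) = g (p 1)"
    have "{hexagon_side (g \<circ> p) 1, t} = {hexagon_side (c \<circ> p) 1, hexagon_side (c \<circ> p) 0}"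
      using placed_sides_at_corner[OF c(1), of 1] unfolding m eq t(4) by simp
    then have "t = hexagon_side (c \<circ> p) 0" using t(2) c1 by (metis doubleton_eq_iff)
    then have "t = hexagon_side (b \<circ> p) 0" using common_side_0[OF ci bi] tb by blast
    then show False using t(1) b0 by simp
  qed
  then have sc: "c (p 1) = g (p 2)" "c (p 2) = g (p 1)" using ec by (auto simp: doubleton_eq_iff)
  have m0: "motion True 0 0 = (\<lambda>z. p 0 + p ((0 + 1) mod 6) - z)" by (simp add: fun_eq_iff motion_def)
  have two: "(1 + 1) mod 6 = (2::nat)" by simp
  have m1: "motion True 1 0 = (\<lambda>z. p 1 + p ((1 + 1) mod 6) - z)"
    unfolding two by (simp add: fun_eq_iff motion_def corner_2)
  have "b = g \<circ> motion True 0 0" unfolding m0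
    by (rule placed_swapped[OF g b(1) b(2)[symmetric]]) (use sb in simp_all)
  then show "placed (g \<circ> motion True 0 0)" using b(1) by simp
  have "c = g \<circ> motion True 1 0" unfolding m1
    by (rule placed_swapped[OF g c(1) c(2)[symmetric]]) (unfold two, use sc in simp_all)
  then show "placed (g \<circ> motion True 1 0)" using c(1) by simp
qed

text \<open>The two orders of composing the half-turns about sides 0 and 1.\<close>

lemma placed_translate_u:
  assumes "placed g" shows "placed (g \<circ> motion False 1 0)" "placed (g \<circ> motion False (-1) 0)"
  using placed_rotate_01(1)[OF placed_rotate_01(2)[OF assms]] placed_rotate_01(2)[OF placed_rotate_01(1)[OF assms]]
  by (simp_all add: comp_assoc motion_o)

lemma placed_translate_neq:
  assumes "placed g" "k \<noteq> 0" shows "hexagon (g \<circ> motion False k 0 \<circ> p) \<noteq> hexagon (g \<circ> p)"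
proof
  assume "hexagon (g \<circ> motion False k 0 \<circ> p) = hexagon (g \<circ> p)"
  then have "g \<circ> motion False k 0 = g"
    using tile_isometry_unique placed_isometry[OF assms(1)] plane_isometry_compose[OF _ motion_isometry] by blast
  then have "g (motion False k 0 0) = g 0" by (metis comp_apply)
  then have "motion False k 0 0 = 0" using plane_isometry_inj[OF placed_isometry[OF assms(1)]] by (simp add: inj_eq)
  then show False using u_nonzero assms(2) by (simp add: motion_def)
qed

lemma translate_side:
  assumes "plane_isometry g"
  shows "hexagon_side (g \<circ> motion False 1 0 \<circ> p) 5 = hexagon_side (g \<circ> p) 2"
    "hexagon_side (g \<circ> motion False (-1) 0 \<circ> p) 2 = hexagon_side (g \<circ> p) 5"
  unfolding comp_assoc hexagon_side_compose[OF assms] motion_sides by simp_all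

text \<open>The tile \<open>c\<close> across side 3 has at \<open>g (p 3)\<close> two sides with the
  lengths of side 3 or 4, which excludes its corners 0, 1, 2. Corners 3 and 5 would bring in its
  side 2 or 5, which is already shared within the strip of \<open>c\<close>. At the remaining corner
  4, \<open>length_34\<close> decides which side is which.\<close>

lemma placed_rotate_3:
  assumes g: "placed g" shows "placed (g \<circ> motion True 0 1)"
proof -
  note gi = placed_isometry[OF g]
  let ?s1 = "hexagon_side (g \<circ> p) 2" and ?s2 = "hexagon_side (g \<circ> p) 3"
  define b where "b = g \<circ> motion False 1 0"
  have b: "placed b" "hexagon (b \<circ> p) \<noteq> hexagon (g \<circ> p)"
    unfolding b_def using placed_translate_u[OF g] placed_translate_neq[OF g] by auto
  have b5: "hexagon_side (b \<circ> p) 5 = ?s1" unfolding b_def by (rule translate_side[OF gi])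
  then have bs: "?s1 \<in> sides (hexagon (b \<circ> p))" by (auto simp: sides_hexagon simp flip: b5)
  obtain c where c: "placed c" "hexagon (c \<circ> p) \<noteq> hexagon (g \<circ> p)" "?s2 \<in> sides (hexagon (c \<circ> p))"
    using placed_neighbour[OF g, of 3] by auto
  note bi = placed_isometry[OF b(1)] and ci = placed_isometry[OF c(1)]
  have m: "(3 + 5) mod 6 = (2::nat)" "(5 + 5) mod 6 = (4::nat)" by simp_all
  have at: "{s \<in> sides (hexagon (g \<circ> p)). g (p 3) \<in> s} = {?s1, ?s2}"
    using placed_sides_at_corner[OF g, of 3] unfolding m by auto
  have ne: "?s1 \<noteq> ?s2" using placed_side_inj[OF g, of 2 3] by auto
  have corner: "g (p 3) \<in> corners (hexagon (g \<circ> p))" by (rule placed_corner) simp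
  obtain t where t: "hexagon (b \<circ> p) \<noteq> hexagon (c \<circ> p)" "t \<noteq> ?s1" "t \<noteq> ?s2"
    "{s \<in> sides (hexagon (b \<circ> p)). g (p 3) \<in> s} = {?s1, t}"
    "{s \<in> sides (hexagon (c \<circ> p)). g (p 3) \<in> s} = {?s2, t}"
    by (rule around_vertex[OF placed_tile[OF g] corner at ne placed_tile[OF b(1)] b(2) bs placed_tile[OF c(1)] c(2,3)])
  have eq: "b (p 5) = g (p 3)" by (simp add: b_def motion_corners)
  have "{?s1, t} = {hexagon_side (b \<circ> p) 5, hexagon_side (b \<circ> p) 4}"
    using placed_sides_at_corner[OF b(1), of 5] unfolding m eq t(4) by simp
  then have t4: "t = hexagon_side (b \<circ> p) 4" using t(2) b5 by (metis doubleton_eq_iff)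
  then have tb: "t \<in> sides (hexagon (b \<circ> p))" by (auto simp: sides_hexagon)
  have "g (p 3) \<in> region (hexagon (c \<circ> p))"
    using side_subset_region[of ?s2 "c \<circ> p"] t(5) by blast
  then have "g (p 3) \<in> corners (hexagon (c \<circ> p))"
    by (rule corner_shared[OF placed_tile[OF g] placed_tile[OF c(1)] corner])
  then obtain k where k: "k < 6" "c (p k) = g (p 3)" by (auto simp: corners_hexagon)
  have ck: "{hexagon_side (c \<circ> p) k, hexagon_side (c \<circ> p) ((k + 5) mod 6)} = {?s2, t}"
    using placed_sides_at_corner[OF c(1) k(1)] unfolding k(2) t(5) by simp
  have len: "side_length p j = side_length p 3 \<or> side_length p j = side_length p 4"
    if "hexagon_side (c \<circ> p) j \<in> {?s2, t}" for j
    using that common_side_length[OF ci gi] common_side_length[OF ci bi] t4 by blast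
  \<comment> \<open>Here \<open>d\<close> will be a translate of \<open>c\<close>, sharing its side
    2 or 5. Were this side \<open>?s2\<close> or \<open>t\<close>, then \<open>d\<close> would be
    \<open>g\<close> or \<open>b\<close>, where the side carries label 3 or 4 instead of 5 or
    2.\<close>
  have no: False if d: "placed d" "hexagon (d \<circ> p) \<noteq> hexagon (c \<circ> p)" "hexagon_side (d \<circ> p) i = hexagon_side (c \<circ> p) j"
    "hexagon_side (c \<circ> p) j \<in> {?s2, t}" "i = 5 \<and> j = 2 \<or> i = 2 \<and> j = 5" for d i j
  proof -
    have i6: "i < 6" "j < 6" using d(5) by auto
    have ds: "hexagon_side (c \<circ> p) j \<in> sides (hexagon (d \<circ> p))"
      unfolding d(3)[symmetric] sides_hexagon using i6 by simp
    have cs: "hexagon_side (c \<circ> p) j \<in> sides (hexagon (c \<circ> p))"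
      unfolding sides_hexagon using i6 by simp
    have gs: "?s2 \<in> sides (hexagon (g \<circ> p))" by (auto simp: sides_hexagon)
    consider "hexagon_side (c \<circ> p) j = ?s2" | "hexagon_side (c \<circ> p) j = t" using d(4) by blast
    then show False
    proof cases
      case 1
      have "hexagon (d \<circ> p) = hexagon (g \<circ> p)"
        using other.side_of_two_tiles[OF placed_tile[OF d(1)] placed_tile[OF c(1)] placed_tile[OF g], of ?s2]
          ds cs gs d(2) c(2) 1 by auto
      then have "d = g" using tile_isometry_unique placed_isometry d(1) g by blast
      then have "i = 3" using placed_side_inj[OF g i6(1), of 3] d(3) 1 by simp
      then show False using d(5) by auto
    next
      case 2
      have "hexagon (d \<circ> p) = hexagon (b \<circ> p)"
        using other.side_of_two_tiles[OF placed_tile[OF d(1)] placed_tile[OF c(1)] placed_tile[OF b(1)], of t]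
          ds cs tb d(2) t(1) 2 by auto
      then have "d = b" using tile_isometry_unique placed_isometry d(1) b(1) by blast
      then have "i = 4" using placed_side_inj[OF b(1) i6(1), of 4] d(3) 2 t4 by simp
      then show False using d(5) by auto
    qed
  qed
  from k(1) have "k = 4"
  proof (cases rule: less_6_cases)
    case 1
    then have "hexagon_side (c \<circ> p) 0 \<in> {?s2, t}" using ck by blast
    then show ?thesis using len[of 0] length_0[of 3] length_0[of 4] by simp
  next
    case 2
    then have "hexagon_side (c \<circ> p) 1 \<in> {?s2, t}" using ck by blast
    then show ?thesis using len[of 1] length_1[of 3] length_1[of 4] by simp
  next
    case 3
    have "(2 + 5) mod 6 = (1::nat)" by simp
    then have "hexagon_side (c \<circ> p) 1 \<in> {?s2, t}" using ck unfolding 3 by auto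
    then show ?thesis using len[of 1] length_1[of 3] length_1[of 4] by simp
  next
    case 4
    have "hexagon_side (c \<circ> p) 2 \<in> {?s2, t}" using ck unfolding 4 m by blast
    then have False
      using no[of "c \<circ> motion False 1 0" 5 2] placed_translate_u(1)[OF c(1)] placed_translate_neq[OF c(1), of 1]
        translate_side(1)[OF ci] by auto
    then show ?thesis ..
  next
    case 6
    have "hexagon_side (c \<circ> p) 5 \<in> {?s2, t}" using ck unfolding 6 by blast
    then have False
      using no[of "c \<circ> motion False (-1) 0" 2 5] placed_translate_u(2)[OF c(1)] placed_translate_neq[OF c(1), of "-1"]
        translate_side(2)[OF ci] by auto
    then show ?thesis ..
  qed
  have "(4 + 5) mod 6 = (3::nat)" by simp
  then have "hexagon_side (c \<circ> p) 3 \<in> {?s2, t}" using ck unfolding \<open>k = 4\<close> by auto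
  moreover have "hexagon_side (c \<circ> p) 3 \<noteq> t"
    using common_side_length[OF ci bi, of 3 4] t4 length_34 by blast
  ultimately have "{c (p 3), c (p 4)} = {g (p 3), g (p 4)}" unfolding hexagon_sides_simps by simp
  then have sw: "c (p 3) = g (p 4)" "c (p 4) = g (p 3)" using k(2) \<open>k = 4\<close> by (auto simp: doubleton_eq_iff)
  have four: "(3 + 1) mod 6 = (4::nat)" by simp
  have m3: "motion True 0 1 = (\<lambda>z. p 3 + p ((3 + 1) mod 6) - z)"
    unfolding four by (simp add: fun_eq_iff motion_def w_def)
  have "c = g \<circ> motion True 0 1" unfolding m3
    by (rule placed_swapped[OF g c(1) c(2)[symmetric]]) (unfold four, use sw in simp_all)
  then show ?thesis using c(1) by simp
qed

lemma placed_translate_w: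
  assumes "placed g" shows "placed (g \<circ> motion False 0 1)" "placed (g \<circ> motion False 0 (-1))"
  using placed_rotate_01(1)[OF placed_rotate_3[OF assms]] placed_rotate_3[OF placed_rotate_01(1)[OF assms]]
  by (simp_all add: comp_assoc motion_o)

lemma placed_motion:
  assumes "placed g" shows "placed (g \<circ> motion e k m)"
proof -
  have 0: "g \<circ> motion False 0 0 = g" by (simp add: fun_eq_iff motion_def)
  have 1: "placed (g \<circ> motion False k 0)" for k
  proof (induction k rule: int_induct[where k = 0])
    case base then show ?case using assms 0 by simp
  next
    case (step1 i) then show ?case using placed_translate_u(1)[OF step1(2)] by (simp add: comp_def motion_compose)
  next
    case (step2 i) then show ?case using placed_translate_u(2)[OF step2(2)] by (simp add: comp_def motion_compose)
  qed
  have 2: "placed (g \<circ> motion False k m)" for k m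
  proof (induction m rule: int_induct[where k = 0])
    case base then show ?case using 1[of k] by (simp add: comp_def)
  next
    case (step1 i) then show ?case using placed_translate_w(1)[OF step1(2)] by (simp add: comp_def motion_compose)
  next
    case (step2 i) then show ?case using placed_translate_w(2)[OF step2(2)] by (simp add: comp_def motion_compose)
  qed
  show ?thesis
    using 2[of k m] placed_rotate_01(1)[OF 2[of k m]] by (cases e) (simp_all add: comp_assoc motion_o)
qed

text \<open>Propagation from one tile places a copy of the orbit inside the tiling; since the copy
  already covers the plane, there is no room for further tiles.\<close>

lemma isometric_to_tiles: "\<exists>g. plane_isometry g \<and> \<T> = move g ` tiles"
proof -
  obtain T0 where "T0 \<in> \<T>" using cover by blast
  then obtain g where g: "placed g" by (rule tile_placed)
  note gi = placed_isometry[OF g]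
  have sub: "move g ` tiles \<subseteq> \<T>"
  proof clarify
    fix T assume "T \<in> tiles"
    then obtain e k m where "T = hexagon (motion e k m \<circ> p)" by (rule tiles_cases)
    then have "move g T = hexagon (g \<circ> motion e k m \<circ> p)" by (simp add: move_hexagon[OF gi] comp_assoc)
    then show "move g T \<in> \<T>" using placed_tile[OF placed_motion[OF g]] by simp
  qed
  have "\<T> \<subseteq> move g ` tiles"
  proof
    fix T assume T: "T \<in> \<T>"
    obtain q where q: "simple_hexagon q" "T = hexagon q" using other.hexagonal[OF T] by blast
    obtain x where x: "x \<in> interior (region T)" using interior_region_hexagon_nonempty[OF q(1)] q(2) by blast
    obtain y where y: "x = g y" using plane_isometry_bij[OF gi] by (metis bij_pointE)
    have "y \<in> (\<Union>T\<in>tiles. region T)" by (simp add: tiles_cover)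
    then obtain T1 where T1: "T1 \<in> tiles" "y \<in> region T1" by blast
    then have "x \<in> region (move g T1)" using y by (simp add: move_def)
    then have "T = move g T1" using other.meets_interior_eq[OF T, of "move g T1"] sub T1(1) x by blast
    then show "T \<in> move g ` tiles" using T1(1) by blast
  qed
  then show ?thesis using sub gi by blast
qed

end

section \<open>Symmetries and torus quotient\<close>

lemma Arg2pi_sum_2pi:
  assumes "Arg2pi x + Arg2pi y + Arg2pi z = 2 * pi"
  shows "x * y * z = of_real (norm (x * y * z))"
proof -
  have "x * y * z = of_real (norm (x * y * z)) * exp (\<i> * of_real (Arg2pi x + Arg2pi y + Arg2pi z))"
    by (subst Arg2pi_eq[of x], subst Arg2pi_eq[of y], subst Arg2pi_eq[of z])
       (simp add: norm_mult exp_add algebra_simps)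
  also have "exp (\<i> * of_real (Arg2pi x + Arg2pi y + Arg2pi z)) = 1"
  proof -
    have "\<i> * of_real (Arg2pi x + Arg2pi y + Arg2pi z) = 2 * of_real pi * \<i>" unfolding assms by simp
    then show ?thesis by (simp only: exp_two_pi_i)
  qed
  finally show ?thesis by simp
qed

text \<open>The product of the three quotients telescopes to the quotient of sides 5 and 2, the two
  sign changes cancelling. The angle sum makes it positive and equal lengths make it 1. For a
  clockwise boundary the same applies to the inverses.\<close>

lemma hexagon_opposite_sides_parallel:
  assumes p: "simple_hexagon p"
    and angles: "interior_angle p 0 + interior_angle p 1 + interior_angle p 2 = 2 * pi"
    and len: "side_length p 2 = side_length p 5"
  shows "p 5 - p 0 = p 3 - p 2"
proof -
  have ne: "p 1 - p 0 \<noteq> 0" "p 2 - p 1 \<noteq> 0" "p 3 - p 2 \<noteq> 0" "p 5 - p 0 \<noteq> 0"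
    using simple_hexagon_arcs(1-6)[OF p] by auto
  have l: "norm (p 5 - p 0) = norm (p 3 - p 2)"
    using len by (simp add: side_length_def dist_norm norm_minus_commute)
  define a b c where "a = (p 5 - p 0) / (p 1 - p 0)" and "b = (p 0 - p 1) / (p 2 - p 1)"
    and "c = (p 1 - p 2) / (p 3 - p 2)"
  have abc: "a * b * c = (p 5 - p 0) / (p 3 - p 2)"
    using ne(1,2) unfolding a_def b_def c_def by (simp add: divide_simps) (simp add: algebra_simps)
  have n1: "norm (a * b * c) = 1" using l ne by (simp add: abc norm_divide)
  have i: "(0 + 1) mod 6 = (1::nat)" "(0 + 5) mod 6 = (5::nat)" "(1 + 1) mod 6 = (2::nat)"
    "(1 + 5) mod 6 = (0::nat)" "(2 + 1) mod 6 = (3::nat)" "(2 + 5) mod 6 = (1::nat)"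
    "0 mod 6 = (0::nat)" "1 mod 6 = (1::nat)" "2 mod 6 = (2::nat)" by simp_all
  have "a * b * c = 1"
  proof (cases "counterclockwise p")
    case True
    then have "Arg2pi a + Arg2pi b + Arg2pi c = 2 * pi"
      using angles unfolding interior_angle_def Let_def i a_def b_def c_def by simp
    then show ?thesis using Arg2pi_sum_2pi[of a b c] n1 by simp
  next
    case False
    have inv: "(p 1 - p 0) / (p 5 - p 0) = inverse a" "(p 2 - p 1) / (p 0 - p 1) = inverse b"
      "(p 3 - p 2) / (p 1 - p 2) = inverse c" by (simp_all add: a_def b_def c_def)
    have "Arg2pi (inverse a) + Arg2pi (inverse b) + Arg2pi (inverse c) = 2 * pi"
      using angles False unfolding interior_angle_def Let_def i inv by simp
    then have "inverse a * inverse b * inverse c = of_real (norm (inverse a * inverse b * inverse c))"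
      by (rule Arg2pi_sum_2pi)
    moreover have "inverse a * inverse b * inverse c = inverse (a * b * c)" by simp
    ultimately have "inverse (a * b * c) = of_real (norm (inverse (a * b * c)))" by metis
    then have "inverse (a * b * c) = 1" using n1 by (simp add: norm_inverse del: inverse_mult_distrib)
    then show ?thesis by (metis inverse_eq_1_iff)
  qed
  then show ?thesis using ne(3) abc by simp
qed

section \<open>Symmetries of the orbit and its quotient by the lattice\<close>

lemma symmetry_compose:
  assumes "symmetry \<T> f" "symmetry \<T> g" shows "symmetry \<T> (f \<circ> g)"
proof -
  have "move (f \<circ> g) ` \<T> = move f ` move g ` \<T>" by (simp add: image_image move_compose)
  then show ?thesis using assms by (simp add: symmetry_def plane_isometry_compose)
qed

text \<open>A torus tiling still determines the plane tiling above it, so plane tilings with equal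
  quotients coincide.\<close>

lemma union_of_orbits:
  assumes "0 \<in> \<Lambda>" "\<Lambda> \<subseteq> \<Lambda>'" "invariant_under \<Lambda>' \<T>"
  shows "\<Union> (snd (induced_torus_tiling \<Lambda> \<T>)) = \<T>"
proof
  show "\<Union> (snd (induced_torus_tiling \<Lambda> \<T>)) \<subseteq> \<T>"
  proof
    fix T assume "T \<in> \<Union> (snd (induced_torus_tiling \<Lambda> \<T>))"
    then obtain T' l where "T' \<in> \<T>" "l \<in> \<Lambda>'" "T = move ((+) l) T'"
      using assms(2) by (auto simp: induced_torus_tiling_def)
    then show "T \<in> \<T>" using assms(3) by (auto simp: invariant_under_def symmetry_def)
  qed
  have "T = move ((+) 0) T" for T by (cases T) (simp add: move_def)
  then show "\<T> \<subseteq> \<Union> (snd (induced_torus_tiling \<Lambda> \<T>))"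
    using assms(1) by (force simp: induced_torus_tiling_def)
qed

context translation_hexagon
begin

lemma motion_inverse:
  "motion e k m \<circ> motion e (if e then k else - k) (if e then m else - m) = id"
  by (auto simp: fun_eq_iff motion_compose) (simp_all add: motion_def)

lemma motion_symmetry: "symmetry tiles (motion e k m)"
proof -
  have sub: "move (motion e k m) ` tiles \<subseteq> tiles" for e k m
  proof clarify
    fix T assume "T \<in> tiles"
    then obtain e' k' m' where "T = hexagon (motion e' k' m' \<circ> p)" by (rule tiles_cases)
    then show "move (motion e k m) T \<in> tiles"
      by (simp only: move_hexagon[OF motion_isometry] motion_compose_hexagon motion_in_tiles)
  qed
  have "tiles \<subseteq> move (motion e k m) ` tiles"
  proof
    fix T assume T: "T \<in> tiles"
    let ?i = "motion e (if e then k else - k) (if e then m else - m)"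
    have "T = move (motion e k m) (move ?i T)" by (simp only: move_compose motion_inverse move_id)
    moreover have "move ?i T \<in> tiles" using sub T by blast
    ultimately show "T \<in> move (motion e k m) ` tiles" by blast
  qed
  then show ?thesis using sub motion_isometry by (simp add: symmetry_def set_eq_subset)
qed

lemma tiles_isohedral: "isohedral tiles"
  unfolding isohedral_def
proof (intro ballI)
  fix T T' assume "T \<in> tiles" "T' \<in> tiles"
  then obtain e k m e' k' m' where T: "T = move (motion e k m) (hexagon p)" "T' = move (motion e' k' m') (hexagon p)"
    by (auto simp: tiles_def)
  let ?i = "motion e (if e then k else - k) (if e then m else - m)"
  have "?i \<circ> motion e k m = id" by (auto simp: fun_eq_iff motion_compose) (simp_all add: motion_def)
  then have "move (motion e' k' m' \<circ> ?i) T = T'" unfolding T by (simp add: move_compose comp_assoc)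
  moreover have "symmetry tiles (motion e' k' m' \<circ> ?i)" by (intro symmetry_compose motion_symmetry)
  ultimately show "\<exists>g. symmetry tiles g \<and> move g T = T'" by blast
qed

definition lattice :: "complex set" where
  "lattice = {of_int k * u + of_int m * w | k m. True}"

lemma translation_motion: "(+) (of_int k * u + of_int m * w) = motion False k m"
  by (simp add: fun_eq_iff motion_def)

lemma periods_independent: "u \<noteq> w" "independent {u, w}"
proof -
  have w: "w \<notin> span {u}"
  proof
    assume "w \<in> span {u}"
    then obtain t where "w = t *\<^sub>R u" by (auto simp: span_singleton)
    then have "w / u = of_real t" using u_nonzero by (simp add: scaleR_conv_of_real)
    then show False using w_not_parallel by simp
  qed
  then show "u \<noteq> w" using span_base[of u "{u}"] by auto
  show "independent {u, w}" using w u_nonzero by (simp add: insert_commute[of u] independent_insert)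
qed

lemma plane_lattice_lattice: "plane_lattice lattice"
  unfolding plane_lattice_def lattice_def using periods_independent by blast

lemma tiles_periodic: "periodic tiles"
  unfolding periodic_def
proof (intro exI conjI)
  show "symmetry tiles ((+) u)" using motion_symmetry[of False 1 0] translation_motion[of 1 0] by simp
  show "symmetry tiles ((+) w)" using motion_symmetry[of False 0 1] translation_motion[of 0 1] by simp
qed (rule periods_independent)+

lemma tiles_invariant: "invariant_under lattice tiles"
  using motion_symmetry by (auto simp: invariant_under_def lattice_def translation_motion)

definition orbit :: "bool \<Rightarrow> tile set" where
  "orbit e = {hexagon (motion e k m \<circ> p) | k m. True}"

lemma lattice_orbit: "{move ((+) l) (hexagon (motion e k m \<circ> p)) | l. l \<in> lattice} = orbit e"
proof
  show "{move ((+) l) (hexagon (motion e k m \<circ> p)) | l. l \<in> lattice} \<subseteq> orbit e"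
    by (auto simp: lattice_def orbit_def translation_motion move_hexagon[OF motion_isometry] motion_compose_hexagon)
      blast
  show "orbit e \<subseteq> {move ((+) l) (hexagon (motion e k m \<circ> p)) | l. l \<in> lattice}"
  proof
    fix T assume "T \<in> orbit e"
    then obtain k' m' where T: "T = hexagon (motion e k' m' \<circ> p)" by (auto simp: orbit_def)
    let ?l = "of_int (k' - k) * u + of_int (m' - m) * w"
    have "move ((+) ?l) (hexagon (motion e k m \<circ> p)) = T"
      unfolding T translation_motion move_hexagon[OF motion_isometry] motion_compose_hexagon by simp
    moreover have "?l \<in> lattice" unfolding lattice_def by blast
    ultimately show "T \<in> {move ((+) l) (hexagon (motion e k m \<circ> p)) | l. l \<in> lattice}" by blast
  qed
qed

lemma torus_tiles_orbits: "torus_tiles (induced_torus_tiling lattice tiles) = {orbit False, orbit True}"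
proof -
  have "torus_tiles (induced_torus_tiling lattice tiles) =
    (\<lambda>(e, k, m). {move ((+) l) (hexagon (motion e k m \<circ> p)) | l. l \<in> lattice}) ` UNIV"
    by (auto simp: torus_tiles_def induced_torus_tiling_def tiles_def motion_tile image_iff)
  also have "\<dots> = orbit ` UNIV" unfolding lattice_orbit by (auto simp: image_iff)
  finally show ?thesis by (simp add: UNIV_bool)
qed

lemma orbits_distinct: "orbit False \<noteq> orbit True"
proof
  assume "orbit False = orbit True"
  moreover have "hexagon (motion False 0 0 \<circ> p) \<in> orbit False" by (auto simp: orbit_def)
  ultimately show False by (auto simp: orbit_def dest!: motion_tile_inj)
qed

end

section \<open>Minimality of the torus tiling\<close>

context asymmetric_hexagon
begin

text \<open>The translate of the base tile is a tile of the orbit, and the isometry producing a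
  given tile is unique, so the translation is one of the motions.\<close>

lemma translation_symmetry_in_lattice:
  assumes "symmetry tiles ((+) l)" shows "l \<in> lattice"
proof -
  have iso: "plane_isometry ((+) l)" using assms by (simp add: symmetry_def)
  have "motion False 0 0 \<circ> p = p" by (simp add: fun_eq_iff motion_def)
  then have "hexagon p \<in> tiles" using motion_in_tiles[of False 0 0] by simp
  then have "move ((+) l) (hexagon p) \<in> tiles" using assms by (auto simp: symmetry_def)
  then have "hexagon ((+) l \<circ> p) \<in> tiles" by (simp add: move_hexagon[OF iso])
  then obtain e k m where "hexagon ((+) l \<circ> p) = hexagon (motion e k m \<circ> p)" by (rule tiles_cases)
  then have eq: "(+) l = motion e k m" by (rule tile_isometry_unique[OF iso motion_isometry])
  \<comment> \<open>Comparing the values at 0 and 1 rules out a half-turn.\<close>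
  have "l + 0 = motion e k m 0" "l + 1 = motion e k m 1" by (simp_all only: eq)
  then have "\<not> e" by (auto simp: motion_def)
  then have "l = of_int k * u + of_int m * w" using \<open>l + 0 = motion e k m 0\<close> by (simp add: motion_def)
  then show ?thesis unfolding lattice_def by blast
qed

text \<open>A covered torus tiling comes from the same plane tiling, recovered as the union of the
  orbits, and from a lattice of translational symmetries, which cannot exceed
  \<open>lattice\<close>.\<close>

lemma torus_tiling_minimal: "minimal_torus_tiling (induced_torus_tiling lattice tiles)"
  unfolding minimal_torus_tiling_def
proof (intro allI impI)
  fix S' assume "torus_covers (induced_torus_tiling lattice tiles) S'"
  then obtain \<T> \<Lambda>' \<Lambda> where c: "\<Lambda>' \<subseteq> \<Lambda>" "invariant_under \<Lambda> \<T>"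
    "induced_torus_tiling lattice tiles = induced_torus_tiling \<Lambda>' \<T>" "S' = induced_torus_tiling \<Lambda> \<T>"
    unfolding torus_covers_def by blast
  have L: "\<Lambda>' = lattice" using c(3) by (simp add: induced_torus_tiling_def)
  have "of_int 0 * u + of_int 0 * w \<in> lattice" unfolding lattice_def by blast
  then have 0: "0 \<in> lattice" by simp
  have "\<T> = tiles"
    using union_of_orbits[OF 0 _ c(2)] union_of_orbits[OF 0 order_refl tiles_invariant] c(1,3) L by simp
  moreover have "\<Lambda> \<subseteq> lattice"
    using c(2) translation_symmetry_in_lattice unfolding \<open>\<T> = tiles\<close> by (auto simp: invariant_under_def)
  then have "\<Lambda> = lattice" using c(1) L by blast
  ultimately show "induced_torus_tiling lattice tiles = S'" using c(4) by simp
qed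

lemma torus_quotient:
  "\<exists>S. plane_covers tiles S \<and> minimal_torus_tiling S \<and> card (torus_tiles S) = 2"
proof (intro exI conjI)
  show "plane_covers tiles (induced_torus_tiling lattice tiles)"
    unfolding plane_covers_def using tiles_tiling plane_lattice_lattice tiles_invariant by blast
  show "card (torus_tiles (induced_torus_tiling lattice tiles)) = 2"
    using orbits_distinct by (simp add: torus_tiles_orbits)
qed (rule torus_tiling_minimal)

end

theorem theorem2p1:
  fixes p :: "nat \<Rightarrow> complex"
  assumes "simple_hexagon p"
    and "interior_angle p 0 + interior_angle p 1 + interior_angle p 2 = 2 * pi"
    and "interior_angle p 3 + interior_angle p 4 + interior_angle p 5 = 2 * pi"
    and "side_length p 2 = side_length p 5"
    and "\<forall>j<6. j \<noteq> 0 \<longrightarrow> side_length p 0 \<noteq> side_length p j"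
    and "\<forall>j<6. j \<noteq> 1 \<longrightarrow> side_length p 1 \<noteq> side_length p j"
    and "side_length p 3 \<noteq> side_length p 4"
  shows "\<exists>\<T>. degree3_tiling p \<T> \<and>
              (\<forall>\<T>'. degree3_tiling p \<T>' \<longrightarrow> (\<exists>g. plane_isometry g \<and> \<T>' = move g ` \<T>)) \<and>
              isohedral \<T> \<and> periodic \<T> \<and>
              (\<exists>S. plane_covers \<T> S \<and> minimal_torus_tiling S \<and> card (torus_tiles S) = 2)"
proof -
  interpret asymmetric_hexagon p
    using assms hexagon_opposite_sides_parallel[OF assms(1,2,4)] by unfold_locales auto
  have "\<exists>g. plane_isometry g \<and> \<T>' = move g ` tiles" if "degree3_tiling p \<T>'" for \<T>'
  proof -
    interpret degree3 p \<T>' using that by unfold_locales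
    show ?thesis by (rule isometric_to_tiles)
  qed
  then show ?thesis
    using tiles_degree3_tiling tiles_isohedral tiles_periodic torus_quotient by blast
qed

end
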